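(* Let $\mathbf X$ be a Euclidean space, let $f:\mathbf X\to[-\infty,+\infty]$ be prox-regular and subdifferentially continuous at $\bar x$ for $\bar v=0$, and assume that $f$ enjoys the minimal quadratic bundle property at $\bar x$ for $\bar v$. Then the following properties are equivalent: (a) The point $\bar x$ is a tilt-stable local minimizer of $f$. (b) There exists a minimal quadratic bundle $\bar q\in\mathrm{quad}\,f(\bar x,\bar v)$ such that for any $w\in\mathbf X\setminus\{0\}$ we have $\bar q(w)>0$.
   Context: Euclidean spaces are finite-dimensional; $\mathbb B_r(z)$ is the closed ball of radius $r$ centered at $z$. $\partial f$ is the limiting (Mordukhovich) subdifferential and $\mathrm{gph}\,\partial f=\{(x,v): v\in\partial f(x)\}$. Prox-regularity: $f$ is prox-regular at $\bar x$ for $\bar v$ if $f$ is finite at $\bar x$ and locally lower semicontinuous around $\bar x$ with $\bar v\in\partial f(\bar x)$, and there exist $\varepsilon>0$, $r\ge0$ such that $f(x')\ge f(x)+\langle v,x'-x\rangle-\frac r2\|x'-x\|^2$ for all $x'\in\mathbb B_\varepsilon(\bar x)$ whenever $(x,v)\in(\mathrm{gph}\,\partial f)\cap\mathbb B_\varepsilon(\bar x,\bar v)$ with $f(x)<f(\bar x)+\varepsilon$. Subdifferential continuity: $f$ is subdifferentially continuous at $\bar x$ for $\bar v$ if $(x^k,v^k)\to(\bar x,\bar v)$ with $v^k\in\partial f(x^k)$ implies $f(x^k)\to f(\bar x)$. Second subderivative: $\mathrm d^2f(x,v)(w)=\liminf_{t\searrow0,\,u\to w}\dfrac{f(x+tu)-f(x)-t\langle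 v,u\rangle}{\frac12t^2}$. GQF: a proper function $\varphi:\mathbf X\to[-\infty,+\infty]$ is a generalized quadratic form (GQF) if $\mathrm{dom}\,\varphi$ is a linear subspace and there is a linear operator $L:\mathrm{dom}\,\varphi\to\mathbf X$ with $\langle Lx,y\rangle=\langle x,Ly\rangle$ for all $x,y\in\mathrm{dom}\,\varphi$ such that $\varphi(x)=\langle Lx,x\rangle$ for all $x\in\mathrm{dom}\,\varphi$. Quadratic bundle: $\mathrm{quad}\,f(\bar x,\bar v)$ is the set of all GQFs $q$ on $\mathbf X$ for which there is a sequence $(x^k,v^k)\in\mathrm{gph}\,\partial f$ with $(x^k,v^k)\to(\bar x,\bar v)$, with $\mathrm d^2f(x^k,v^k)$ a GQF for each $k$, and such that $\mathrm d^2f(x^k,v^k)$ epi-converges to $q$ (the epigraphs converge in the Painlevé–Kuratowski sense). Minimal quadratic bundle: $f$ enjoys the minimal quadratic bundle property at $\bar x$ for $\bar v$ if there exists $\bar q\in\mathrm{quad}\,f(\bar x,\bar v)$ such that $q(w)\ge\bar q(w)$ for any $q\in\mathrm{quad}\,f(\bar x,\bar v)$ and any $w\in\mathbf X$; such a $\bar q$ is called a minimal quadratic bundle of $f$ at $\bar x$ for $\bar v$. Tilt stability: $\bar x$ is a tilt-stable local minimizer of $f$ if $f(\bar x)$ is finite and there is $\gamma>0$ such that the mapping $M_\gamma: v\mapsto\operatorname{argmin}\{f(x)-\langle v,x\rangle : x\in\mathbb B_\gamma(\bar x)\}$ is single-valued and Lipschitz continuous on a neighborhood of $0$, with $M_\gamma(0)=\{\bar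 x\}$. *)

theory Defs
  imports "HOL-Analysis.Analysis"
begin

text \<open>
  Functions into \<open>[-\<infinity>,\<infinity>]\<close> are rendered as functions into \<open>ereal\<close>. The two subdifferentials are
  empty at points where the function is not finite, so the differences \<open>f y - f x\<close> below are
  only ever used with \<open>f x\<close> finite and the convention for \<open>\<infinity> - \<infinity>\<close> plays no role.
\<close>

definition regular_subdifferential :: "('a::euclidean_space \<Rightarrow> ereal) \<Rightarrow> 'a \<Rightarrow> 'a set" where
  "regular_subdifferential f x =
     {v. \<bar>f x\<bar> \<noteq> \<infinity> \<and>
         0 \<le> Liminf (at x) (\<lambda>y. (f y - f x - ereal (v \<bullet> (y - x))) / ereal (norm (y - x)))}"

text \<open>The convergence in the definition of the limiting subdifferential is \<open>f\<close>-attentive.\<close>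

definition limiting_subdifferential :: "('a::euclidean_space \<Rightarrow> ereal) \<Rightarrow> 'a \<Rightarrow> 'a set" where
  "limiting_subdifferential f x =
     {v. \<bar>f x\<bar> \<noteq> \<infinity> \<and>
         (\<exists>xs vs. xs \<longlonglongrightarrow> x \<and> (\<lambda>k. f (xs k)) \<longlonglongrightarrow> f x \<and>
                  (\<forall>k::nat. vs k \<in> regular_subdifferential f (xs k)) \<and> vs \<longlonglongrightarrow> v)}"

definition gph_subdifferential :: "('a::euclidean_space \<Rightarrow> ereal) \<Rightarrow> ('a \<times> 'a) set" where
  "gph_subdifferential f = {(x, v). v \<in> limiting_subdifferential f x}"

definition lsc_around :: "('a::euclidean_space \<Rightarrow> ereal) \<Rightarrow> 'a \<Rightarrow> bool" where
  "lsc_around f xbar \<longleftrightarrow> (\<exists>\<delta>>0. \<forall>x\<in>ball xbar \<delta>. f x \<le> Liminf (at x) f)"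

definition prox_regular :: "('a::euclidean_space \<Rightarrow> ereal) \<Rightarrow> 'a \<Rightarrow> 'a \<Rightarrow> bool" where
  "prox_regular f xbar vbar \<longleftrightarrow>
     \<bar>f xbar\<bar> \<noteq> \<infinity> \<and> lsc_around f xbar \<and> vbar \<in> limiting_subdifferential f xbar \<and>
     (\<exists>\<epsilon>>0. \<exists>r\<ge>0. \<forall>(x, v) \<in> gph_subdifferential f \<inter> cball (xbar, vbar) \<epsilon>.
        f x < f xbar + ereal \<epsilon> \<longrightarrow>
        (\<forall>x'\<in>cball xbar \<epsilon>.
           f x' \<ge> f x + ereal (v \<bullet> (x' - x)) - ereal (r / 2 * (norm (x' - x))\<^sup>2)))"

definition subdifferentially_continuous ::
    "('a::euclidean_space \<Rightarrow> ereal) \<Rightarrow> 'a \<Rightarrow> 'a \<Rightarrow> bool" where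
  "subdifferentially_continuous f xbar vbar \<longleftrightarrow>
     (\<forall>xs vs. (\<lambda>k. (xs k, vs k)) \<longlonglongrightarrow> (xbar, vbar) \<and>
              (\<forall>k::nat. vs k \<in> limiting_subdifferential f (xs k))
        \<longrightarrow> (\<lambda>k. f (xs k)) \<longlonglongrightarrow> f xbar)"

text \<open>The filter \<open>nhds w\<close> is not punctured: \<open>u = w\<close> is allowed in the limit \<open>u \<rightarrow> w\<close>.\<close>

definition second_subderivative ::
    "('a::euclidean_space \<Rightarrow> ereal) \<Rightarrow> 'a \<Rightarrow> 'a \<Rightarrow> 'a \<Rightarrow> ereal" where
  "second_subderivative f x v w =
     Liminf (at_right 0 \<times>\<^sub>F nhds w)
       (\<lambda>(t::real, u). (f (x + t *\<^sub>R u) - f x - ereal (t * (v \<bullet> u))) / ereal (t\<^sup>2 / 2))"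

definition edom :: "('a \<Rightarrow> ereal) \<Rightarrow> 'a set" where
  "edom \<phi> = {x. \<phi> x < \<infinity>}"

definition proper_fun :: "('a \<Rightarrow> ereal) \<Rightarrow> bool" where
  "proper_fun \<phi> \<longleftrightarrow> (\<forall>x. \<phi> x \<noteq> -\<infinity>) \<and> edom \<phi> \<noteq> {}"

text \<open>
  The operator is only constrained on the domain of the form; its values elsewhere
  are irrelevant. It need not map the domain into itself.
\<close>

definition is_GQF :: "('a::euclidean_space \<Rightarrow> ereal) \<Rightarrow> bool" where
  "is_GQF \<phi> \<longleftrightarrow>
     proper_fun \<phi> \<and> subspace (edom \<phi>) \<and>
     (\<exists>L :: 'a \<Rightarrow> 'a.
        (\<forall>x\<in>edom \<phi>. \<forall>y\<in>edom \<phi>. L (x + y) = L x + L y) \<and>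
        (\<forall>c. \<forall>x\<in>edom \<phi>. L (c *\<^sub>R x) = c *\<^sub>R L x) \<and>
        (\<forall>x\<in>edom \<phi>. \<forall>y\<in>edom \<phi>. L x \<bullet> y = x \<bullet> L y) \<and>
        (\<forall>x\<in>edom \<phi>. \<phi> x = ereal (L x \<bullet> x)))"

definition epi :: "('a \<Rightarrow> ereal) \<Rightarrow> ('a \<times> real) set" where
  "epi \<phi> = {(x, \<alpha>). \<phi> x \<le> ereal \<alpha>}"

definition PK_outer_limit :: "(nat \<Rightarrow> 'a::topological_space set) \<Rightarrow> 'a set" where
  "PK_outer_limit C =
     {z. \<exists>r zs. strict_mono (r :: nat \<Rightarrow> nat) \<and> (\<forall>k. zs k \<in> C (r k)) \<and> zs \<longlonglongrightarrow> z}"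

definition PK_inner_limit :: "(nat \<Rightarrow> 'a::topological_space set) \<Rightarrow> 'a set" where
  "PK_inner_limit C = {z. \<exists>zs. (\<forall>\<^sub>F k in sequentially. zs k \<in> C k) \<and> zs \<longlonglongrightarrow> z}"

definition PK_converges :: "(nat \<Rightarrow> 'a::topological_space set) \<Rightarrow> 'a set \<Rightarrow> bool" where
  "PK_converges C D \<longleftrightarrow> PK_outer_limit C = D \<and> PK_inner_limit C = D"

definition epi_converges ::
    "(nat \<Rightarrow> 'a::topological_space \<Rightarrow> ereal) \<Rightarrow> ('a \<Rightarrow> ereal) \<Rightarrow> bool" where
  "epi_converges \<phi>s \<phi> \<longleftrightarrow> PK_converges (\<lambda>k. epi (\<phi>s k)) (epi \<phi>)"

definition quad_bundle ::
    "('a::euclidean_space \<Rightarrow> ereal) \<Rightarrow> 'a \<Rightarrow> 'a \<Rightarrow> ('a \<Rightarrow> ereal) set" where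
  "quad_bundle f xbar vbar =
     {q. is_GQF q \<and>
         (\<exists>xs vs. (\<forall>k::nat. (xs k, vs k) \<in> gph_subdifferential f) \<and>
                  (\<lambda>k. (xs k, vs k)) \<longlonglongrightarrow> (xbar, vbar) \<and>
                  (\<forall>k. is_GQF (second_subderivative f (xs k) (vs k))) \<and>
                  epi_converges (\<lambda>k. second_subderivative f (xs k) (vs k)) q)}"

definition is_minimal_quad_bundle ::
    "('a::euclidean_space \<Rightarrow> ereal) \<Rightarrow> 'a \<Rightarrow> 'a \<Rightarrow> ('a \<Rightarrow> ereal) \<Rightarrow> bool" where
  "is_minimal_quad_bundle f xbar vbar qbar \<longleftrightarrow>
     qbar \<in> quad_bundle f xbar vbar \<and> (\<forall>q\<in>quad_bundle f xbar vbar. \<forall>w. q w \<ge> qbar w)"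

definition minimal_quad_bundle_property ::
    "('a::euclidean_space \<Rightarrow> ereal) \<Rightarrow> 'a \<Rightarrow> 'a \<Rightarrow> bool" where
  "minimal_quad_bundle_property f xbar vbar \<longleftrightarrow>
     (\<exists>qbar. is_minimal_quad_bundle f xbar vbar qbar)"

definition tilt_argmin ::
    "('a::euclidean_space \<Rightarrow> ereal) \<Rightarrow> 'a \<Rightarrow> real \<Rightarrow> 'a \<Rightarrow> 'a set" where
  "tilt_argmin f xbar \<gamma> v =
     {x. is_arg_min (\<lambda>x. f x - ereal (v \<bullet> x)) (\<lambda>x. x \<in> cball xbar \<gamma>) x}"

definition tilt_stable_local_minimizer :: "('a::euclidean_space \<Rightarrow> ereal) \<Rightarrow> 'a \<Rightarrow> bool" where
  "tilt_stable_local_minimizer f xbar \<longleftrightarrow>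
     \<bar>f xbar\<bar> \<noteq> \<infinity> \<and>
     (\<exists>\<gamma>>0. tilt_argmin f xbar \<gamma> 0 = {xbar} \<and>
        (\<exists>V m \<kappa>. open V \<and> 0 \<in> V \<and> (\<forall>v\<in>V. tilt_argmin f xbar \<gamma> v = {m v}) \<and>
                 \<kappa>-lipschitz_on V m))"

end

theory Submission
  imports Defs
begin

text \<open>
  Let \<open>e\<close> be the Moreau envelope of \<open>f\<close> near the base point (localized to a ball, with a parameter \<open>s\<close> exceeding
  twice the prox-regularity modulus), \<open>P\<close> the proximal map and \<open>G = s (id - P)\<close> the Lipschitz gradient
  of \<open>e\<close>. By Rademacher's theorem \<open>G\<close> is differentiable almost everywhere, and wherever it has a
  derivative \<open>A\<close> at \<open>y\<close>, the matrix \<open>A\<close> is symmetric and the second subderivative of \<open>f\<close> at \<open>(P y, G y)\<close> is the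
  generalized quadratic form with proximal matrix \<open>J = I - A / s\<close>. Convergence of these matrices is
  epi-convergence of the forms, so every limit of them, as \<open>y\<close> tends to the base point, yields an element of the
  quadratic bundle. If all elements of the bundle are positive, compactness gives \<open>A \<ge> c I\<close> almost everywhere
  nearby, hence \<open>e\<close> is strongly convex there, which transfers to a uniform quadratic growth of \<open>f\<close> and to
  tilt stability.

  Conversely, tilt stability makes the conjugate of the localized \<open>f\<close> differentiable with Lipschitz gradient \<open>m\<close>;
  dually \<open>f\<close> grows quadratically, uniformly around the points \<open>m v\<close>. By prox-regularity and subdifferential
  continuity all subgradient pairs \<open>(x, v)\<close> nearby satisfy \<open>x = m v\<close>, so all second subderivatives there
  dominate \<open>c |w|\<^sup>2\<close>, and this bound passes to epi-limits.
\<close>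

subsection \<open>Rademacher's theorem\<close>

text \<open>Second-order information on the envelope exists only almost everywhere, as a Gateaux
  derivative of \<open>G\<close> at single points. Two consequences shape the proof. Symmetry of
  \<open>A\<close> is obtained by comparing proximal expansions at one point. And a segment along
  which \<open>G\<close> is to be integrated may lie in the exceptional null set; its endpoints are
  moved by a common small translation until almost all of it is good, and continuity of
  \<open>G\<close> undoes the move. The substitute for the fundamental theorem of calculus,
  \<open>integral_le_increment\<close>, serves there and in the proof of differentiability. The
  matrices \<open>J\<close> are preferred because the forms are infinite off subspaces that may
  change along the sequence, while the matrices stay bounded; prox-regularity bounds the forms below
  by \<open>- r * (norm w)\<^sup>2\<close>, so that their epigraphs cannot escape downwards in the
  limit. In the converse direction a subgradient near the base point is not a priori attached to a
  minimizer of a tilted function; solving \<open>w + \<sigma> m w = v + \<sigma> x\<close> with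
  \<open>\<sigma> > r\<close>, in the manner of Minty, shows that it is.\<close>

lemma sum_increments_le:
  fixes g :: "real \<Rightarrow> real" and l r :: "'i \<Rightarrow> real"
  assumes mono: "mono_on {a..b} g" and ab: "a \<le> b" and fin: "finite F"
    and sub: "\<And>i. i \<in> F \<Longrightarrow> a \<le> l i \<and> l i \<le> r i \<and> r i \<le> b"
    and disj: "pairwise (\<lambda>i j. disjnt {l i..r i} {l j..r j}) F"
  shows "(\<Sum>i\<in>F. g (r i) - g (l i)) \<le> g b - g a"
  using fin mono ab sub disj
proof (induction F arbitrary: b rule: finite_ranking_induct[where f = l])
  case empty
  then show ?case by (auto simp: mono_on_def)
next
  \<comment> \<open>The ranking by \<open>l\<close> adds the interval with the largest left endpoint
    last, so the others lie in \<open>{a..l x}\<close> and the induction hypothesis applies with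
    \<open>l x\<close> for \<open>b\<close>.\<close>
  case (insert x S)
  show ?case
  proof (cases "x \<in> S")
    case True
    then show ?thesis using insert by (simp add: insert_absorb)
  next
    case False
    have x: "a \<le> l x" "l x \<le> r x" "r x \<le> b" using insert.prems by auto
    have "r y \<le> l x" if "y \<in> S" for y
    proof -
      have "disjnt {l y..r y} {l x..r x}"
        using insert.prems(4) that False by (auto simp: pairwise_def)
      moreover have "l y \<le> l x" using insert.hyps that by auto
      ultimately show ?thesis using x unfolding disjnt_iff
        by (metis atLeastAtMost_iff linear order_refl)
    qed
    moreover have "mono_on {a..l x} g"
      using insert.prems(1) by (rule mono_on_subset) (use x in auto)
    ultimately have "(\<Sum>i\<in>S. g (r i) - g (l i)) \<le> g (l x) - g a"
      using insert.prems x by (intro insert.IH) (auto simp: pairwise_insert)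
    moreover have "g (r x) \<le> g b"
      using insert.prems(1) x by (auto simp: mono_on_def)
    ultimately show ?thesis using False insert.hyps by simp
  qed
qed

text \<open>A Vitali family of short intervals on which \<open>\<psi>\<close> is steep exhausts \<open>[a, b]\<close> up to
  small measure; by Henstock's lemma its finite subfamilies give nearly optimal Riemann sums.\<close>

lemma integral_le_increment:
  fixes \<psi> D :: "real \<Rightarrow> real"
  assumes ab: "a \<le> b" and lip: "K-lipschitz_on {a..b} \<psi>"
    and int: "D integrable_on {a..b}" and bdd: "\<And>x. x \<in> {a..b} \<Longrightarrow> \<bar>D x\<bar> \<le> M"
    and neg: "negligible N"
    and slope: "\<And>x e d. x \<in> {a<..<b} - N \<Longrightarrow> 0 < e \<Longrightarrow> 0 < d \<Longrightarrow>
        \<exists>s. s \<noteq> 0 \<and> \<bar>s\<bar> < d \<and> D x - e \<le> (\<psi> (x + s) - \<psi> x) / s"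
  shows "integral {a..b} D \<le> \<psi> b - \<psi> a"
proof (rule field_le_epsilon)
  fix \<epsilon>0 :: real assume "0 < \<epsilon>0"
  have K: "0 \<le> K" using lip by (rule lipschitz_on_nonneg)
  have M: "0 \<le> M" using bdd[of a] ab by force
  \<comment> \<open>The final error is \<open>\<epsilon>\<close> times this denominator:
    \<open>1\<close> from Henstock's lemma, \<open>b - a\<close> from the slope tolerance,
    \<open>K\<close> and \<open>M\<close> from the uncovered part of the interval.\<close>
  define \<epsilon> where "\<epsilon> = \<epsilon>0 / (1 + (b - a) + K + M)"
  have \<epsilon>: "0 < \<epsilon>" using \<open>0 < \<epsilon>0\<close> ab K M by (auto simp: \<epsilon>_def intro!: divide_pos_pos)
  have intc: "D integrable_on cbox a b" using int by simp
  obtain \<gamma> where \<gamma>: "gauge \<gamma>"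
    and hen: "\<And>p. p tagged_partial_division_of (cbox a b) \<Longrightarrow> \<gamma> fine p \<Longrightarrow>
             (\<Sum>(x,k)\<in>p. norm (measure lborel k *\<^sub>R D x - integral k D)) < \<epsilon>"
    using Henstock_lemma[OF intc \<epsilon>] by blast
  \<comment> \<open>An index \<open>(x, s)\<close> stands for the interval between \<open>x\<close>
    and \<open>x + s\<close>; \<open>s\<close> may have either sign, so the tag \<open>x\<close> is
    one of the two endpoints.\<close>
  define l r where "l = (\<lambda>(x::real, s::real). min x (x + s))" and "r = (\<lambda>(x::real, s::real). max x (x + s))"
  define I where "I = {(x, s). x \<in> {a<..<b} - N \<and> s \<noteq> 0 \<and> {l (x, s)..r (x, s)} \<subseteq> {a<..<b} \<inter> \<gamma> x \<and>
        D x - \<epsilon> \<le> (\<psi> (x + s) - \<psi> x) / s}"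
  define c where "c = (\<lambda>(x::real, s::real). x + s / 2)"
  define \<rho> where "\<rho> = (\<lambda>(x::real, s::real). \<bar>s\<bar> / 2)"
  have cb: "cball (c i) (\<rho> i) = {l i..r i}" for i
    by (cases i) (auto simp: c_def \<rho>_def l_def r_def cball_eq_atLeastAtMost abs_if field_simps)
  have rl: "r i - l i = \<bar>snd i\<bar>" for i
    by (cases i) (auto simp: l_def r_def)
  have pos: "0 < \<rho> i" if "i \<in> I" for i
    using that by (auto simp: I_def \<rho>_def)
  have vit: "\<exists>i. i \<in> I \<and> x \<in> cball (c i) (\<rho> i) \<and> \<rho> i < d" if x: "x \<in> {a<..<b} - N" and d: "0 < d" for x d
  proof -
    have "open ({a<..<b} \<inter> \<gamma> x)" "x \<in> {a<..<b} \<inter> \<gamma> x"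
      using \<gamma> x by (auto simp: gauge_def)
    then obtain \<eta> where \<eta>: "0 < \<eta>" "cball x \<eta> \<subseteq> {a<..<b} \<inter> \<gamma> x"
      using open_contains_cball by meson
    obtain s where s: "s \<noteq> 0" "\<bar>s\<bar> < min d \<eta>" "D x - \<epsilon> \<le> (\<psi> (x + s) - \<psi> x) / s"
      using slope[OF x \<epsilon>, of "min d \<eta>"] d \<eta> by auto
    have "{l (x, s)..r (x, s)} \<subseteq> cball x \<eta>"
      using s by (auto simp: l_def r_def cball_eq_atLeastAtMost)
    then have "(x, s) \<in> I" using x s \<eta> by (auto simp: I_def)
    moreover have "x \<in> cball (c (x, s)) (\<rho> (x, s))" unfolding cb by (auto simp: l_def r_def)
    ultimately show ?thesis using s d by (intro exI[of _ "(x, s)"]) (auto simp: \<rho>_def)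
  qed
  obtain C where C: "countable C" "C \<subseteq> I"
     "pairwise (\<lambda>i j. disjnt (cball (c i) (\<rho> i)) (cball (c j) (\<rho> j))) C"
     "negligible (({a<..<b} - N) - (\<Union>i\<in>C. cball (c i) (\<rho> i)))"
    by (rule Vitali_covering_theorem_cballs[of I \<rho> "{a<..<b} - N" c, OF pos vit]) blast+
  let ?A = "(\<lambda>i. {l i..r i}) ` C"
  have sub: "{l i..r i} \<subseteq> {a<..<b}" if "i \<in> C" for i
    using that C(2) by (auto simp: I_def)
  have lm: "\<Union>?A \<in> lmeasurable"
  proof (rule fmeasurableI2)
    show "{a..b} \<in> lmeasurable" by simp
    show "\<Union>?A \<subseteq> {a..b}" using sub by fastforce
    show "\<Union>?A \<in> sets lebesgue" using C(1) by (intro sets.countable_UN') auto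
  qed
  obtain D' where D': "D' \<subseteq> ?A" "finite D'" "measure lebesgue (\<Union>?A) - \<epsilon> < measure lebesgue (\<Union>D')"
  proof (rule measure_countable_Union_approachable[of ?A \<epsilon> "measure lebesgue {a..b}"])
    show "measure lebesgue (\<Union>D') \<le> measure lebesgue {a..b}" if "D' \<subseteq> ?A" "finite D'" for D'
    proof (rule measure_mono_fmeasurable)
      show "\<Union>D' \<subseteq> {a..b}" using sub that(1) by fastforce
      show "\<Union>D' \<in> sets lebesgue" using that by (intro sets.finite_Union) auto
    qed simp
  qed (use C(1) \<epsilon> in auto)
  obtain F where F: "F \<subseteq> C" "finite F" "D' = (\<lambda>i. {l i..r i}) ` F"
    using finite_subset_image[OF D'(2,1)] by blast
  have disj: "pairwise (\<lambda>i j. disjnt {l i..r i} {l j..r j}) F"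
    using C(3) F(1) unfolding cb by (rule pairwise_subset)
  have lr: "a \<le> l i \<and> l i \<le> r i \<and> r i \<le> b" if "i \<in> F" for i
  proof -
    have "l i \<le> r i" by (cases i) (auto simp: l_def r_def)
    moreover have "{l i..r i} \<subseteq> {a<..<b}" using sub F that by blast
    ultimately show ?thesis by auto
  qed
  have "b - a = measure lebesgue {a<..<b}" using ab by simp
  also have "\<dots> \<le> measure lebesgue (\<Union>?A)"
  proof -
    have "measure lebesgue (\<Union>?A) = measure lebesgue {a<..<b}"
    proof (rule measure_negligible_symdiff)
      show "negligible (({a<..<b} - \<Union>?A) \<union> (\<Union>?A - {a<..<b}))"
      proof (rule negligible_subset)
        show "negligible (({a<..<b} - N - (\<Union>i\<in>C. cball (c i) (\<rho> i))) \<union> N)"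
          using C(4) neg by (rule negligible_Un)
        show "({a<..<b} - \<Union>?A) \<union> (\<Union>?A - {a<..<b}) \<subseteq> ({a<..<b} - N - (\<Union>i\<in>C. cball (c i) (\<rho> i))) \<union> N"
          using sub unfolding cb by blast
      qed
    qed simp
    then show ?thesis by simp
  qed
  also have "\<dots> \<le> measure lebesgue (\<Union>D') + \<epsilon>" using D'(3) by simp
  also have "measure lebesgue (\<Union>D') = (\<Sum>i\<in>F. \<bar>snd i\<bar>)"
  proof -
    have "measure lebesgue (\<Union>D') = (\<Sum>i\<in>F. measure lebesgue {l i..r i})"
      unfolding F(3)
    proof (rule measure_UNION_AE[OF F(2)])
      show "pairwise (\<lambda>i j. AE x in lebesgue. x \<notin> {l i..r i} \<or> x \<notin> {l j..r j}) F"
        using disj by (auto simp: disjnt_iff pairwise_def intro!: AE_I2)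
    qed simp
    then show ?thesis using lr rl by (simp cong: sum.cong)
  qed
  finally have rest: "b - a - (\<Sum>i\<in>F. \<bar>snd i\<bar>) \<le> \<epsilon>" by simp

  \<comment> \<open>Adding \<open>K * x\<close> makes \<open>\<psi>\<close> monotone, so the
    increments over \<open>F\<close> exceed that over \<open>{a..b}\<close> by at most
    \<open>K\<close> times the uncovered length.\<close>
  have "mono_on {a..b} (\<lambda>x. \<psi> x + K * x)"
  proof (rule mono_onI)
    fix x y assume xy: "x \<in> {a..b}" "y \<in> {a..b}" "x \<le> y"
    have "\<bar>\<psi> x - \<psi> y\<bar> \<le> K * \<bar>x - y\<bar>"
      using lipschitz_onD[OF lip xy(1,2)] by (simp add: dist_real_def)
    then show "\<psi> x + K * x \<le> \<psi> y + K * y" using xy(3) by (simp add: abs_if algebra_simps split: if_splits)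
  qed
  from sum_increments_le[OF this ab F(2) lr disj]
  have "(\<Sum>i\<in>F. (\<psi> (r i) - \<psi> (l i)) + K * \<bar>snd i\<bar>) \<le> \<psi> b - \<psi> a + K * (b - a)"
    by (simp add: algebra_simps flip: rl)
  then have "(\<Sum>i\<in>F. \<psi> (r i) - \<psi> (l i)) \<le> \<psi> b - \<psi> a + K * (b - a - (\<Sum>i\<in>F. \<bar>snd i\<bar>))"
    by (simp add: sum.distrib sum_subtractf sum_distrib_left algebra_simps)
  also have "\<dots> \<le> \<psi> b - \<psi> a + K * \<epsilon>" using rest K by (simp add: mult_left_mono)
  finally have A: "(\<Sum>i\<in>F. \<psi> (r i) - \<psi> (l i)) \<le> \<psi> b - \<psi> a + K * \<epsilon>" .

  \<comment> \<open>The same argument for the indefinite integral: the uncovered part carries at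
    most \<open>M * \<epsilon>\<close> of the integral of \<open>D\<close>.\<close>
  have "mono_on {a..b} (\<lambda>x. M * x - integral {a..x} D)"
  proof (rule mono_onI)
    fix x y assume xy: "x \<in> {a..b}" "y \<in> {a..b}" "x \<le> y"
    have "integral {a..x} D + integral {x..y} D = integral {a..y} D"
      using xy by (intro Henstock_Kurzweil_Integration.integral_combine integrable_subinterval_real[OF int]) auto
    moreover have "integral {x..y} D \<le> integral {x..y} (\<lambda>_. M)"
      using xy bdd by (intro integral_le integrable_subinterval_real[OF int]) (auto simp: abs_le_iff)
    ultimately show "M * x - integral {a..x} D \<le> M * y - integral {a..y} D"
      using xy by (simp add: algebra_simps)
  qed
  from sum_increments_le[OF this ab F(2) lr disj]
  have "(\<Sum>i\<in>F. M * \<bar>snd i\<bar> - (integral {a..r i} D - integral {a..l i} D)) \<le> M * (b - a) - integral {a..b} D"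
    by (simp add: algebra_simps flip: rl)
  also have "(\<Sum>i\<in>F. M * \<bar>snd i\<bar> - (integral {a..r i} D - integral {a..l i} D))
     = (\<Sum>i\<in>F. M * \<bar>snd i\<bar> - integral {l i..r i} D)"
  proof (rule sum.cong[OF refl])
    fix i assume i: "i \<in> F"
    have "integral {a..l i} D + integral {l i..r i} D = integral {a..r i} D"
      using lr[OF i] by (intro Henstock_Kurzweil_Integration.integral_combine integrable_subinterval_real[OF int]) auto
    then show "M * \<bar>snd i\<bar> - (integral {a..r i} D - integral {a..l i} D) = M * \<bar>snd i\<bar> - integral {l i..r i} D" by simp
  qed
  finally have "integral {a..b} D \<le> (\<Sum>i\<in>F. integral {l i..r i} D) + M * (b - a - (\<Sum>i\<in>F. \<bar>snd i\<bar>))"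
    by (simp add: sum_subtractf sum_distrib_left algebra_simps)
  also have "\<dots> \<le> (\<Sum>i\<in>F. integral {l i..r i} D) + M * \<epsilon>" using rest M by (simp add: mult_left_mono)
  finally have B: "integral {a..b} D \<le> (\<Sum>i\<in>F. integral {l i..r i} D) + M * \<epsilon>" .

  define p where "p = (\<lambda>i. (fst i, {l i..r i})) ` F"
  have inj: "inj_on (\<lambda>i. (fst i, {l i..r i})) F"
  proof (rule inj_onI, rule ccontr)
    fix i j assume ij: "i \<in> F" "j \<in> F" "(fst i, {l i..r i}) = (fst j, {l j..r j})" "i \<noteq> j"
    then have "disjnt {l i..r i} {l j..r j}" using disj by (auto simp: pairwise_def)
    then show False using ij lr by (auto simp: disjnt_def)
  qed
  have part: "p tagged_partial_division_of cbox a b"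
    unfolding tagged_partial_division_of_def
  proof (intro conjI allI impI)
    show "finite p" unfolding p_def using F(2) by simp
    fix x k assume "(x, k) \<in> p"
    then obtain i where i: "i \<in> F" "x = fst i" "k = {l i..r i}" by (auto simp: p_def)
    show "x \<in> k" by (cases i) (auto simp: i l_def r_def)
    show "k \<subseteq> cbox a b" using lr[OF i(1)] i by auto
    show "\<exists>a b. k = cbox a b" using i by auto
  next
    fix x1 K1 x2 K2 assume "(x1, K1) \<in> p \<and> (x2, K2) \<in> p \<and> (x1, K1) \<noteq> (x2, K2)"
    then obtain i j where ij: "i \<in> F" "j \<in> F" "i \<noteq> j" "K1 = {l i..r i}" "K2 = {l j..r j}" by (auto simp: p_def)
    then have "disjnt K1 K2" using disj by (auto simp: pairwise_def)
    then show "interior K1 \<inter> interior K2 = {}"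
      using interior_subset by (fastforce simp: disjnt_def)
  qed
  have "\<gamma> fine p"
  proof -
    have "{l i..r i} \<subseteq> \<gamma> (fst i)" if "i \<in> F" for i
    proof -
      have "i \<in> I" using that F(1) C(2) by blast
      then show ?thesis by (cases i) (simp add: I_def)
    qed
    then show ?thesis by (auto simp: fine_def p_def)
  qed
  from hen[OF part this]
  have H: "(\<Sum>i\<in>F. \<bar>\<bar>snd i\<bar> * D (fst i) - integral {l i..r i} D\<bar>) < \<epsilon>"
    unfolding p_def using lr rl by (simp add: sum.reindex[OF inj] cong: sum.cong)
  have "(\<Sum>i\<in>F. integral {l i..r i} D) \<le> (\<Sum>i\<in>F. (\<psi> (r i) - \<psi> (l i)) + \<epsilon> * \<bar>snd i\<bar>
       + \<bar>\<bar>snd i\<bar> * D (fst i) - integral {l i..r i} D\<bar>)"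
  proof (rule sum_mono)
    fix i assume i: "i \<in> F"
    obtain x s where xs: "i = (x, s)" by force
    have "s \<noteq> 0" "D x - \<epsilon> \<le> (\<psi> (x + s) - \<psi> x) / s"
      using i F C(2) by (auto simp: I_def xs)
    then have "\<bar>s\<bar> * (D x - \<epsilon>) \<le> \<bar>s\<bar> * ((\<psi> (x + s) - \<psi> x) / s)"
      by (intro mult_left_mono) auto
    also have "\<dots> = \<psi> (r i) - \<psi> (l i)"
      using \<open>s \<noteq> 0\<close> by (cases "s > 0") (auto simp: xs r_def l_def abs_if)
    finally show "integral {l i..r i} D \<le> (\<psi> (r i) - \<psi> (l i)) + \<epsilon> * \<bar>snd i\<bar>
       + \<bar>\<bar>snd i\<bar> * D (fst i) - integral {l i..r i} D\<bar>"
      by (simp add: xs algebra_simps abs_if)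
  qed
  also have "\<dots> \<le> (\<psi> b - \<psi> a + K * \<epsilon>) + \<epsilon> * (b - a) + \<epsilon>"
  proof -
    have "(\<Sum>i\<in>F. M * \<bar>snd i\<bar>) \<le> M * (b - a)" if "0 \<le> M" for M
    proof -
      have "mono_on {a..b} (\<lambda>x::real. M * x)" using that by (auto intro!: mono_onI mult_left_mono)
      from sum_increments_le[OF this ab F(2) lr disj] show ?thesis by (simp add: algebra_simps flip: rl)
    qed
    from this[of \<epsilon>] show ?thesis using A H \<epsilon> by (simp add: sum.distrib)
  qed
  finally have "integral {a..b} D \<le> \<psi> b - \<psi> a + \<epsilon> * (1 + (b - a) + K + M)"
    using B by (simp add: algebra_simps)
  also have "\<epsilon> * (1 + (b - a) + K + M) = \<epsilon>0" using ab K M by (simp add: \<epsilon>_def)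
  finally show "integral {a..b} D \<le> \<psi> b - \<psi> a + \<epsilon>0" .
qed

section \<open>Integration along a fixed direction, and functions with vanishing box
  integrals\<close>

lemma nn_integral_along_direction:
  fixes g :: "'a::euclidean_space \<Rightarrow> ennreal"
  assumes [measurable]: "g \<in> borel_measurable borel"
  shows "(\<integral>\<^sup>+y. \<integral>\<^sup>+s. g (y + s *\<^sub>R w) * indicator {0..1::real} s \<partial>lborel \<partial>lborel) = (\<integral>\<^sup>+y. g y \<partial>lborel)"
proof -
  have "(\<integral>\<^sup>+y. \<integral>\<^sup>+s. g (y + s *\<^sub>R w) * indicator {0..1::real} s \<partial>lborel \<partial>lborel)
      = (\<integral>\<^sup>+s. \<integral>\<^sup>+y. g (y + s *\<^sub>R w) * indicator {0..1::real} s \<partial>lborel \<partial>lborel)"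
    by (rule lborel_pair.Fubini') measurable
  \<comment> \<open>Translation invariance: for each fixed \<open>s\<close> the inner integral is
    that of \<open>g\<close>, and \<open>s\<close> ranges over an interval of length one. This
    avoids coordinates adapted to \<open>w\<close>.\<close>
  also have "\<dots> = (\<integral>\<^sup>+s. (\<integral>\<^sup>+y. g y \<partial>lborel) * indicator {0..1::real} s \<partial>lborel)"
  proof (rule nn_integral_cong)
    fix s :: real
    have "(\<integral>\<^sup>+y. g y \<partial>lborel) = (\<integral>\<^sup>+y. g y \<partial>distr lborel borel ((+) (s *\<^sub>R w)))"
      by (simp add: lborel_distr_plus)
    also have "\<dots> = (\<integral>\<^sup>+y. g (y + s *\<^sub>R w) \<partial>lborel)"
      by (subst nn_integral_distr) (auto simp: add.commute)
    finally show "(\<integral>\<^sup>+y. g (y + s *\<^sub>R w) * indicator {0..1::real} s \<partial>lborel)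
        = (\<integral>\<^sup>+y. g y \<partial>lborel) * indicator {0..1::real} s"
      by (simp add: nn_integral_multc)
  qed
  also have "\<dots> = (\<integral>\<^sup>+y. g y \<partial>lborel)"
    by (simp add: nn_integral_cmult)
  finally show ?thesis .
qed

text \<open>\<open>nn_integral_along_direction\<close> for the indicator of \<open>N\<close>. It
  lets \<open>G_strongly_monotone\<close> pick starting points whose segment in direction
  \<open>w\<close> meets \<open>N\<close> in a null set.\<close>

lemma AE_along_direction:
  fixes N :: "'a::euclidean_space set"
  assumes N: "N \<in> null_sets lborel"
  shows "AE y in lborel. AE s in lborel. s \<in> {0..1::real} \<longrightarrow> y + s *\<^sub>R w \<notin> N"
proof -
  have [measurable]: "N \<in> sets borel" using N by auto
  have "(\<integral>\<^sup>+y. \<integral>\<^sup>+s. indicator N (y + s *\<^sub>R w) * indicator {0..1::real} s \<partial>lborel \<partial>lborel) = 0"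
    using N by (subst nn_integral_along_direction) auto
  then have "AE y in lborel. (\<integral>\<^sup>+s. indicator N (y + s *\<^sub>R w) * indicator {0..1::real} s \<partial>lborel) = 0"
    by (subst (asm) nn_integral_0_iff_AE) measurable
  then show ?thesis
  proof eventually_elim
    case (elim y)
    then have "AE s in lborel. indicator N (y + s *\<^sub>R w) * indicator {0..1::real} s = (0::ennreal)"
      by (subst (asm) nn_integral_0_iff_AE) measurable
    then show ?case by eventually_elim (auto simp: indicator_def split: if_splits)
  qed
qed

text \<open>A small multiple of \<open>h\<close> perturbs Lebesgue measure to the nonnegative
  density \<open>p\<close>. Vanishing box integrals leave the measure of boxes unchanged, so the two
  measures coincide, and uniqueness of densities gives \<open>p = 1\<close> almost
  everywhere.\<close>

lemma AE_zero_if_box_integrals_zero: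
  fixes h :: "'a::euclidean_space \<Rightarrow> real"
  assumes [measurable]: "h \<in> borel_measurable borel" and bdd: "\<And>y. \<bar>h y\<bar> \<le> C"
    and zero: "\<And>a b. (\<integral>y. indicator (box a b) y * h y \<partial>lborel) = 0"
  shows "AE y in lborel. h y = 0"
proof -
  define p where "p = (\<lambda>y. 1 + h y / (C + 1))"
  have C: "0 \<le> C" using bdd[of 0] by linarith
  have p0: "0 \<le> p y" for y
  proof -
    have "- (C + 1) \<le> h y" using bdd[of y] by linarith
    then show ?thesis using C by (simp add: p_def field_simps)
  qed
  have [measurable]: "p \<in> borel_measurable borel" unfolding p_def by measurable
  have "lborel = density lborel p"
  proof (rule lborel_eqI)
    fix l u :: 'a assume lu: "\<And>b. b \<in> Basis \<Longrightarrow> l \<bullet> b \<le> u \<bullet> b"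
    have I: "integrable lborel (indicator (box l u) :: 'a \<Rightarrow> real)"
      by (simp add: integrable_indicator_iff emeasure_lborel_box_eq)
    have Ih: "integrable lborel (\<lambda>y. indicator (box l u) y * h y)"
    proof (rule Bochner_Integration.integrable_bound)
      show "integrable lborel (\<lambda>y. C * indicator (box l u) y :: real)" using I by simp
      show "AE y in lborel. norm (indicator (box l u) y * h y) \<le> norm (C * indicator (box l u) y)"
        using bdd C by (auto simp: indicator_def)
    qed measurable
    have Ip: "(\<lambda>y. indicator (box l u) y * p y) = (\<lambda>y. indicator (box l u) y + (indicator (box l u) y * h y) / (C + 1))"
      by (auto simp: p_def algebra_simps)
    have "emeasure (density lborel p) (box l u) = (\<integral>\<^sup>+y. ennreal (indicator (box l u) y * p y) \<partial>lborel)"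
      by (subst emeasure_density) (auto intro!: nn_integral_cong simp: indicator_def)
    also have "\<dots> = ennreal (\<integral>y. indicator (box l u) y * p y \<partial>lborel)"
      using I Ih p0 unfolding Ip[symmetric]
      by (intro nn_integral_eq_integral) (auto simp: Ip)
    also have "(\<integral>y. indicator (box l u) y * p y \<partial>lborel) = measure lborel (box l u)"
      unfolding Ip using I Ih zero by simp
    finally show "emeasure (density lborel p) (box l u) = (\<Prod>b\<in>Basis. (u - l) \<bullet> b)"
      using lu by (simp add: emeasure_lborel_box emeasure_eq_ennreal_measure[symmetric] emeasure_lborel_box_eq)
  qed simp
  then have "density lborel (\<lambda>_. 1) = density lborel (\<lambda>y. ennreal (p y))" by (simp add: density_1)
  then have "AE y in lborel. 1 = ennreal (p y)"
    by (subst (asm) sigma_finite_measure.density_unique_iff[OF sigma_finite_lborel]) auto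
  then show ?thesis
  proof eventually_elim
    case (elim y)
    then have "p y = 1" using p0 by (metis ennreal_1 ennreal_inj zero_le_one)
    then show ?case using C by (simp add: p_def)
  qed
qed

section \<open>Upper derivates of Lipschitz functions\<close>

definition punctured_rats :: "nat \<Rightarrow> real set" where
  "punctured_rats n = {s \<in> \<rat>. s \<noteq> 0 \<and> \<bar>s\<bar> < inverse (Suc n)}"

text \<open>The two-sided limsup of the difference quotients as \<open>s\<close> tends to
  \<open>0\<close>. Only rational steps occur, so that the supremum is countable and measurability
  is inherited from \<open>F\<close>; for Lipschitz \<open>F\<close> nothing is lost, by
  \<open>eventually_diff_quot_le\<close>. Applied to \<open>- F\<close> it gives minus the
  liminf.\<close>

definition upper_derivate :: "('a::real_vector \<Rightarrow> real) \<Rightarrow> 'a \<Rightarrow> 'a \<Rightarrow> real" where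
  "upper_derivate F w y = (INF n. SUP s\<in>punctured_rats n. (F (y + s *\<^sub>R w) - F y) / s)"

lemma countable_punctured_rats [simp]: "countable (punctured_rats n)"
  by (rule countable_subset[OF _ countable_rat]) (auto simp: punctured_rats_def)

lemma punctured_rats_nonempty [simp]: "punctured_rats n \<noteq> {}"
proof -
  obtain q where "q \<in> \<rat>" "0 < q" "q < inverse (real (Suc n))"
    using Rats_dense_in_real[of 0 "inverse (real (Suc n))"] by auto
  then show ?thesis by (auto simp: punctured_rats_def)
qed

context
  fixes F :: "'a::real_normed_vector \<Rightarrow> real" and K :: real
  assumes lip: "K-lipschitz_on UNIV F"
begin

lemma diff_quot_le: "\<bar>(F (y + s *\<^sub>R w) - F y) / s\<bar> \<le> K * norm w"
proof (cases "s = 0")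
  case True
  then show ?thesis using lipschitz_on_nonneg[OF lip] by simp
next
  case False
  have "\<bar>F (y + s *\<^sub>R w) - F y\<bar> \<le> K * (\<bar>s\<bar> * norm w)"
    using lipschitz_onD[OF lip, of "y + s *\<^sub>R w" y] by (simp add: dist_norm)
  then show ?thesis using False by (simp add: abs_divide field_simps)
qed

lemma bdd_above_diff_quot: "bdd_above ((\<lambda>s. (F (y + s *\<^sub>R w) - F y) / s) ` S)"
  using diff_quot_le by (intro bdd_aboveI2[of _ _ "K * norm w"]) (metis abs_le_D1)

lemma SUP_diff_quot_ge: "- (K * norm w) \<le> (SUP s\<in>punctured_rats n. (F (y + s *\<^sub>R w) - F y) / s)"
proof -
  obtain s where s: "s \<in> punctured_rats n" using punctured_rats_nonempty by blast
  have "- (K * norm w) \<le> (F (y + s *\<^sub>R w) - F y) / s"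
    using diff_quot_le[of y s w] unfolding abs_le_iff by linarith
  also have "\<dots> \<le> (SUP s\<in>punctured_rats n. (F (y + s *\<^sub>R w) - F y) / s)"
    by (rule cSUP_upper[OF s bdd_above_diff_quot])
  finally show ?thesis .
qed

lemma bdd_below_SUP_diff_quot:
  "bdd_below (range (\<lambda>n. SUP s\<in>punctured_rats n. (F (y + s *\<^sub>R w) - F y) / s))"
  using SUP_diff_quot_ge by (intro bdd_belowI2)

lemma upper_derivate_le: "upper_derivate F w y \<le> (SUP s\<in>punctured_rats n. (F (y + s *\<^sub>R w) - F y) / s)"
  unfolding upper_derivate_def by (rule cINF_lower[OF bdd_below_SUP_diff_quot]) simp

lemma upper_derivate_bound: "\<bar>upper_derivate F w y\<bar> \<le> K * norm w"
proof -
  have "(SUP s\<in>punctured_rats 0. (F (y + s *\<^sub>R w) - F y) / s) \<le> K * norm w"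
    by (intro cSUP_least abs_le_D1[OF diff_quot_le]) simp
  then have "upper_derivate F w y \<le> K * norm w" using upper_derivate_le[of w y 0] by linarith
  moreover have "- (K * norm w) \<le> upper_derivate F w y"
    unfolding upper_derivate_def by (intro cINF_greatest SUP_diff_quot_ge) simp
  ultimately show ?thesis by simp
qed

lemma upper_derivate_approached:
  assumes "0 < e" "0 < d"
  shows "\<exists>s. s \<noteq> 0 \<and> \<bar>s\<bar> < d \<and> upper_derivate F w y - e \<le> (F (y + s *\<^sub>R w) - F y) / s"
proof -
  obtain n where n: "inverse (real (Suc n)) < d" using assms(2) reals_Archimedean by blast
  have "upper_derivate F w y - e < (SUP s\<in>punctured_rats n. (F (y + s *\<^sub>R w) - F y) / s)"
    using upper_derivate_le[of w y n] assms(1) by linarith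
  then obtain s where "s \<in> punctured_rats n" "upper_derivate F w y - e < (F (y + s *\<^sub>R w) - F y) / s"
    using less_cSUP_iff[OF punctured_rats_nonempty bdd_above_diff_quot] by blast
  then show ?thesis using n by (intro exI[of _ s]) (auto simp: punctured_rats_def)
qed

text \<open>The quotient is continuous at nonzero steps, so a real step violating the bound would
  have nearby rational steps violating it too, against the supremum over
  \<open>punctured_rats n\<close>.\<close>

lemma eventually_diff_quot_le:
  assumes e: "0 < e"
  shows "\<forall>\<^sub>F s in at 0. (F (y + s *\<^sub>R w) - F y) / s \<le> upper_derivate F w y + e"
proof -
  let ?q = "\<lambda>s. (F (y + s *\<^sub>R w) - F y) / s"
  obtain n where n: "(SUP s\<in>punctured_rats n. ?q s) < upper_derivate F w y + e"
  proof -
    have "(INF n. SUP s\<in>punctured_rats n. ?q s) < upper_derivate F w y + e"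
      using e by (simp add: upper_derivate_def)
    then have "\<exists>n\<in>UNIV. (SUP s\<in>punctured_rats n. ?q s) < upper_derivate F w y + e"
      by (rule iffD1[OF cINF_less_iff[OF UNIV_not_empty bdd_below_SUP_diff_quot]])
    then show ?thesis using that by blast
  qed
  have "?q s \<le> upper_derivate F w y + e" if s: "s \<noteq> 0" "\<bar>s\<bar> < inverse (Suc n)" for s
  proof (rule ccontr)
    assume neg: "\<not> ?thesis"
    have "isCont ?q s"
    proof -
      have "continuous_on UNIV F" using lip by (rule lipschitz_on_continuous_on)
      then have "isCont F (y + s *\<^sub>R w)" by (simp add: continuous_on_eq_continuous_at)
      then have "isCont (\<lambda>s. F (y + s *\<^sub>R w)) s"
        by (rule isCont_o2[rotated]) (intro continuous_intros)
      then show ?thesis using s by (intro continuous_intros) auto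
    qed
    then have "(?q \<longlongrightarrow> ?q s) (nhds s)"
      unfolding isCont_def by (rule iffD1[OF tendsto_at_iff_tendsto_nhds])
    then have "\<forall>\<^sub>F t in nhds s. upper_derivate F w y + e < ?q t"
      by (rule order_tendstoD(1)) (use neg in simp)
    moreover have "\<forall>\<^sub>F t in nhds s. t \<noteq> 0 \<and> \<bar>t\<bar> < inverse (Suc n)"
      using s by (intro eventually_conj t1_space_nhds order_tendstoD[OF tendsto_rabs[OF filterlim_ident]]) auto
    ultimately have "\<forall>\<^sub>F t in nhds s. upper_derivate F w y + e < ?q t \<and> t \<noteq> 0 \<and> \<bar>t\<bar> < inverse (Suc n)"
      by eventually_elim auto
    then obtain S where S: "open S" "s \<in> S"
       "\<And>t. t \<in> S \<Longrightarrow> upper_derivate F w y + e < ?q t \<and> t \<noteq> 0 \<and> \<bar>t\<bar> < inverse (Suc n)"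
      unfolding eventually_nhds by blast
    obtain d where d: "0 < d" "ball s d \<subseteq> S" using S open_contains_ball by blast
    obtain t where t: "t \<in> \<rat>" "s < t" "t < s + d" using Rats_dense_in_real[of s "s + d"] d by auto
    then have "t \<in> ball s d" by (auto simp: dist_real_def)
    then have "t \<in> S" using d by blast
    from S(3)[OF this] t have "t \<in> punctured_rats n" "upper_derivate F w y + e < ?q t"
      by (auto simp: punctured_rats_def)
    then show False using cSUP_upper[OF _ bdd_above_diff_quot, of t "punctured_rats n" y w] n by linarith
  qed
  then show ?thesis
    unfolding eventually_at by (intro exI[of _ "inverse (Suc n)"]) (auto simp: dist_real_def)
qed

end

lemma measurable_upper_derivate:
  fixes F :: "'a::euclidean_space \<Rightarrow> real"
  assumes "K-lipschitz_on UNIV F"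
  shows "upper_derivate F w \<in> borel_measurable borel"
proof -
  have "continuous_on UNIV F" using assms by (rule lipschitz_on_continuous_on)
  then have [measurable]: "F \<in> borel_measurable borel" by (rule borel_measurable_continuous_onI)
  have "(\<lambda>y. INF n. SUP s\<in>punctured_rats n. (F (y + s *\<^sub>R w) - F y) / s) \<in> borel_measurable borel"
    by (intro borel_measurable_cINF borel_measurable_cSUP bdd_above_diff_quot[OF assms] bdd_below_SUP_diff_quot[OF assms]) auto
  then show ?thesis unfolding upper_derivate_def .
qed

lemma lipschitz_on_uminus: "K-lipschitz_on S F \<Longrightarrow> K-lipschitz_on S (\<lambda>x. - F x)"
  for F :: "'a::metric_space \<Rightarrow> real"
  by (auto simp: lipschitz_on_def dist_minus)

context
  fixes F :: "'a::real_normed_vector \<Rightarrow> real" and K :: real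
  assumes lip: "K-lipschitz_on UNIV F"
begin

text \<open>The second summand is minus the lower derivate, so the sum is the gap between the upper
  and the lower derivate.\<close>

lemma upper_derivate_uminus_nonneg: "0 \<le> upper_derivate F w y + upper_derivate (\<lambda>x. - F x) w y"
proof (rule field_le_epsilon)
  fix e :: real assume e: "0 < e"
  have "\<forall>\<^sub>F s in at (0::real). (F (y + s *\<^sub>R w) - F y) / s \<le> upper_derivate F w y + e / 2"
    using e by (intro eventually_diff_quot_le[OF lip]) simp
  moreover have "\<forall>\<^sub>F s in at (0::real). (- F (y + s *\<^sub>R w) - - F y) / s \<le> upper_derivate (\<lambda>x. - F x) w y + e / 2"
    using e by (intro eventually_diff_quot_le[OF lipschitz_on_uminus[OF lip]]) simp
  ultimately have "\<forall>\<^sub>F s in at (0::real). 0 \<le> upper_derivate F w y + upper_derivate (\<lambda>x. - F x) w y + e"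
    by eventually_elim (simp add: diff_divide_distrib)
  then show "0 \<le> upper_derivate F w y + upper_derivate (\<lambda>x. - F x) w y + e"
    by (simp add: eventually_const_iff)
qed

lemma diff_quot_tendsto:
  assumes "upper_derivate F w y + upper_derivate (\<lambda>x. - F x) w y = 0"
  shows "((\<lambda>s. (F (y + s *\<^sub>R w) - F y) / s) \<longlongrightarrow> upper_derivate F w y) (at 0)"
proof (rule tendstoI)
  fix e :: real assume e: "0 < e"
  have "\<forall>\<^sub>F s in at (0::real). (F (y + s *\<^sub>R w) - F y) / s \<le> upper_derivate F w y + e / 2"
    using e by (intro eventually_diff_quot_le[OF lip]) simp
  moreover have "\<forall>\<^sub>F s in at (0::real). (- F (y + s *\<^sub>R w) - - F y) / s \<le> upper_derivate (\<lambda>x. - F x) w y + e / 2"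
    using e by (intro eventually_diff_quot_le[OF lipschitz_on_uminus[OF lip]]) simp
  ultimately show "\<forall>\<^sub>F s in at 0. dist ((F (y + s *\<^sub>R w) - F y) / s) (upper_derivate F w y) < e"
  proof eventually_elim
    case (elim s)
    have "(- F (y + s *\<^sub>R w) - - F y) / s = - ((F (y + s *\<^sub>R w) - F y) / s)"
      by (simp add: minus_divide_left)
    then show ?case using elim assms e unfolding dist_real_def by linarith
  qed
qed

end

text \<open>By \<open>integral_le_increment\<close> the integrals of the upper derivates of
  \<open>\<psi>\<close> and of \<open>- \<psi>\<close> are at most the increments of these
  functions, which cancel. The sum of the two derivates is nonnegative with nonpositive integral,
  hence zero almost everywhere.\<close>

lemma AE_lipschitz_real_derivates_eq:
  fixes \<psi> :: "real \<Rightarrow> real"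
  assumes lip: "K-lipschitz_on UNIV \<psi>"
  shows "AE s in lborel. s \<in> {0..1} \<longrightarrow> upper_derivate \<psi> 1 s + upper_derivate (\<lambda>x. - \<psi> x) 1 s = 0"
proof -
  have le: "(LINT s:{0..1}|lborel. upper_derivate \<psi> 1 s) \<le> \<psi> 1 - \<psi> 0"
    and int: "set_integrable lborel {0..1} (upper_derivate \<psi> 1)"
    if lip: "K-lipschitz_on UNIV \<psi>" for \<psi> :: "real \<Rightarrow> real"
  proof -
    have [measurable]: "upper_derivate \<psi> 1 \<in> borel_measurable borel"
      by (rule measurable_upper_derivate[OF lip])
    show int: "set_integrable lborel {0..1} (upper_derivate \<psi> 1)"
      unfolding set_integrable_def
    proof (rule Bochner_Integration.integrable_bound)
      show "integrable lborel (\<lambda>s::real. K * indicator {0..1} s)"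
        by (intro integrable_mult_right integrable_real_indicator) simp_all
      show "AE s in lborel. norm (indicator {0..1} s *\<^sub>R upper_derivate \<psi> 1 s) \<le> norm (K * indicator {0..1} s)"
        using upper_derivate_bound[OF lip, of 1] lipschitz_on_nonneg[OF lip] by (auto simp: indicator_def)
    qed measurable
    have "integral {0..1} (upper_derivate \<psi> 1) \<le> \<psi> 1 - \<psi> 0"
    proof (rule integral_le_increment)
      show "K-lipschitz_on {0..1} \<psi>" using lip by (rule lipschitz_on_subset) simp
      show "upper_derivate \<psi> 1 integrable_on {0..1}" using set_borel_integral_eq_integral(1)[OF int] .
      show "\<bar>upper_derivate \<psi> 1 x\<bar> \<le> K" for x using upper_derivate_bound[OF lip, of 1] by simp
      show "\<exists>s. s \<noteq> 0 \<and> \<bar>s\<bar> < d \<and> upper_derivate \<psi> 1 x - e \<le> (\<psi> (x + s) - \<psi> x) / s" if "0 < e" "0 < d" for x e d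
        using upper_derivate_approached[OF lip that, of 1 x] by simp
    qed auto
    then show "(LINT s:{0..1}|lborel. upper_derivate \<psi> 1 s) \<le> \<psi> 1 - \<psi> 0"
      using set_borel_integral_eq_integral(2)[OF int] by simp
  qed
  let ?E = "\<lambda>s. upper_derivate \<psi> 1 s + upper_derivate (\<lambda>x. - \<psi> x) 1 s"
  note lip' = lipschitz_on_uminus[OF lip]
  have intE: "set_integrable lborel {0..1} ?E"
    using int[OF lip] int[OF lip'] by (rule set_integral_add)
  have "(LINT s:{0..1}|lborel. ?E s) \<le> 0"
    using le[OF lip] le[OF lip'] set_integral_add(2)[OF int[OF lip] int[OF lip']] by simp
  moreover have "0 \<le> (LINT s:{0..1}|lborel. ?E s)"
    using upper_derivate_uminus_nonneg[OF lip, of 1] unfolding set_lebesgue_integral_def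
    by (intro Bochner_Integration.integral_nonneg) (auto simp: indicator_def)
  ultimately have "(LINT s:{0..1}|lborel. ?E s) = 0" by simp
  then have "AE s in lborel. indicator {0..1} s *\<^sub>R ?E s = 0"
    using intE upper_derivate_uminus_nonneg[OF lip, of 1] unfolding set_lebesgue_integral_def set_integrable_def
    by (subst (asm) integral_nonneg_eq_0_iff_AE) (auto simp: indicator_def)
  then show ?thesis by eventually_elim (auto simp: indicator_def split: if_splits)
qed

lemma upper_derivate_line: "upper_derivate F w (y + s *\<^sub>R w) = upper_derivate (\<lambda>t. F (y + t *\<^sub>R w)) (1::real) s"
  by (simp add: upper_derivate_def algebra_simps)

text \<open>The one-dimensional result on every line \<open>y + s w\<close>, integrated over
  \<open>y\<close> by \<open>nn_integral_along_direction\<close>.\<close>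

lemma AE_lipschitz_derivates_eq:
  fixes F :: "'a::euclidean_space \<Rightarrow> real"
  assumes lip: "K-lipschitz_on UNIV F"
  shows "AE y in lborel. upper_derivate F w y + upper_derivate (\<lambda>x. - F x) w y = 0"
proof -
  let ?E = "\<lambda>y. upper_derivate F w y + upper_derivate (\<lambda>x. - F x) w y"
  have [measurable]: "upper_derivate F w \<in> borel_measurable borel" "upper_derivate (\<lambda>x. - F x) w \<in> borel_measurable borel"
    by (rule measurable_upper_derivate[OF lip] measurable_upper_derivate[OF lipschitz_on_uminus[OF lip]])+
  have "(\<integral>\<^sup>+s. ennreal (?E (y + s *\<^sub>R w)) * indicator {0..1} s \<partial>lborel) = 0" for y
  proof -
    have "(K * norm w)-lipschitz_on UNIV (\<lambda>t. F (y + t *\<^sub>R w))"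
    proof (rule lipschitz_onI)
      fix s t :: real
      have "dist (F (y + s *\<^sub>R w)) (F (y + t *\<^sub>R w)) \<le> K * dist (y + s *\<^sub>R w) (y + t *\<^sub>R w)"
        using lip by (rule lipschitz_onD) auto
      also have "dist (y + s *\<^sub>R w) (y + t *\<^sub>R w) = norm w * dist s t"
        by (simp add: dist_norm flip: scaleR_diff_left)
      finally show "dist (F (y + s *\<^sub>R w)) (F (y + t *\<^sub>R w)) \<le> K * norm w * dist s t" by (simp add: mult.assoc)
    qed (use lipschitz_on_nonneg[OF lip] in simp)
    from AE_lipschitz_real_derivates_eq[OF this]
    have "AE s in lborel. s \<in> {0..1} \<longrightarrow> ?E (y + s *\<^sub>R w) = 0"
      by (simp only: upper_derivate_line)
    then have "AE s in lborel. ennreal (?E (y + s *\<^sub>R w)) * indicator {0..1} s = 0"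
      by eventually_elim (auto simp: indicator_def)
    then show ?thesis by (subst nn_integral_0_iff_AE) measurable
  qed
  then have "(\<integral>\<^sup>+y. ennreal (?E y) \<partial>lborel) = 0"
    using nn_integral_along_direction[of "\<lambda>y. ennreal (?E y)" w] by simp
  then have "AE y in lborel. ennreal (?E y) = 0"
    by (subst (asm) nn_integral_0_iff_AE) measurable
  then show ?thesis
  proof eventually_elim
    case (elim y)
    then show ?case using upper_derivate_uminus_nonneg[OF lip, of w y] by (simp add: ennreal_eq_0_iff)
  qed
qed

lemma AE_diff_quot_tendsto:
  fixes F :: "'a::euclidean_space \<Rightarrow> real"
  assumes lip: "K-lipschitz_on UNIV F"
  shows "AE y in lborel. ((\<lambda>s. (F (y + s *\<^sub>R w) - F y) / s) \<longlongrightarrow> upper_derivate F w y) (at 0)"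
  using AE_lipschitz_derivates_eq[OF lip, of w] by eventually_elim (rule diff_quot_tendsto[OF lip])

text \<open>In the integral over a box, the identity \<open>q\<^sub>s(v + w)(y) = q\<^sub>s(v)(y + s w) + q\<^sub>s(w)(y)\<close> for difference
  quotients lets the shift by \<open>s w\<close> be moved onto the indicator function, where it disappears in the limit.\<close>

lemma AE_upper_derivate_add:
  fixes F :: "'a::euclidean_space \<Rightarrow> real"
  assumes lip: "K-lipschitz_on UNIV F"
  shows "AE y in lborel. upper_derivate F (v + w) y = upper_derivate F v y + upper_derivate F w y"
proof -
  have cont: "continuous_on UNIV F" using lip by (rule lipschitz_on_continuous_on)
  then have [measurable]: "F \<in> borel_measurable borel" by (rule borel_measurable_continuous_onI)
  have [measurable]: "upper_derivate F u \<in> borel_measurable borel" for u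
    by (rule measurable_upper_derivate[OF lip])
  define h where "h n = inverse (real (Suc n))" for n
  have h0: "h \<longlonglongrightarrow> 0" unfolding h_def by (rule LIMSEQ_inverse_real_of_nat)
  have hpos: "0 < h n" "h n \<le> 1" for n by (auto simp: h_def field_simps)
  have hne: "h n \<noteq> 0" for n by (simp add: h_def)
  define q where "q u n y = (F (y + h n *\<^sub>R u) - F y) / h n" for u n y
  have [measurable]: "q u n \<in> borel_measurable borel" for u n unfolding q_def by measurable
  have qb: "\<bar>q u n y\<bar> \<le> K * norm u" for u n y unfolding q_def by (rule diff_quot_le[OF lip])
  have qlim: "AE y in lborel. (\<lambda>n. q u n y) \<longlonglongrightarrow> upper_derivate F u y" for u
    using AE_diff_quot_tendsto[OF lip, of u]
  proof eventually_elim
    case (elim y)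
    have "filterlim h (at 0) sequentially"
      using h0 hne by (simp add: filterlim_at)
    then show ?case unfolding q_def by (rule filterlim_compose[OF elim])
  qed
  have qadd: "q (v + w) n y = q v n (y + h n *\<^sub>R w) + q w n y" for n y
    by (simp add: q_def algebra_simps add_divide_distrib diff_divide_distrib)
  let ?h = "\<lambda>y. upper_derivate F (v + w) y - upper_derivate F v y - upper_derivate F w y"
  have "AE y in lborel. ?h y = 0"
  proof (rule AE_zero_if_box_integrals_zero)
    show "\<bar>?h y\<bar> \<le> K * norm (v + w) + K * norm v + K * norm w" for y
      using upper_derivate_bound[OF lip, of "v + w" y] upper_derivate_bound[OF lip, of v y]
        upper_derivate_bound[OF lip, of w y] by linarith
    fix a b :: 'a
    let ?A = "indicator (box a b) :: 'a \<Rightarrow> real"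
    have intA: "integrable lborel ?A"
      by (intro integrable_real_indicator) (auto simp: emeasure_lborel_box_eq)
    have conv: "(\<lambda>n. \<integral>y. ?A y * q u n y \<partial>lborel) \<longlonglongrightarrow> (\<integral>y. ?A y * upper_derivate F u y \<partial>lborel)"
      and intq: "integrable lborel (\<lambda>y. ?A y * q u n y)"
      and intd: "integrable lborel (\<lambda>y. ?A y * upper_derivate F u y)" for u n
    proof -
      have I: "integrable lborel (\<lambda>y. K * norm u * ?A y)" using intA by simp
      have L: "AE y in lborel. (\<lambda>n. ?A y * q u n y) \<longlonglongrightarrow> ?A y * upper_derivate F u y"
        using qlim[of u] by eventually_elim (intro tendsto_intros)
      have B: "AE y in lborel. norm (?A y * q u n y) \<le> K * norm u * ?A y" for n
        using qb[of u n] by (auto simp: indicator_def)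
      show "(\<lambda>n. \<integral>y. ?A y * q u n y \<partial>lborel) \<longlonglongrightarrow> (\<integral>y. ?A y * upper_derivate F u y \<partial>lborel)"
        by (rule integral_dominated_convergence[OF _ _ I L B]) measurable
      show "integrable lborel (\<lambda>y. ?A y * q u n y)"
        by (rule integrable_dominated_convergence2[OF _ _ I L B]) measurable
      show "integrable lborel (\<lambda>y. ?A y * upper_derivate F u y)"
        by (rule integrable_dominated_convergence[OF _ _ I L B]) measurable
    qed
    have shift: "(\<integral>y. ?A y * q v n (y + h n *\<^sub>R w) \<partial>lborel) = (\<integral>y. ?A (y - h n *\<^sub>R w) * q v n y \<partial>lborel)" for n
    proof -
      have "(\<integral>y. ?A (y - h n *\<^sub>R w) * q v n y \<partial>lborel)
          = (\<integral>y. ?A (y - h n *\<^sub>R w) * q v n y \<partial>distr lborel borel ((+) (h n *\<^sub>R w)))"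
        by (simp add: lborel_distr_plus)
      also have "\<dots> = (\<integral>y. ?A y * q v n (y + h n *\<^sub>R w) \<partial>lborel)"
        by (subst integral_distr) (auto simp: add.commute)
      finally show ?thesis by simp
    qed
    have conv': "(\<lambda>n. \<integral>y. ?A (y - h n *\<^sub>R w) * q v n y \<partial>lborel) \<longlonglongrightarrow> (\<integral>y. ?A y * upper_derivate F v y \<partial>lborel)"
    proof -
      obtain R where R: "\<And>y. y \<in> box a b \<Longrightarrow> norm y \<le> R"
        using bounded_box bounded_iff by metis
      \<comment> \<open>Since \<open>h n \<le> 1\<close>, all shifted boxes lie in this ball, which
        gives the dominating function. Pointwise convergence of the shifted indicators holds off the
        frontier of the box.\<close>
      let ?B = "indicator (cball 0 (R + norm w)) :: 'a \<Rightarrow> real"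
      have I: "integrable lborel (\<lambda>y. K * norm v * ?B y)"
        by (intro integrable_mult_right integrable_real_indicator)
          (use emeasure_bounded_finite[OF bounded_cball, of 0 "R + norm w"] in auto)
      have "frontier (box a b) \<in> null_sets lborel"
        using negligible_convex_frontier[OF convex_box(2), of a b]
        by (simp add: negligible_iff_null_sets null_sets_completion_iff borel_closed)
      then have "AE y in lborel. y \<notin> frontier (box a b)" by (rule AE_not_in)
      then have L: "AE y in lborel. (\<lambda>n. ?A (y - h n *\<^sub>R w) * q v n y) \<longlonglongrightarrow> ?A y * upper_derivate F v y"
        using qlim[of v]
      proof eventually_elim
        case (elim y)
        have lim: "(\<lambda>n. y - h n *\<^sub>R w) \<longlonglongrightarrow> y"
          using tendsto_diff[OF tendsto_const tendsto_scaleR[OF h0 tendsto_const]] by force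
        have "\<forall>\<^sub>F n in sequentially. ?A (y - h n *\<^sub>R w) = ?A y"
        proof (cases "y \<in> box a b")
          case True
          from topological_tendstoD[OF lim open_box True]
          show ?thesis by eventually_elim (simp add: True)
        next
          case False
          then have "y \<in> - closure (box a b)" using elim(1) interior_subset[of "box a b"] by (auto simp: frontier_def)
          from topological_tendstoD[OF lim _ this]
          have "\<forall>\<^sub>F n in sequentially. y - h n *\<^sub>R w \<in> - closure (box a b)" by (simp add: open_Compl)
          then show ?thesis
            by eventually_elim (use False closure_subset[of "box a b"] in \<open>auto simp: indicator_def\<close>)
        qed
        then have "(\<lambda>n. ?A (y - h n *\<^sub>R w)) \<longlonglongrightarrow> ?A y" by (rule tendsto_eventually)
        then show ?case using elim(2) by (rule tendsto_mult)
      qed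
      have B: "AE y in lborel. norm (?A (y - h n *\<^sub>R w) * q v n y) \<le> K * norm v * ?B y" for n
      proof (rule AE_I2)
        fix y
        have "?A (y - h n *\<^sub>R w) \<le> ?B y"
        proof (cases "y - h n *\<^sub>R w \<in> box a b")
          case True
          have "norm y \<le> norm (y - h n *\<^sub>R w) + norm (h n *\<^sub>R w)"
            using norm_triangle_ineq[of "y - h n *\<^sub>R w" "h n *\<^sub>R w"] by simp
          also have "\<dots> \<le> R + norm w"
            using R[OF True] hpos[of n] by (intro add_mono) (auto intro!: mult_left_le_one_le)
          finally show ?thesis by (simp add: indicator_def)
        qed simp
        then have "?A (y - h n *\<^sub>R w) * \<bar>q v n y\<bar> \<le> ?B y * (K * norm v)"
          using qb[of v n y] by (intro mult_mono) auto
        then show "norm (?A (y - h n *\<^sub>R w) * q v n y) \<le> K * norm v * ?B y"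
          by (simp add: abs_mult mult.commute)
      qed
      show ?thesis by (rule integral_dominated_convergence[OF _ _ I L B]) measurable
    qed
    have "(\<integral>y. ?A y * q (v + w) n y \<partial>lborel)
        = (\<integral>y. ?A (y - h n *\<^sub>R w) * q v n y \<partial>lborel) + (\<integral>y. ?A y * q w n y \<partial>lborel)" for n
    proof -
      have "(\<integral>y. ?A y * q v n (y + h n *\<^sub>R w) \<partial>lborel) = (\<integral>y. ?A y * q (v + w) n y - ?A y * q w n y \<partial>lborel)"
        by (simp add: qadd algebra_simps)
      also have "\<dots> = (\<integral>y. ?A y * q (v + w) n y \<partial>lborel) - (\<integral>y. ?A y * q w n y \<partial>lborel)"
        by (rule Bochner_Integration.integral_diff[OF intq intq])
      finally show ?thesis by (simp add: shift)
    qed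
    then have "(\<lambda>n. \<integral>y. ?A y * q (v + w) n y \<partial>lborel) \<longlonglongrightarrow>
       (\<integral>y. ?A y * upper_derivate F v y \<partial>lborel) + (\<integral>y. ?A y * upper_derivate F w y \<partial>lborel)"
      using tendsto_add[OF conv' conv[of w]] by simp
    with conv[of "v + w"] have "(\<integral>y. ?A y * upper_derivate F (v + w) y \<partial>lborel) =
       (\<integral>y. ?A y * upper_derivate F v y \<partial>lborel) + (\<integral>y. ?A y * upper_derivate F w y \<partial>lborel)"
      by (rule LIMSEQ_unique)
    then show "(\<integral>y. ?A y * ?h y \<partial>lborel) = 0"
      by (simp add: right_diff_distrib intd)
  qed measurable
  then show ?thesis by eventually_elim simp
qed

text \<open>The exceptional null set depends on the coefficients, so only countably many directions
  can be handled at once; \<open>Rademacher_Gateaux_real\<close> takes a dense set of them.\<close>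

lemma AE_upper_derivate_sum:
  fixes F :: "'a::euclidean_space \<Rightarrow> real"
  assumes lip: "K-lipschitz_on UNIV F" and "finite S"
  shows "AE y in lborel. upper_derivate F (\<Sum>b\<in>S. c b *\<^sub>R b) y = (\<Sum>b\<in>S. c b * upper_derivate F b y)"
  using \<open>finite S\<close>
proof induction
  case empty
  show ?case
  proof (rule AE_I2)
    fix y show "upper_derivate F (\<Sum>b\<in>{}. c b *\<^sub>R b) y = (\<Sum>b\<in>{}. c b * upper_derivate F b y)"
      using upper_derivate_bound[OF lip, of 0 y] by simp
  qed
next
  case (insert b S)
  have "AE y in lborel. upper_derivate F (c b *\<^sub>R b) y = c b * upper_derivate F b y"
    using AE_diff_quot_tendsto[OF lip, of b] AE_diff_quot_tendsto[OF lip, of "c b *\<^sub>R b"]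
  proof eventually_elim
    case (elim y)
    show ?case
    proof (cases "c b = 0")
      case True
      then show ?thesis using upper_derivate_bound[OF lip, of 0 y] by simp
    next
      case False
      \<comment> \<open>Homogeneity by the substitution of \<open>s * c b\<close> for the
        step.\<close>
      have "filterlim (\<lambda>s. s * c b) (at 0) (at 0)"
        using False by (auto simp: filterlim_at eventually_at_filter intro!: tendsto_eq_intros)
      from tendsto_mult[OF tendsto_const filterlim_compose[OF elim(1) this], of "c b"]
      have "((\<lambda>s. c b * ((F (y + (s * c b) *\<^sub>R b) - F y) / (s * c b))) \<longlongrightarrow> c b * upper_derivate F b y) (at 0)" .
      then have "((\<lambda>s. (F (y + s *\<^sub>R c b *\<^sub>R b) - F y) / s) \<longlongrightarrow> c b * upper_derivate F b y) (at 0)"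
        using False by (simp add: mult.commute)
      from LIM_unique[OF elim(2) this] show ?thesis .
    qed
  qed
  with insert.IH AE_upper_derivate_add[OF lip, of "c b *\<^sub>R b" "\<Sum>b\<in>S. c b *\<^sub>R b"]
  show ?case by eventually_elim (simp add: insert.hyps)
qed

text \<open>Off one null set the derivative formula holds on a countable dense set of directions.
  The difference quotients are \<open>K\<close>-Lipschitz in the direction, uniformly in the step,
  so the formula extends to all directions.\<close>

theorem Rademacher_Gateaux_real:
  fixes F :: "'a::euclidean_space \<Rightarrow> real"
  assumes lip: "K-lipschitz_on UNIV F"
  shows "AE y in lborel. \<exists>g. \<forall>w. ((\<lambda>s. (F (y + s *\<^sub>R w) - F y) / s) \<longlongrightarrow> g \<bullet> w) (at 0)"
proof -
  obtain D :: "'a set" where D: "countable D" "\<And>X. open X \<Longrightarrow> X \<noteq> {} \<Longrightarrow> \<exists>d\<in>D. d \<in> X"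
    using countable_dense_setE by blast
  define g where "g y = (\<Sum>b\<in>Basis. upper_derivate F b y *\<^sub>R b)" for y
  have "AE y in lborel. ((\<lambda>s. (F (y + s *\<^sub>R w) - F y) / s) \<longlongrightarrow> g y \<bullet> w) (at 0)" for w
    using AE_diff_quot_tendsto[OF lip, of w] AE_upper_derivate_sum[OF lip finite_Basis, of "\<lambda>b. w \<bullet> b"]
  proof eventually_elim
    case (elim y)
    have "upper_derivate F w y = (\<Sum>b\<in>Basis. (w \<bullet> b) * upper_derivate F b y)"
      using elim(2) by (simp add: euclidean_representation)
    also have "\<dots> = g y \<bullet> w" unfolding g_def inner_sum_left by (intro sum.cong refl) (simp add: inner_commute)
    finally show ?case using elim(1) by simp
  qed
  then have "AE y in lborel. \<forall>w\<in>D. ((\<lambda>s. (F (y + s *\<^sub>R w) - F y) / s) \<longlongrightarrow> g y \<bullet> w) (at 0)"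
    using D(1) by (simp add: AE_ball_countable)
  then show ?thesis
  proof eventually_elim
    case (elim y)
    have "((\<lambda>s. (F (y + s *\<^sub>R w) - F y) / s) \<longlongrightarrow> g y \<bullet> w) (at 0)" for w
    proof (rule tendstoI)
      fix e :: real assume e: "0 < e"
      have K: "0 \<le> K" using lip by (rule lipschitz_on_nonneg)
      define C where "C = K + norm (g y) + 1"
      have C: "0 < C" using K by (simp add: C_def add_nonneg_pos)
      define d where "d = e / 3 / C"
      have d: "0 < d" using e C by (simp add: d_def)
      obtain w' where w': "w' \<in> D" "w' \<in> ball w d" using D(2)[of "ball w d"] d by auto
      have dd: "(K + norm (g y)) * dist w' w \<le> e / 3"
      proof -
        have "(K + norm (g y)) * dist w' w \<le> C * d"
          using w' K d by (intro mult_mono) (auto simp: dist_commute C_def)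
        also have "\<dots> = e / 3" using C by (simp add: d_def)
        finally show ?thesis .
      qed
      have "\<forall>\<^sub>F s in at 0. dist ((F (y + s *\<^sub>R w') - F y) / s) (g y \<bullet> w') < e / 3"
        using elim w'(1) e by (intro tendstoD) auto
      moreover have "\<forall>\<^sub>F s in at (0::real). s \<noteq> 0" by (simp add: eventually_at_filter)
      ultimately show "\<forall>\<^sub>F s in at 0. dist ((F (y + s *\<^sub>R w) - F y) / s) (g y \<bullet> w) < e"
      proof eventually_elim
        case (elim s)
        have "\<bar>F (y + s *\<^sub>R w) - F (y + s *\<^sub>R w')\<bar> \<le> K * (\<bar>s\<bar> * dist w' w)"
          using lipschitz_onD[OF lip, of "y + s *\<^sub>R w" "y + s *\<^sub>R w'"]
          by (simp add: dist_norm norm_minus_commute flip: scaleR_diff_right)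
        then have "\<bar>(F (y + s *\<^sub>R w) - F y) / s - (F (y + s *\<^sub>R w') - F y) / s\<bar> \<le> K * dist w' w"
          using elim by (simp add: abs_divide field_simps flip: diff_divide_distrib)
        moreover have "\<bar>g y \<bullet> w' - g y \<bullet> w\<bar> \<le> norm (g y) * dist w' w"
          using Cauchy_Schwarz_ineq2[of "g y" "w' - w"] by (simp add: inner_diff_right dist_norm)
        ultimately show ?case using elim dd e unfolding dist_real_def distrib_right by linarith
      qed
    qed
    then show ?case by blast
  qed
qed

theorem Rademacher_Gateaux:
  fixes F :: "'a::euclidean_space \<Rightarrow> 'b::euclidean_space"
  assumes lip: "K-lipschitz_on UNIV F"
  shows "AE y in lborel. \<exists>A. linear A \<and> (\<forall>w. ((\<lambda>s. (F (y + s *\<^sub>R w) - F y) /\<^sub>R s) \<longlongrightarrow> A w) (at 0))"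
proof -
  have "K-lipschitz_on UNIV (\<lambda>x. F x \<bullet> b)" if "b \<in> Basis" for b
  proof (rule lipschitz_onI)
    fix x y
    have "dist (F x \<bullet> b) (F y \<bullet> b) \<le> dist (F x) (F y)"
      using that Basis_le_norm[of b "F x - F y"] by (simp add: dist_norm inner_diff_left)
    also have "\<dots> \<le> K * dist x y" using lip by (rule lipschitz_onD) auto
    finally show "dist (F x \<bullet> b) (F y \<bullet> b) \<le> K * dist x y" .
  qed (rule lipschitz_on_nonneg[OF lip])
  from Rademacher_Gateaux_real[OF this]
  have "AE y in lborel. \<forall>b\<in>Basis. \<exists>g. \<forall>w. ((\<lambda>s. (F (y + s *\<^sub>R w) \<bullet> b - F y \<bullet> b) / s) \<longlongrightarrow> g \<bullet> w) (at 0)"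
    by (simp add: AE_ball_countable countable_finite)
  then show ?thesis
  proof eventually_elim
    case (elim y)
    then obtain g where g: "\<And>b w. b \<in> Basis \<Longrightarrow> ((\<lambda>s. (F (y + s *\<^sub>R w) \<bullet> b - F y \<bullet> b) / s) \<longlongrightarrow> g b \<bullet> w) (at 0)"
      using bchoice[OF elim] by blast
    define A where "A w = (\<Sum>b\<in>Basis. (g b \<bullet> w) *\<^sub>R b)" for w
    have "linear A"
      by (rule linearI) (simp_all add: A_def inner_add_right scaleR_add_left sum.distrib scaleR_sum_right)
    moreover have "((\<lambda>s. (F (y + s *\<^sub>R w) - F y) /\<^sub>R s) \<longlongrightarrow> A w) (at 0)" for w
    proof -
      have "((\<lambda>s. \<Sum>b\<in>Basis. ((F (y + s *\<^sub>R w) \<bullet> b - F y \<bullet> b) / s) *\<^sub>R b) \<longlongrightarrow> A w) (at 0)"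
        unfolding A_def by (intro tendsto_sum tendsto_scaleR g tendsto_const)
      moreover have "(\<Sum>b\<in>Basis. ((F (y + s *\<^sub>R w) \<bullet> b - F y \<bullet> b) / s) *\<^sub>R b) = (F (y + s *\<^sub>R w) - F y) /\<^sub>R s" for s
      proof -
        have "(F (y + s *\<^sub>R w) - F y) /\<^sub>R s = (\<Sum>b\<in>Basis. (((F (y + s *\<^sub>R w) - F y) /\<^sub>R s) \<bullet> b) *\<^sub>R b)"
          by (rule euclidean_representation[symmetric])
        then show ?thesis by (simp add: inner_diff_left divide_inverse mult.commute)
      qed
      ultimately show ?thesis by simp
    qed
    ultimately show ?case by blast
  qed
qed

subsection \<open>Subderivatives, and generalized quadratic forms as resolvents\<close>

text \<open>If the infimum \<open>m\<close> were not attained, lower semicontinuity would give each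
  point a neighbourhood on which the sum stays above a bound larger than \<open>m\<close>; finitely
  many of these cover \<open>K\<close>, and the least of their bounds would exceed the
  infimum.\<close>

lemma lsc_plus_continuous_attains_inf:
  fixes f :: "'a::euclidean_space \<Rightarrow> ereal" and c :: "'a \<Rightarrow> real"
  assumes K: "compact K" "K \<noteq> {}" and lsc: "\<And>x. x \<in> K \<Longrightarrow> f x \<le> Liminf (at x) f"
    and cont: "continuous_on UNIV c"
  obtains x where "x \<in> K" "\<And>x'. x' \<in> K \<Longrightarrow> f x + ereal (c x) \<le> f x' + ereal (c x')"
proof -
  define m where "m = (INF x\<in>K. f x + ereal (c x))"
  have "\<exists>x\<in>K. f x + ereal (c x) = m"
  proof (rule ccontr)
    assume "\<not> ?thesis"
    then have gt: "m < f x + ereal (c x)" if "x \<in> K" for x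
      using that INF_lower[OF that, of "\<lambda>x. f x + ereal (c x)"] by (auto simp: m_def order_less_le)
    have "\<exists>U b. open U \<and> x \<in> U \<and> m < b \<and> (\<forall>u\<in>U. b \<le> f u + ereal (c u))" if x: "x \<in> K" for x
    proof -
      obtain z where z: "m < ereal z" "ereal z < f x + ereal (c x)" using ereal_dense2[OF gt[OF x]] by blast
      then have "ereal (z - c x) < f x" by (cases "f x") auto
      then obtain a where a: "ereal (z - c x) < ereal a" "ereal a < f x" using ereal_dense2 by blast
      have "ereal a < Liminf (at x) f" using a(2) lsc[OF x] by (rule less_le_trans)
      then have "\<forall>\<^sub>F u in nhds x. ereal a < f u"
        using a(2) less_LiminfD eventually_nhds_conv_at by blast
      moreover have "\<forall>\<^sub>F u in nhds x. z - a < c u"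
      proof (rule order_tendstoD(1))
        have "isCont c x" using cont by (simp add: continuous_on_eq_continuous_at)
        then show "(c \<longlongrightarrow> c x) (nhds x)" unfolding isCont_def by (rule iffD1[OF tendsto_at_iff_tendsto_nhds])
        show "z - a < c x" using a by simp
      qed
      ultimately have "\<forall>\<^sub>F u in nhds x. ereal z \<le> f u + ereal (c u)"
      proof eventually_elim
        case (elim u)
        then show ?case by (cases "f u") auto
      qed
      then show ?thesis using z(1) unfolding eventually_nhds by blast
    qed
    then obtain U b where U: "\<And>x. x \<in> K \<Longrightarrow> open (U x) \<and> x \<in> U x \<and> m < b x \<and> (\<forall>u\<in>U x. b x \<le> f u + ereal (c u))"
      by metis
    then have "K \<subseteq> (\<Union>x\<in>K. U x)" by blast
    then obtain C where C: "C \<subseteq> K" "finite C" "K \<subseteq> (\<Union>x\<in>C. U x)"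
      using K(1) U compactE_image[of K K U] by metis
    have "C \<noteq> {}" using C(3) K(2) by blast
    then have "m < Min (b ` C)" using C(1,2) U by auto
    moreover have "Min (b ` C) \<le> m"
      unfolding m_def
    proof (rule INF_greatest)
      fix u assume "u \<in> K"
      then obtain x where x: "x \<in> C" "u \<in> U x" using C(3) by blast
      then have "Min (b ` C) \<le> b x" using C(2) by auto
      also have "b x \<le> f u + ereal (c u)" using U x C(1) by blast
      finally show "Min (b ` C) \<le> f u + ereal (c u)" .
    qed
    ultimately show False by simp
  qed
  then obtain x where x: "x \<in> K" "f x + ereal (c x) = m" by blast
  show ?thesis
    by (rule that[OF x(1)]) (unfold x(2) m_def, rule INF_lower)
qed

text \<open>A quadratic minorant touching at \<open>x\<close> makes \<open>v\<close> a regular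
  subgradient, its error being of second order; constant sequences turn this into a limiting
  subgradient.\<close>

lemma limiting_subdifferentialI:
  assumes fx: "f x = ereal a"
    and growth: "\<forall>\<^sub>F y in nhds x. ereal (a + v \<bullet> (y - x) - C * (norm (y - x))\<^sup>2) \<le> f y"
  shows "v \<in> limiting_subdifferential f x"
proof -
  have "0 \<le> Liminf (at x) (\<lambda>y. (f y - f x - ereal (v \<bullet> (y - x))) / ereal (norm (y - x)))"
  proof (cases "at x = bot")
    case False
    have "((\<lambda>y. ereal (- C * norm (y - x))) \<longlongrightarrow> ereal (- C * norm (x - x))) (at x)"
      by (intro tendsto_intros)
    from lim_imp_Liminf[OF False this]
    have "0 = Liminf (at x) (\<lambda>y. ereal (- C * norm (y - x)))" by (simp add: zero_ereal_def)
    also have "\<dots> \<le> Liminf (at x) (\<lambda>y. (f y - f x - ereal (v \<bullet> (y - x))) / ereal (norm (y - x)))"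
    proof (rule Liminf_mono)
      have "\<forall>\<^sub>F y in at x. ereal (a + v \<bullet> (y - x) - C * (norm (y - x))\<^sup>2) \<le> f y \<and> y \<noteq> x"
        using growth by (simp add: eventually_at_filter eventually_mono)
      then show "\<forall>\<^sub>F y in at x. ereal (- C * norm (y - x)) \<le> (f y - f x - ereal (v \<bullet> (y - x))) / ereal (norm (y - x))"
      proof eventually_elim
        case (elim y)
        then have "0 < norm (y - x)" by simp
        with elim show ?case
          by (cases "f y") (auto simp: fx field_simps power2_eq_square)
      qed
    qed
    finally show ?thesis .
  qed simp
  then have "v \<in> regular_subdifferential f x" by (simp add: regular_subdifferential_def fx)
  then show ?thesis
    unfolding limiting_subdifferential_def mem_Collect_eq
    by (intro conjI exI[of _ "\<lambda>_. x"] exI[of _ "\<lambda>_. v"]) (auto simp: fx)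
qed

lemma second_subderivative_geI:
  fixes g :: "real \<times> 'a::euclidean_space \<Rightarrow> real"
  assumes fx: "f x = ereal a" and lim: "(g \<longlongrightarrow> l) (at_right 0 \<times>\<^sub>F nhds w)"
    and ev: "\<forall>\<^sub>F (t, u) in at_right 0 \<times>\<^sub>F nhds w. ereal (a + t * (v \<bullet> u) + t\<^sup>2 / 2 * g (t, u)) \<le> f (x + t *\<^sub>R u)"
  shows "ereal l \<le> second_subderivative f x v w"
proof -
  have "at_right (0::real) \<times>\<^sub>F nhds w \<noteq> bot" by (simp add: prod_filter_eq_bot)
  then have "ereal l = Liminf (at_right 0 \<times>\<^sub>F nhds w) (\<lambda>p. ereal (g p))"
    using lim_imp_Liminf tendsto_ereal[OF lim] by metis
  also have "\<dots> \<le> second_subderivative f x v w"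
    unfolding second_subderivative_def
  proof (rule Liminf_mono)
    have "\<forall>\<^sub>F p in at_right (0::real) \<times>\<^sub>F nhds w. 0 < fst p"
      by (rule eventually_compose_filterlim[OF eventually_at_right_less filterlim_fst])
    with ev show "\<forall>\<^sub>F p in at_right 0 \<times>\<^sub>F nhds w. ereal (g p)
         \<le> (case p of (t, u) \<Rightarrow> (f (x + t *\<^sub>R u) - f x - ereal (t * (v \<bullet> u))) / ereal (t\<^sup>2 / 2))"
    proof eventually_elim
      case (elim p)
      obtain t u where p: "p = (t, u)" by force
      have "0 < t\<^sup>2" using elim(2) p by simp
      with elim show ?case
        by (cases "f (x + t *\<^sub>R u)") (auto simp: p fx field_simps)
    qed
  qed
  finally show ?thesis .
qed

lemma second_subderivative_ge_quadratic:
  assumes fx: "f x = ereal a"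
    and growth: "\<forall>\<^sub>F y in nhds x. ereal (a + v \<bullet> (y - x) + c / 2 * (norm (y - x))\<^sup>2) \<le> f y"
  shows "ereal (c * (norm w)\<^sup>2) \<le> second_subderivative f x v w"
proof (rule second_subderivative_geI[of f x a "\<lambda>(t, u). c * (norm u)\<^sup>2", OF fx])
  have snd: "(snd \<longlongrightarrow> w) (at_right (0::real) \<times>\<^sub>F nhds w)" by (rule filterlim_snd)
  have fst: "(fst \<longlongrightarrow> 0) (at_right (0::real) \<times>\<^sub>F nhds w)"
    by (rule filterlim_mono[OF filterlim_fst _ order_refl]) (simp add: at_within_def)
  show "((\<lambda>(t::real, u). c * (norm u)\<^sup>2) \<longlongrightarrow> c * (norm w)\<^sup>2) (at_right 0 \<times>\<^sub>F nhds w)"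
    unfolding case_prod_unfold by (intro tendsto_intros snd)
  have "((\<lambda>p. x + fst p *\<^sub>R snd p) \<longlongrightarrow> x + 0 *\<^sub>R w) (at_right 0 \<times>\<^sub>F nhds w)"
    by (intro tendsto_intros fst snd)
  then have "filterlim (\<lambda>p. x + fst p *\<^sub>R snd p) (nhds x) (at_right 0 \<times>\<^sub>F nhds w)" by simp
  from eventually_compose_filterlim[OF growth this]
  show "\<forall>\<^sub>F (t, u) in at_right 0 \<times>\<^sub>F nhds w.
      ereal (a + t * (v \<bullet> u) + t\<^sup>2 / 2 * (case (t, u) of (t, u) \<Rightarrow> c * (norm u)\<^sup>2)) \<le> f (x + t *\<^sub>R u)"
    by eventually_elim (auto simp: power_mult_distrib mult_ac)
qed

text \<open>The pairs \<open>(t, u t)\<close> form one admissible path in the liminf, and along it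
  the quotient equals \<open>g t\<close>.\<close>

lemma second_subderivative_leI:
  fixes u :: "real \<Rightarrow> 'a::euclidean_space"
  assumes fx: "f x = ereal a" and u: "(u \<longlongrightarrow> w) (at_right 0)" and g: "(g \<longlongrightarrow> l) (at_right 0)"
    and ev: "\<forall>\<^sub>F t in at_right 0. f (x + t *\<^sub>R u t) = ereal (a + t * (v \<bullet> u t) + t\<^sup>2 / 2 * g t)"
  shows "second_subderivative f x v w \<le> ereal l"
proof -
  let ?h = "\<lambda>(t, u). (f (x + t *\<^sub>R u) - f x - ereal (t * (v \<bullet> u))) / ereal (t\<^sup>2 / 2)"
  have lim: "filterlim (\<lambda>t. (t, u t)) (at_right 0 \<times>\<^sub>F nhds w) (at_right 0)"
    by (intro filterlim_Pair filterlim_ident u)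
  have "second_subderivative f x v w \<le> Liminf (at_right 0) (\<lambda>t. ?h (t, u t))"
    unfolding second_subderivative_def le_Liminf_iff
    using eventually_compose_filterlim[OF less_LiminfD lim] by blast
  also have "\<dots> = Liminf (at_right 0) (\<lambda>t. ereal (g t))"
  proof (rule Liminf_eq)
    show "\<forall>\<^sub>F t in at_right 0. ?h (t, u t) = ereal (g t)"
      using ev eventually_at_right_less[of "0::real"]
      by eventually_elim (simp add: fx)
  qed
  also have "\<dots> = ereal l"
    by (rule lim_imp_Liminf) (auto intro: g)
  finally show ?thesis .
qed

section \<open>Generalized quadratic forms parametrized by symmetric matrices, and their
  epi-limits\<close>

lemma PK_inner_subset_outer: "PK_inner_limit C \<subseteq> PK_outer_limit C"
proof
  fix z assume "z \<in> PK_inner_limit C"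
  then obtain zs N where zs: "\<And>k. N \<le> k \<Longrightarrow> zs k \<in> C k" "zs \<longlonglongrightarrow> z"
    by (auto simp: PK_inner_limit_def eventually_sequentially)
  show "z \<in> PK_outer_limit C"
    unfolding PK_outer_limit_def mem_Collect_eq
  proof (intro exI conjI allI)
    show "strict_mono (\<lambda>k. k + N)" by (auto simp: strict_mono_def)
    show "zs (k + N) \<in> C (k + N)" for k using zs(1) by simp
    show "(\<lambda>k. zs (k + N)) \<longlonglongrightarrow> z" using zs(2) by (rule LIMSEQ_ignore_initial_segment)
  qed
qed

text \<open>The kernel of a symmetric \<open>J\<close> is the orthogonal complement of its range,
  and \<open>n\<close> is the component of \<open>w\<close> in it. Large multiples of
  \<open>n\<close> later force the value \<infinity> off the range.\<close>

lemma kernel_vector_off_range: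
  fixes J :: "'a::euclidean_space \<Rightarrow> 'a"
  assumes lin: "linear J" and sym: "\<And>x y. J x \<bullet> y = x \<bullet> J y" and w: "w \<notin> range J"
  obtains n where "J n = 0" "0 < n \<bullet> w"
proof -
  obtain y n where yn: "y \<in> span (range J)" "\<And>u. u \<in> span (range J) \<Longrightarrow> orthogonal n u" "w = y + n"
    using orthogonal_subspace_decomp_exists by metis
  have "span (range J) \<subseteq> range J" by (rule span_minimal[OF order_refl linear_subspace_image[OF lin subspace_UNIV]])
  then have ysp: "y \<in> range J" using yn(1) by blast
  have orth: "n \<bullet> J u = 0" for u using yn(2)[of "J u"] by (simp add: orthogonal_def span_base)
  have "J n \<bullet> J n = 0" using orth[of "J n"] sym by simp
  then have "J n = 0" by simp
  moreover have "n \<noteq> 0" using yn(3) ysp w by auto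
  then have "0 < n \<bullet> w" using ysp orth yn(3) by (auto simp: inner_add_right)
  ultimately show ?thesis by (rule that)
qed

text \<open>
  A symmetric \<open>J\<close> encodes the generalized quadratic form whose proximal map with parameter \<open>1/s\<close>
  is \<open>J\<close>. This parametrization replaces varying domains by varying matrices, so that
  epi-convergence becomes convergence of matrices.
\<close>

definition resolvent_form :: "real \<Rightarrow> ('a::euclidean_space \<Rightarrow> 'a) \<Rightarrow> 'a \<Rightarrow> ereal" where
  "resolvent_form s J w = (if w \<in> range J then ereal (s * ((inv J w - w) \<bullet> w)) else \<infinity>)"

text \<open>Two preimages of \<open>J z\<close> have the same inner product with \<open>J z\<close>
  because \<open>J\<close> is symmetric, so the choice made by \<open>inv\<close> does not
  matter.\<close>

lemma resolvent_form_apply: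
  assumes lin: "linear J" and sym: "\<And>x y. J x \<bullet> y = x \<bullet> J y"
  shows "resolvent_form s J (J z) = ereal (s * ((z - J z) \<bullet> J z))"
proof -
  have "J (inv J (J z)) = J z" by (simp add: f_inv_into_f)
  then have "inv J (J z) \<bullet> J z = z \<bullet> J z" using sym[of "inv J (J z)" z] sym[of z z] by (simp add: inner_commute)
  then show ?thesis by (simp add: resolvent_form_def inner_diff_left)
qed

lemma is_GQF_resolvent_form:
  assumes lin: "linear J" and sym: "\<And>x y. J x \<bullet> y = x \<bullet> J y"
  shows "is_GQF (resolvent_form s J)"
proof -
  have dom: "edom (resolvent_form s J) = range J" by (auto simp: edom_def resolvent_form_def)
  \<comment> \<open>\<open>inv J\<close> may fail to be linear; a linear right inverse
    \<open>k\<close> on the range gives the same values and supplies the operator of the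
    form.\<close>
  obtain k where k: "linear k" "\<And>v. v \<in> range J \<Longrightarrow> J (k v) = v"
    using linear_exists_right_inverse_on[OF lin subspace_UNIV] by auto
  have app: "resolvent_form s J w = ereal (s *\<^sub>R (k w - w) \<bullet> w)" if "w \<in> range J" for w
    using resolvent_form_apply[OF lin sym, of s "k w"] k(2)[OF that] by simp
  have sym': "s *\<^sub>R (k x - x) \<bullet> y = x \<bullet> s *\<^sub>R (k y - y)" if "x \<in> range J" "y \<in> range J" for x y
    using sym[of "k x" "k y"] k(2)[OF that(1)] k(2)[OF that(2)]
    by (simp add: inner_diff_left inner_diff_right)
  show ?thesis
    unfolding is_GQF_def proper_fun_def dom
  proof (intro conjI)
    show "\<forall>x. resolvent_form s J x \<noteq> - \<infinity>" by (simp add: resolvent_form_def)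
    show "subspace (range J)" using linear_subspace_image[OF lin subspace_UNIV] .
    show "\<exists>L :: 'a \<Rightarrow> 'a. (\<forall>x\<in>range J. \<forall>y\<in>range J. L (x + y) = L x + L y) \<and>
        (\<forall>c. \<forall>x\<in>range J. L (c *\<^sub>R x) = c *\<^sub>R L x) \<and>
        (\<forall>x\<in>range J. \<forall>y\<in>range J. L x \<bullet> y = x \<bullet> L y) \<and>
        (\<forall>x\<in>range J. resolvent_form s J x = ereal (L x \<bullet> x))"
      using app sym' k(1)
      by (intro exI[of _ "\<lambda>w. s *\<^sub>R (k w - w)"])
        (auto simp: linear_add linear_scale algebra_simps)
  qed simp
qed

lemma epi_converges_resolvent_form:
  fixes J :: "nat \<Rightarrow> 'a::euclidean_space \<Rightarrow> 'a"
  assumes lin: "\<And>k. linear (J k)" and sym: "\<And>k x y. J k x \<bullet> y = x \<bullet> J k y"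
    and lin0: "linear J0" and lim: "\<And>z. (\<lambda>k. J k z) \<longlonglongrightarrow> J0 z" and s: "0 < s"
    and lower: "\<And>k z. - (C * (norm (J k z))\<^sup>2) \<le> s * ((z - J k z) \<bullet> J k z)"
  shows "(\<And>x y. J0 x \<bullet> y = x \<bullet> J0 y)" "epi_converges (\<lambda>k. resolvent_form s (J k)) (resolvent_form s J0)"
proof -
  show sym0: "J0 x \<bullet> y = x \<bullet> J0 y" for x y
  proof (rule LIMSEQ_unique)
    show "(\<lambda>k. J k x \<bullet> y) \<longlonglongrightarrow> J0 x \<bullet> y" by (intro tendsto_intros lim)
    show "(\<lambda>k. J k x \<bullet> y) \<longlonglongrightarrow> x \<bullet> J0 y" unfolding sym by (intro tendsto_intros lim)
  qed
  let ?E = "\<lambda>k. epi (resolvent_form s (J k))"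
  have outer: "(w, \<alpha>) \<in> epi (resolvent_form s J0)" if mem: "(w, \<alpha>) \<in> PK_outer_limit ?E" for w \<alpha>
  proof -
    obtain r :: "nat \<Rightarrow> nat" and zs where r: "strict_mono (r :: nat \<Rightarrow> nat)" "\<And>k. zs k \<in> ?E (r k)" "zs \<longlonglongrightarrow> (w, \<alpha>)"
      using mem by (auto simp: PK_outer_limit_def)
    define wk where "wk k = fst (zs k)" for k
    define ak where "ak k = snd (zs k)" for k
    have wlim: "wk \<longlonglongrightarrow> w" and alim: "ak \<longlonglongrightarrow> \<alpha>"
      using tendsto_fst[OF r(3)] tendsto_snd[OF r(3)] by (simp_all add: wk_def[abs_def] ak_def[abs_def])
    have plim: "(\<lambda>k. J (r k) z) \<longlonglongrightarrow> J0 z" for z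
      using LIMSEQ_subseq_LIMSEQ[OF lim r(1)] by (simp add: o_def)
    \<comment> \<open>The points \<open>wk k\<close> may have unbounded preimages under
      \<open>J (r k)\<close>. The form is therefore bounded below by expanding about a fixed
      \<open>z\<close>: value and tangent at \<open>J (r k) z\<close>, with the quadratic remainder
      controlled by \<open>lower\<close>. Every term of this bound converges.\<close>
    have bound: "s * ((z - J0 z) \<bullet> J0 z) + 2 * (s * ((z - J0 z) \<bullet> (w - J0 z))) - C * (norm (w - J0 z))\<^sup>2 \<le> \<alpha>" for z
    proof (rule LIMSEQ_le)
      show "ak \<longlonglongrightarrow> \<alpha>" by (rule alim)
      show "(\<lambda>k. s * ((z - J (r k) z) \<bullet> J (r k) z) + 2 * (s * ((z - J (r k) z) \<bullet> (wk k - J (r k) z)))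
             - C * (norm (wk k - J (r k) z))\<^sup>2)
         \<longlonglongrightarrow> s * ((z - J0 z) \<bullet> J0 z) + 2 * (s * ((z - J0 z) \<bullet> (w - J0 z))) - C * (norm (w - J0 z))\<^sup>2"
        by (intro tendsto_intros plim wlim)
      have "s * ((z - J (r k) z) \<bullet> J (r k) z) + 2 * (s * ((z - J (r k) z) \<bullet> (wk k - J (r k) z)))
             - C * (norm (wk k - J (r k) z))\<^sup>2 \<le> ak k" for k
      proof -
        let ?J = "J (r k)"
        have "resolvent_form s ?J (wk k) \<le> ereal (ak k)"
          using r(2)[of k] by (simp add: epi_def wk_def ak_def case_prod_unfold)
        then obtain \<zeta> where \<zeta>: "wk k = ?J \<zeta>"
          by (auto simp: resolvent_form_def split: if_splits)
        then have a: "s * ((\<zeta> - wk k) \<bullet> wk k) \<le> ak k"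
          using \<open>resolvent_form s ?J (wk k) \<le> _\<close> resolvent_form_apply[OF lin[of "r k"] sym, of s \<zeta>] by simp
        define d where "d = \<zeta> - z"
        have Jd: "?J d = wk k - ?J z" by (simp add: d_def \<zeta> linear_diff[OF lin])
        have low: "- (C * (norm (wk k - ?J z))\<^sup>2) \<le> s * ((d - (wk k - ?J z)) \<bullet> (wk k - ?J z))"
          using lower[of "r k" d] by (simp add: Jd)
        have dz: "d \<bullet> ?J z = (wk k - ?J z) \<bullet> z" using sym[of "r k" d z] by (simp add: Jd)
        have "(\<zeta> - wk k) \<bullet> wk k = (z - ?J z) \<bullet> ?J z + 2 * ((z - ?J z) \<bullet> (wk k - ?J z))
             + (d - (wk k - ?J z)) \<bullet> (wk k - ?J z)"
          using dz by (simp add: d_def inner_diff_left inner_diff_right inner_commute)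
        then have "s * ((\<zeta> - wk k) \<bullet> wk k) = s * ((z - ?J z) \<bullet> ?J z) + 2 * (s * ((z - ?J z) \<bullet> (wk k - ?J z)))
             + s * ((d - (wk k - ?J z)) \<bullet> (wk k - ?J z))"
          by (simp add: distrib_left)
        then show ?thesis using a low by linarith
      qed
      then show "\<exists>N. \<forall>k\<ge>N. s * ((z - J (r k) z) \<bullet> J (r k) z) + 2 * (s * ((z - J (r k) z) \<bullet> (wk k - J (r k) z)))
             - C * (norm (wk k - J (r k) z))\<^sup>2 \<le> ak k" by blast
    qed
    have "w \<in> range J0"
    proof (rule ccontr)
      assume "w \<notin> range J0"
      then obtain n where n: "J0 n = 0" "0 < n \<bullet> w" using kernel_vector_off_range[OF lin0 sym0] by blast
      \<comment> \<open>For \<open>z = \<tau> n\<close> only the tangent term depends on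
        \<open>\<tau>\<close>, linearly with positive slope, so a large \<open>\<tau>\<close>
        violates the bound.\<close>
      have "2 * (s * (\<tau> * (n \<bullet> w))) - C * (norm w)\<^sup>2 \<le> \<alpha>" for \<tau>
        using bound[of "\<tau> *\<^sub>R n"] by (simp add: linear_scale[OF lin0] n(1))
      from this[of "(\<alpha> + C * (norm w)\<^sup>2 + 1) / (2 * (s * (n \<bullet> w)))"]
      show False using mult_pos_pos[OF s n(2)] by (simp add: field_simps)
    qed
    then obtain z where z: "w = J0 z" by blast
    have "s * ((z - w) \<bullet> w) \<le> \<alpha>" using bound[of z] by (simp add: z)
    then show ?thesis using resolvent_form_apply[OF lin0 sym0, of s z] by (simp add: epi_def z)
  qed
  have inner: "(w, \<alpha>) \<in> PK_inner_limit ?E" if "(w, \<alpha>) \<in> epi (resolvent_form s J0)" for w \<alpha>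
  proof -
    have le: "resolvent_form s J0 w \<le> ereal \<alpha>" using that by (simp add: epi_def)
    then obtain z where z: "w = J0 z" by (auto simp: resolvent_form_def split: if_splits)
    have le': "s * ((z - J0 z) \<bullet> J0 z) \<le> \<alpha>" using le resolvent_form_apply[OF lin0 sym0, of s z] by (simp add: z)
    \<comment> \<open>Recovery sequence: the images under \<open>J k\<close> of one fixed preimage,
      with the excess of \<open>\<alpha>\<close> over the limit value added to the height.\<close>
    define zs where "zs k = (J k z, s * ((z - J k z) \<bullet> J k z) + (\<alpha> - s * ((z - J0 z) \<bullet> J0 z)))" for k
    have "zs k \<in> ?E k" for k
      using le' resolvent_form_apply[OF lin[of k] sym, of s z] by (simp add: epi_def zs_def)
    moreover have "zs \<longlonglongrightarrow> (J0 z, s * ((z - J0 z) \<bullet> J0 z) + (\<alpha> - s * ((z - J0 z) \<bullet> J0 z)))"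
      unfolding zs_def by (intro tendsto_intros lim)
    ultimately show ?thesis unfolding PK_inner_limit_def z by (auto intro!: exI[of _ zs])
  qed
  show "epi_converges (\<lambda>k. resolvent_form s (J k)) (resolvent_form s J0)"
    unfolding epi_converges_def PK_converges_def
    using PK_inner_subset_outer[of ?E] outer inner by (auto simp: subset_eq split_paired_all)
qed

subsection \<open>The Moreau envelope of a prox-regular function\<close>

locale prox_regular_at =
  fixes f :: "'a::euclidean_space \<Rightarrow> ereal" and xb :: 'a and \<rho> r fb :: real
  assumes rho_pos: "0 < \<rho>" and r_nonneg: "0 \<le> r" and f_xb: "f xb = ereal fb"
    and lsc: "\<And>x. x \<in> cball xb \<rho> \<Longrightarrow> f x \<le> Liminf (at x) f"
    and zero_subgradient: "0 \<in> limiting_subdifferential f xb"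
    and prox: "\<And>x v x'. v \<in> limiting_subdifferential f x \<Longrightarrow> x \<in> cball xb \<rho> \<Longrightarrow> norm v \<le> \<rho> \<Longrightarrow>
       f x < f xb + ereal \<rho> \<Longrightarrow> x' \<in> cball xb \<rho> \<Longrightarrow>
       f x + ereal (v \<bullet> (x' - x)) - ereal (r / 2 * (norm (x' - x))\<^sup>2) \<le> f x'"

lemma prox_regular_locale:
  assumes "prox_regular f xb 0"
  obtains \<rho> r fb where "prox_regular_at f xb \<rho> r fb"
proof -
  have fin: "\<bar>f xb\<bar> \<noteq> \<infinity>" and sub: "0 \<in> limiting_subdifferential f xb"
    using assms by (simp_all add: prox_regular_def)
  obtain \<delta> where \<delta>: "0 < \<delta>" and lsc: "\<And>x. x \<in> ball xb \<delta> \<Longrightarrow> f x \<le> Liminf (at x) f"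
    using assms unfolding prox_regular_def lsc_around_def by blast
  obtain \<epsilon> r where \<epsilon>: "0 < \<epsilon>" and r: "0 \<le> r" and all: "\<forall>(x, v) \<in> gph_subdifferential f \<inter> cball (xb, 0) \<epsilon>.
        f x < f xb + ereal \<epsilon> \<longrightarrow> (\<forall>x'\<in>cball xb \<epsilon>.
           f x' \<ge> f x + ereal (v \<bullet> (x' - x)) - ereal (r / 2 * (norm (x' - x))\<^sup>2))"
    using assms unfolding prox_regular_def by blast
  have prox: "f x + ereal (v \<bullet> (x' - x)) - ereal (r / 2 * (norm (x' - x))\<^sup>2) \<le> f x'"
    if "(x, v) \<in> gph_subdifferential f \<inter> cball (xb, 0) \<epsilon>" "f x < f xb + ereal \<epsilon>" "x' \<in> cball xb \<epsilon>" for x v x'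
    using bspec[OF all that(1)] that(2,3) by simp
  obtain fb where fb: "f xb = ereal fb" using fin by (cases "f xb") auto
  \<comment> \<open>Half of \<open>\<epsilon>\<close>, so that \<open>x\<close> and \<open>v\<close>
    each within \<open>\<rho>\<close> form a pair within \<open>\<epsilon>\<close>; half of
    \<open>\<delta>\<close>, so that the closed ball lies in the open one.\<close>
  define \<rho> where "\<rho> = min (\<epsilon> / 2) (\<delta> / 2)"
  have "prox_regular_at f xb \<rho> r fb"
  proof
    show "0 < \<rho>" using \<epsilon> \<delta> by (simp add: \<rho>_def)
    show "f x \<le> Liminf (at x) f" if "x \<in> cball xb \<rho>" for x
      using that \<delta> by (intro lsc) (auto simp: \<rho>_def)
    fix x v x'
    assume v: "v \<in> limiting_subdifferential f x" and x: "x \<in> cball xb \<rho>" and nv: "norm v \<le> \<rho>"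
      and fx: "f x < f xb + ereal \<rho>" and x': "x' \<in> cball xb \<rho>"
    have "dist (xb, 0) (x, v) \<le> dist xb x + norm v"
      unfolding dist_Pair_Pair using sqrt_sum_squares_le_sum_abs[of "dist xb x" "dist 0 v"] by simp
    also have "\<dots> \<le> \<epsilon>" using x nv by (simp add: \<rho>_def)
    finally have "(x, v) \<in> gph_subdifferential f \<inter> cball (xb, 0) \<epsilon>"
      using v by (simp add: gph_subdifferential_def)
    moreover have "f x < f xb + ereal \<epsilon>"
    proof (rule less_le_trans[OF fx])
      have "\<rho> \<le> \<epsilon>" using \<epsilon> by (simp add: \<rho>_def)
      then show "f xb + ereal \<rho> \<le> f xb + ereal \<epsilon>" by (simp add: fb)
    qed
    moreover have "x' \<in> cball xb \<epsilon>" using x' \<epsilon> by (simp add: \<rho>_def)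
    ultimately show "f x + ereal (v \<bullet> (x' - x)) - ereal (r / 2 * (norm (x' - x))\<^sup>2) \<le> f x'"
      by (rule prox)
  qed (use r fb sub in auto)
  then show ?thesis by (rule that)
qed

context prox_regular_at
begin

lemma growth_xb:
  assumes "x \<in> cball xb \<rho>"
  shows "ereal (fb - r / 2 * (norm (x - xb))\<^sup>2) \<le> f x"
  using prox[OF zero_subgradient _ _ _ assms] rho_pos by (simp add: f_xb)

text \<open>Chosen so that \<open>s - r \<ge> s / 2 > 0\<close>; this margin over the
  prox-regularity modulus produces the constants in \<open>P_near\<close> and
  \<open>P_lipschitz\<close>.\<close>

definition s :: real where "s = 2 * r + 1"

lemma s_ge: "1 \<le> s" "2 * r \<le> s" "0 < s" using r_nonneg by (auto simp: s_def)

text \<open>For \<open>y\<close> within \<open>R\<close> of \<open>xb\<close>, the estimates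
  \<open>P_near\<close> and \<open>norm_G\<close>, with factors \<open>4\<close> and
  \<open>5 s\<close>, keep \<open>P y\<close> and \<open>G y\<close> where the prox-regularity
  inequality is available; \<open>R \<le> 1\<close> bounds a squared distance by \<open>R\<close> in
  \<open>f_P_less\<close>.\<close>

definition R :: real where "R = min 1 (\<rho> / (5 * (s + 1)))"

lemma R_pos: "0 < R" using rho_pos s_ge by (simp add: R_def)

lemma R_le: "R \<le> 1" "5 * R < \<rho>" "5 * s * R < \<rho>"
proof -
  have "R \<le> \<rho> / (5 * (s + 1))" by (simp add: R_def)
  then have "5 * s * R + 5 * R \<le> \<rho>" using s_ge by (simp add: field_simps)
  moreover have "0 < s * R" using s_ge R_pos by simp
  ultimately show "5 * R < \<rho>" "5 * s * R < \<rho>" using R_pos by linarith+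
qed (simp add: R_def)

text \<open>A minimizer over the closed ball exists by lower semicontinuity and is selected
  arbitrarily; near \<open>xb\<close> the selection is Lipschitz by \<open>P_lipschitz\<close>, and
  the constraint is inactive by \<open>P_ball\<close>.\<close>

definition P :: "'a \<Rightarrow> 'a" where
  "P y = (SOME x. x \<in> cball xb \<rho> \<and> (\<forall>x'\<in>cball xb \<rho>. f x + ereal (s / 2 * (norm (x - y))\<^sup>2) \<le> f x' + ereal (s / 2 * (norm (x' - y))\<^sup>2)))"

lemma P_in: "P y \<in> cball xb \<rho>"
  and P_le: "x' \<in> cball xb \<rho> \<Longrightarrow> f (P y) + ereal (s / 2 * (norm (P y - y))\<^sup>2) \<le> f x' + ereal (s / 2 * (norm (x' - y))\<^sup>2)"
proof -
  obtain x where "x \<in> cball xb \<rho>" "\<And>x'. x' \<in> cball xb \<rho> \<Longrightarrow>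
      f x + ereal (s / 2 * (norm (x - y))\<^sup>2) \<le> f x' + ereal (s / 2 * (norm (x' - y))\<^sup>2)"
    by (rule lsc_plus_continuous_attains_inf[of "cball xb \<rho>" f "\<lambda>x. s / 2 * (norm (x - y))\<^sup>2"])
      (use rho_pos lsc in \<open>auto intro!: continuous_intros\<close>)
  then have "\<exists>x. x \<in> cball xb \<rho> \<and> (\<forall>x'\<in>cball xb \<rho>. f x + ereal (s / 2 * (norm (x - y))\<^sup>2) \<le> f x' + ereal (s / 2 * (norm (x' - y))\<^sup>2))"
    by blast
  from someI_ex[OF this] show "P y \<in> cball xb \<rho>"
    "x' \<in> cball xb \<rho> \<Longrightarrow> f (P y) + ereal (s / 2 * (norm (P y - y))\<^sup>2) \<le> f x' + ereal (s / 2 * (norm (x' - y))\<^sup>2)"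
    unfolding P_def[symmetric] by blast+
qed

definition fP :: "'a \<Rightarrow> real" where "fP y = real_of_ereal (f (P y))"

definition env :: "'a \<Rightarrow> real" where "env y = fP y + s / 2 * (norm (P y - y))\<^sup>2"

definition G :: "'a \<Rightarrow> 'a" where "G y = s *\<^sub>R (y - P y)"

lemma f_P: "f (P y) = ereal (fP y)"
proof -
  have "f (P y) \<noteq> \<infinity>" using P_le[of xb y] rho_pos by (auto simp: f_xb)
  moreover have "f (P y) \<noteq> -\<infinity>" using growth_xb[OF P_in[of y]] by auto
  ultimately show ?thesis by (cases "f (P y)") (auto simp: fP_def)
qed

lemma env_le: "x' \<in> cball xb \<rho> \<Longrightarrow> ereal (env y) \<le> f x' + ereal (s / 2 * (norm (x' - y))\<^sup>2)"
  using P_le[of x' y] by (simp add: f_P env_def)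

lemma env_le': "x' \<in> cball xb \<rho> \<Longrightarrow> ereal (env y - s / 2 * (norm (x' - y))\<^sup>2) \<le> f x'"
  using env_le[of x' y] by (cases "f x'") auto

lemma env_le_P: "env y' \<le> fP y + s / 2 * (norm (P y - y'))\<^sup>2"
  using env_le[OF P_in[of y], of y'] by (simp add: f_P)

text \<open>The point \<open>P y\<close> is a competitor in the problem defining the envelope at
  \<open>y'\<close>; expanding the square gives slope \<open>G y\<close> and curvature
  \<open>s\<close>.\<close>

lemma env_upper: "env y' \<le> env y + G y \<bullet> (y' - y) + s / 2 * (norm (y' - y))\<^sup>2"
proof -
  have "(norm (P y - y'))\<^sup>2 = (norm (P y - y))\<^sup>2 + 2 * ((y - P y) \<bullet> (y' - y)) + (norm (y' - y))\<^sup>2"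
    by (simp add: power2_norm_eq_inner algebra_simps inner_commute)
  then have "s / 2 * (norm (P y - y'))\<^sup>2 = s / 2 * (norm (P y - y))\<^sup>2 + G y \<bullet> (y' - y) + s / 2 * (norm (y' - y))\<^sup>2"
    by (simp add: G_def distrib_left)
  then show ?thesis using env_le_P[of y' y] unfolding env_def by linarith
qed

text \<open>Minimality of \<open>P y\<close> is tested at \<open>xb\<close>, and
  \<open>growth_xb\<close> bounds \<open>f (P y)\<close> from below;
  \<open>s - r \<ge> s / 2\<close> turns the result into the factor \<open>4\<close>.\<close>

lemma P_near: "norm (P y - xb) \<le> 4 * norm (y - xb)"
proof -
  let ?p = "norm (P y - xb)" and ?d = "norm (y - xb)"
  have "fP y + s / 2 * (norm (P y - y))\<^sup>2 \<le> fb + s / 2 * ?d\<^sup>2"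
    using P_le[of xb y] rho_pos by (simp add: f_P f_xb norm_minus_commute)
  moreover have "fb - r / 2 * ?p\<^sup>2 \<le> fP y"
    using growth_xb[OF P_in[of y]] by (simp add: f_P)
  moreover have "(norm (P y - y))\<^sup>2 = ?p\<^sup>2 - 2 * ((P y - xb) \<bullet> (y - xb)) + ?d\<^sup>2"
    by (simp add: power2_norm_eq_inner algebra_simps inner_commute)
  ultimately have "(s - r) * ?p\<^sup>2 \<le> 2 * s * ((P y - xb) \<bullet> (y - xb))"
    by (simp add: algebra_simps)
  also have "\<dots> \<le> 2 * s * (?p * ?d)" using s_ge norm_cauchy_schwarz by (intro mult_left_mono) auto
  finally have "(s - r) * ?p\<^sup>2 \<le> 2 * s * (?p * ?d)" .
  moreover have "s / 2 * ?p\<^sup>2 \<le> (s - r) * ?p\<^sup>2" using s_ge by (intro mult_right_mono) auto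
  ultimately have "s / 2 * (?p * ?p) \<le> s / 2 * (?p * (4 * ?d))" by (simp add: power2_eq_square algebra_simps)
  then have "?p * ?p \<le> ?p * (4 * ?d)" using s_ge by (simp only: mult_le_cancel_left_pos half_gt_zero)
  then show ?thesis by (cases "?p = 0") (auto simp: mult_le_cancel_left_pos)
qed

lemma P_xb: "P xb = xb" using P_near[of xb] by simp

lemma G_xb: "G xb = 0" by (simp add: G_def P_xb)

lemma P_dist: "norm (P y - y) \<le> 5 * norm (y - xb)"
  using P_near[of y] norm_triangle_ineq4[of "P y - xb" "y - xb"] by simp

lemma norm_G: "norm (G y) \<le> 5 * s * norm (y - xb)"
  using P_dist[of y] s_ge by (simp add: G_def norm_minus_commute mult_left_mono)

context
  fixes y assumes y: "y \<in> ball xb R"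
begin

lemma norm_y: "norm (y - xb) < R" using y by (simp add: dist_norm norm_minus_commute)

lemma P_ball: "P y \<in> ball xb \<rho>"
proof -
  have "norm (P y - xb) < \<rho>" using P_near[of y] norm_y R_le R_pos by linarith
  then show ?thesis by (simp add: dist_norm norm_minus_commute)
qed

lemma G_small: "norm (G y) \<le> \<rho>"
proof -
  have "5 * s * norm (y - xb) \<le> 5 * s * R" using norm_y s_ge by (intro mult_left_mono) auto
  then show ?thesis using norm_G[of y] R_le by linarith
qed

lemma f_P_less: "f (P y) < f xb + ereal \<rho>"
proof -
  have "(norm (y - xb))\<^sup>2 \<le> R * 1" unfolding power2_eq_square
    using norm_y R_le R_pos by (intro mult_mono) auto
  then have "s / 2 * (norm (y - xb))\<^sup>2 \<le> s / 2 * R" using s_ge by (intro mult_left_mono) auto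
  moreover have "0 < s * R" "0 \<le> s / 2 * (norm (P y - y))\<^sup>2" using s_ge R_pos by auto
  moreover have "fP y + s / 2 * (norm (P y - y))\<^sup>2 \<le> fb + s / 2 * (norm (y - xb))\<^sup>2"
    using P_le[of xb y] rho_pos by (simp add: f_P f_xb norm_minus_commute)
  ultimately have "fP y < fb + \<rho>" using R_le by simp
  then show ?thesis by (simp add: f_P f_xb)
qed

text \<open>Optimality of \<open>P y\<close>: the proximal problem at \<open>y\<close> yields a
  quadratic of slope \<open>G y\<close> and curvature \<open>- s\<close> that supports
  \<open>f\<close> at \<open>P y\<close>.\<close>

lemma G_subgradient: "G y \<in> limiting_subdifferential f (P y)"
proof (rule limiting_subdifferentialI)
  show "f (P y) = ereal (fP y)" by (rule f_P)
  have "\<forall>\<^sub>F x' in nhds (P y). x' \<in> ball xb \<rho>" using P_ball by (intro eventually_nhds_in_open) auto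
  then show "\<forall>\<^sub>F x' in nhds (P y). ereal (fP y + G y \<bullet> (x' - P y) - s / 2 * (norm (x' - P y))\<^sup>2) \<le> f x'"
  proof eventually_elim
    case (elim x')
    have "(norm (x' - y))\<^sup>2 = (norm (P y - y))\<^sup>2 - 2 * ((y - P y) \<bullet> (x' - P y)) + (norm (x' - P y))\<^sup>2"
      by (simp add: power2_norm_eq_inner algebra_simps inner_commute)
    then have "s / 2 * (norm (x' - y))\<^sup>2 = s / 2 * (norm (P y - y))\<^sup>2 - G y \<bullet> (x' - P y) + s / 2 * (norm (x' - P y))\<^sup>2"
      by (simp add: G_def distrib_left right_diff_distrib)
    then have "env y - s / 2 * (norm (x' - y))\<^sup>2 = fP y + G y \<bullet> (x' - P y) - s / 2 * (norm (x' - P y))\<^sup>2"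
      unfolding env_def by linarith
    then show ?case using env_le'[of x' y] elim by simp
  qed
qed

lemma P_gph: "(P y, G y) \<in> gph_subdifferential f"
  using G_subgradient by (simp add: gph_subdifferential_def)

text \<open>Prox-regularity improves the curvature \<open>- s\<close> found in
  \<open>G_subgradient\<close> to \<open>- r\<close>; the gap between \<open>r\<close> and
  \<open>s\<close> is what makes \<open>P\<close> Lipschitz.\<close>

lemma prox_growth:
  assumes "x' \<in> cball xb \<rho>"
  shows "ereal (fP y + G y \<bullet> (x' - P y) - r / 2 * (norm (x' - P y))\<^sup>2) \<le> f x'"
  using prox[OF G_subgradient P_in G_small f_P_less assms] by (simp add: f_P)

lemma second_subderivative_P_ge: "ereal (- r * (norm w)\<^sup>2) \<le> second_subderivative f (P y) (G y) w"
proof (rule second_subderivative_ge_quadratic[of f "P y" "fP y"])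
  have "\<forall>\<^sub>F x' in nhds (P y). x' \<in> ball xb \<rho>" using P_ball by (intro eventually_nhds_in_open) auto
  then show "\<forall>\<^sub>F x' in nhds (P y). ereal (fP y + G y \<bullet> (x' - P y) + - r / 2 * (norm (x' - P y))\<^sup>2) \<le> f x'"
    by eventually_elim (use prox_growth in simp)
qed (rule f_P)

end

text \<open>Adding \<open>prox_growth\<close> at \<open>y1\<close> and at \<open>y2\<close> gives
  hypomonotonicity of the pairs \<open>(P y, G y)\<close>, and \<open>G = s (id - P)\<close>
  converts it into a bound on \<open>P\<close>.\<close>

lemma P_lipschitz:
  assumes y: "y1 \<in> ball xb R" "y2 \<in> ball xb R"
  shows "norm (P y1 - P y2) \<le> 2 * norm (y1 - y2)"
proof -
  let ?u = "P y1 - P y2" and ?d = "y1 - y2"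
  have "fP y1 + G y1 \<bullet> (P y2 - P y1) - r / 2 * (norm (P y2 - P y1))\<^sup>2 \<le> fP y2"
    using prox_growth[OF y(1) P_in[of y2]] by (simp add: f_P)
  moreover have "fP y2 + G y2 \<bullet> (P y1 - P y2) - r / 2 * (norm (P y1 - P y2))\<^sup>2 \<le> fP y1"
    using prox_growth[OF y(2) P_in[of y1]] by (simp add: f_P)
  ultimately have "- (r * (norm ?u)\<^sup>2) \<le> (G y1 - G y2) \<bullet> ?u"
    by (simp add: norm_minus_commute inner_diff_left inner_diff_right)
  also have "(G y1 - G y2) \<bullet> ?u = s * (?d \<bullet> ?u) - s * (norm ?u)\<^sup>2"
    by (simp add: G_def power2_norm_eq_inner algebra_simps)
  finally have "(s - r) * (norm ?u)\<^sup>2 \<le> s * (?d \<bullet> ?u)" by (simp add: algebra_simps)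
  also have "\<dots> \<le> s * (norm ?d * norm ?u)" using s_ge norm_cauchy_schwarz by (intro mult_left_mono) auto
  finally have "(s - r) * (norm ?u)\<^sup>2 \<le> s * (norm ?d * norm ?u)" .
  moreover have "s / 2 * (norm ?u)\<^sup>2 \<le> (s - r) * (norm ?u)\<^sup>2" using s_ge by (intro mult_right_mono) auto
  ultimately have "s / 2 * (norm ?u * norm ?u) \<le> s / 2 * (norm ?u * (2 * norm ?d))"
    by (simp add: power2_eq_square algebra_simps)
  then have "norm ?u * norm ?u \<le> norm ?u * (2 * norm ?d)" using s_ge by (simp only: mult_le_cancel_left_pos half_gt_zero)
  then show ?thesis by (cases "norm ?u = 0") (auto simp: mult_le_cancel_left_pos)
qed

lemma G_lipschitz:
  assumes y: "y1 \<in> ball xb R" "y2 \<in> ball xb R"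
  shows "norm (G y1 - G y2) \<le> 3 * s * norm (y1 - y2)"
proof -
  have "G y1 - G y2 = s *\<^sub>R ((y1 - y2) - (P y1 - P y2))" by (simp add: G_def algebra_simps)
  then have "norm (G y1 - G y2) = s * norm ((y1 - y2) - (P y1 - P y2))" using s_ge by simp
  also have "\<dots> \<le> s * (norm (y1 - y2) + 2 * norm (y1 - y2))"
    using s_ge norm_triangle_ineq4[of "y1 - y2" "P y1 - P y2"] P_lipschitz[OF y] by (intro mult_left_mono) linarith+
  finally show ?thesis by simp
qed

text \<open>\<open>env_upper\<close> with the points exchanged bounds \<open>env y'\<close> from
  below with slope \<open>G y'\<close>; passing to \<open>G y\<close> costs \<open>3 s\<close> by
  \<open>G_lipschitz\<close>, and \<open>3 s + s / 2 \<le> 4 s\<close>.\<close>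

lemma env_lower:
  assumes y: "y \<in> ball xb R" "y' \<in> ball xb R"
  shows "env y + G y \<bullet> (y' - y) - 4 * s * (norm (y' - y))\<^sup>2 \<le> env y'"
proof -
  have "env y \<le> env y' + G y' \<bullet> (y - y') + s / 2 * (norm (y' - y))\<^sup>2"
    using env_upper[of y y'] by (simp add: norm_minus_commute)
  moreover have "(G y' - G y) \<bullet> (y - y') \<le> 3 * s * (norm (y' - y))\<^sup>2"
  proof -
    have "(G y' - G y) \<bullet> (y - y') \<le> norm (G y' - G y) * norm (y - y')" by (rule norm_cauchy_schwarz)
    also have "\<dots> \<le> 3 * s * norm (y' - y) * norm (y - y')"
      using G_lipschitz[OF y(2,1)] by (intro mult_right_mono) auto
    finally show ?thesis by (simp add: power2_eq_square norm_minus_commute)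
  qed
  moreover have "0 \<le> s * (norm (y' - y))\<^sup>2" using s_ge by simp
  ultimately show ?thesis by (simp add: inner_diff_left inner_diff_right algebra_simps)
qed

lemma env_has_derivative:
  assumes y: "y \<in> ball xb R"
  shows "(env has_derivative (\<lambda>h. G y \<bullet> h)) (at y)"
  unfolding has_derivative_at2
proof
  show "bounded_linear (\<lambda>h. G y \<bullet> h)" by (rule bounded_linear_inner_right)
  show "((\<lambda>y'. (1 / norm (y' - y)) *\<^sub>R (env y' - (env y + G y \<bullet> (y' - y)))) \<longlongrightarrow> 0) (at y)"
  proof (rule Lim_null_comparison)
    have "\<forall>\<^sub>F y' in at y. y' \<in> ball xb R \<and> y' \<noteq> y"
      using y eventually_nhds_in_open[OF open_ball y] by (simp add: eventually_at_filter eventually_mono)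
    then show "\<forall>\<^sub>F y' in at y. norm ((1 / norm (y' - y)) *\<^sub>R (env y' - (env y + G y \<bullet> (y' - y)))) \<le> 4 * s * norm (y' - y)"
    proof eventually_elim
      case (elim y')
      have "0 \<le> s * (norm (y' - y))\<^sup>2" using s_ge by simp
      then have "\<bar>env y' - (env y + G y \<bullet> (y' - y))\<bar> \<le> 4 * s * (norm (y' - y))\<^sup>2"
        using env_lower[OF y, of y'] env_upper[of y' y] elim by (simp add: abs_le_iff algebra_simps)
      then show ?case using elim by (simp add: field_simps power2_eq_square)
    qed
    have "((\<lambda>y'. 4 * s * norm (y' - y)) \<longlongrightarrow> 4 * s * norm (y - y)) (at y)" by (intro tendsto_intros)
    then show "((\<lambda>y'. 4 * s * norm (y' - y)) \<longlongrightarrow> 0) (at y)" by simp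
  qed
qed

end

subsection \<open>Second subderivatives at points of differentiability of the proximal map\<close>

lemma norm_add_scaleR_square:
  fixes a d :: "'a::real_inner"
  shows "(norm (a + t *\<^sub>R d))\<^sup>2 = (norm a)\<^sup>2 + 2 * (t * (a \<bullet> d)) + t\<^sup>2 * (norm d)\<^sup>2"
  by (simp add: power2_norm_eq_inner inner_add_left inner_add_right inner_commute power2_eq_square[of t] algebra_simps)

context prox_regular_at
begin

definition G_Gateaux :: "'a \<Rightarrow> ('a \<Rightarrow> 'a) \<Rightarrow> bool" where
  "G_Gateaux y A \<longleftrightarrow> linear A \<and> (\<forall>w. ((\<lambda>t. (G (y + t *\<^sub>R w) - G y) /\<^sub>R t) \<longlongrightarrow> A w) (at 0))"

definition prox_deriv :: "('a \<Rightarrow> 'a) \<Rightarrow> 'a \<Rightarrow> 'a" where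
  "prox_deriv A z = z - A z /\<^sub>R s"

definition env_quot :: "'a \<Rightarrow> real \<Rightarrow> 'a \<Rightarrow> real" where
  "env_quot y t z = (env (y + t *\<^sub>R z) - env y - t * (G y \<bullet> z)) / (t\<^sup>2 / 2)"

lemma A_eq_prox_deriv: "A z = s *\<^sub>R (z - prox_deriv A z)"
  using s_ge by (simp add: prox_deriv_def)

lemma linear_prox_derivI: "linear A \<Longrightarrow> linear (prox_deriv A)"
  unfolding prox_deriv_def by (intro linear_compose_sub linear_compose_scale_right linear_ident)

lemma env_expand: "t \<noteq> 0 \<Longrightarrow> env (y + t *\<^sub>R z) = env y + t * (G y \<bullet> z) + t\<^sup>2 / 2 * env_quot y t z"
  by (simp add: env_quot_def del: times_divide_eq_left divide_divide_eq_left divide_divide_eq_right)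

lemma shifted_square:
  "s / 2 * (norm (P y + t *\<^sub>R u - (y + t *\<^sub>R z)))\<^sup>2
     = s / 2 * (norm (P y - y))\<^sup>2 - t * (G y \<bullet> (u - z)) + t\<^sup>2 / 2 * (s * (norm (u - z))\<^sup>2)"
proof -
  have "P y + t *\<^sub>R u - (y + t *\<^sub>R z) = (P y - y) + t *\<^sub>R (u - z)" by (simp add: algebra_simps)
  then have sq: "(norm (P y + t *\<^sub>R u - (y + t *\<^sub>R z)))\<^sup>2
      = (norm (P y - y))\<^sup>2 + 2 * (t * ((P y - y) \<bullet> (u - z))) + t\<^sup>2 * (norm (u - z))\<^sup>2"
    by (simp only: norm_add_scaleR_square)
  have G: "G y \<bullet> (u - z) = - (s * ((P y - y) \<bullet> (u - z)))"
    by (simp add: G_def inner_diff_left algebra_simps)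
  show ?thesis unfolding sq G by (simp add: distrib_left)
qed

text \<open>The inequality defining the envelope at \<open>y + t z\<close>, tested at
  \<open>P y + t u\<close> and sorted by powers of \<open>t\<close>. The vector \<open>z\<close> is
  free, which yields a family of lower bounds.\<close>

lemma f_lower_expansion:
  assumes "t \<noteq> 0" "P y + t *\<^sub>R u \<in> cball xb \<rho>"
  shows "ereal (fP y + t * (G y \<bullet> u) + t\<^sup>2 / 2 * (env_quot y t z - s * (norm (u - z))\<^sup>2)) \<le> f (P y + t *\<^sub>R u)"
proof -
  have "env (y + t *\<^sub>R z) - s / 2 * (norm (P y + t *\<^sub>R u - (y + t *\<^sub>R z)))\<^sup>2
      = fP y + t * (G y \<bullet> u) + t\<^sup>2 / 2 * (env_quot y t z - s * (norm (u - z))\<^sup>2)"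
    unfolding shifted_square env_expand[OF assms(1)] env_def[of y] by (simp add: inner_diff_right algebra_simps)
  then show ?thesis using env_le'[OF assms(2), of "y + t *\<^sub>R z"] by simp
qed

text \<open>Equality in \<open>f_lower_expansion\<close>, because this \<open>u\<close> makes the
  test point the minimizer \<open>P (y + t z)\<close>.\<close>

lemma f_expansion_prox:
  assumes t: "t \<noteq> 0" and u: "u = (P (y + t *\<^sub>R z) - P y) /\<^sub>R t"
  shows "f (P y + t *\<^sub>R u) = ereal (fP y + t * (G y \<bullet> u) + t\<^sup>2 / 2 * (env_quot y t z - s * (norm (u - z))\<^sup>2))"
proof -
  have Pu: "P y + t *\<^sub>R u = P (y + t *\<^sub>R z)" using t by (simp add: u)
  have "fP (y + t *\<^sub>R z) = env (y + t *\<^sub>R z) - s / 2 * (norm (P y + t *\<^sub>R u - (y + t *\<^sub>R z)))\<^sup>2"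
    unfolding Pu by (simp add: env_def)
  also have "\<dots> = fP y + t * (G y \<bullet> u) + t\<^sup>2 / 2 * (env_quot y t z - s * (norm (u - z))\<^sup>2)"
    unfolding shifted_square env_expand[OF t] env_def[of y] by (simp add: inner_diff_right algebra_simps)
  finally show ?thesis unfolding Pu f_P by simp
qed

context
  fixes y A assumes y: "y \<in> ball xb R" and gat: "G_Gateaux y A"
begin

lemma linear_A: "linear A" using gat by (simp add: G_Gateaux_def)

lemma A_lim: "((\<lambda>t. (G (y + t *\<^sub>R w) - G y) /\<^sub>R t) \<longlongrightarrow> A w) (at 0)"
  using gat by (simp add: G_Gateaux_def)

lemma ball_along: "\<forall>\<^sub>F t in at_right 0. y + t *\<^sub>R z \<in> ball xb R"
proof -
  have "((\<lambda>t. y + t *\<^sub>R z) \<longlongrightarrow> y + 0 *\<^sub>R z) (at_right 0)" by (intro tendsto_intros)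
  then show ?thesis using topological_tendstoD[OF _ open_ball y] by simp
qed

text \<open>L'Hopital's rule reduces the second-order quotient of \<open>env\<close> to the
  first-order quotient of its gradient \<open>G\<close> at the single point
  \<open>y\<close>.\<close>

lemma env_quot_tendsto: "((\<lambda>t. env_quot y t z) \<longlongrightarrow> A z \<bullet> z) (at_right 0)"
  unfolding env_quot_def
proof (rule lhopital_right_0[where f' = "\<lambda>t. (G (y + t *\<^sub>R z) - G y) \<bullet> z" and g' = "\<lambda>t. t"])
  have pos: "\<forall>\<^sub>F t in at_right 0. 0 < (t::real)" by (rule eventually_at_right_less)
  have der: "((\<lambda>t. env (y + t *\<^sub>R z) - env y - t * (G y \<bullet> z)) has_real_derivative (G (y + t *\<^sub>R z) - G y) \<bullet> z) (at t)"
    if "y + t *\<^sub>R z \<in> ball xb R" for t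
  proof -
    have "((\<lambda>t. y + t *\<^sub>R z) has_derivative (\<lambda>h. h *\<^sub>R z)) (at t)"
      by (auto intro!: derivative_eq_intros)
    from has_derivative_compose[OF this env_has_derivative[OF that]]
    have "((\<lambda>t. env (y + t *\<^sub>R z)) has_real_derivative G (y + t *\<^sub>R z) \<bullet> z) (at t)"
      by (simp add: has_field_derivative_def mult_commute_abs)
    then show ?thesis by (auto intro!: derivative_eq_intros simp: inner_diff_left)
  qed
  show "\<forall>\<^sub>F t in at_right 0. ((\<lambda>t. env (y + t *\<^sub>R z) - env y - t * (G y \<bullet> z)) has_real_derivative (G (y + t *\<^sub>R z) - G y) \<bullet> z) (at t)"
    using ball_along[of z] by eventually_elim (rule der)
  have "isCont (\<lambda>t. env (y + t *\<^sub>R z) - env y - t * (G y \<bullet> z)) 0"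
    using y by (intro DERIV_isCont[OF der]) simp
  then show "((\<lambda>t. env (y + t *\<^sub>R z) - env y - t * (G y \<bullet> z)) \<longlongrightarrow> 0) (at_right 0)"
    by (simp add: isCont_def filterlim_at_split)
  show "((\<lambda>t::real. t\<^sup>2 / 2) \<longlongrightarrow> 0) (at_right 0)" by (auto intro!: tendsto_eq_intros)
  show "\<forall>\<^sub>F t in at_right 0. (t::real)\<^sup>2 / 2 \<noteq> 0" "\<forall>\<^sub>F t in at_right 0. (t::real) \<noteq> 0"
    using pos by (eventually_elim, simp)+
  show "\<forall>\<^sub>F t in at_right 0. ((\<lambda>t. t\<^sup>2 / 2) has_real_derivative t) (at t)"
    by (intro always_eventually allI) (auto intro!: derivative_eq_intros)
  have "((\<lambda>t. ((G (y + t *\<^sub>R z) - G y) /\<^sub>R t) \<bullet> z) \<longlongrightarrow> A z \<bullet> z) (at_right 0)"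
    using A_lim[of z] by (intro tendsto_intros) (simp add: filterlim_at_split)
  then show "((\<lambda>t. (G (y + t *\<^sub>R z) - G y) \<bullet> z / t) \<longlongrightarrow> A z \<bullet> z) (at_right 0)"
    by (simp add: divide_inverse mult.commute)
qed

lemma prox_quot_tendsto: "((\<lambda>t. (P (y + t *\<^sub>R z) - P y) /\<^sub>R t) \<longlongrightarrow> prox_deriv A z) (at_right 0)"
proof -
  have "((\<lambda>t. z - ((G (y + t *\<^sub>R z) - G y) /\<^sub>R t) /\<^sub>R s) \<longlongrightarrow> prox_deriv A z) (at_right 0)"
    unfolding prox_deriv_def using A_lim[of z] by (intro tendsto_intros) (simp add: filterlim_at_split)
  moreover have "\<forall>\<^sub>F t in at_right 0. z - ((G (y + t *\<^sub>R z) - G y) /\<^sub>R t) /\<^sub>R s = (P (y + t *\<^sub>R z) - P y) /\<^sub>R t"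
    using eventually_at_right_less[of "0::real"]
  proof eventually_elim
    case (elim t)
    have "(G (y + t *\<^sub>R z) - G y) /\<^sub>R s = t *\<^sub>R z - (P (y + t *\<^sub>R z) - P y)"
      using s_ge by (simp add: G_def flip: scaleR_diff_right)
    then have "((G (y + t *\<^sub>R z) - G y) /\<^sub>R t) /\<^sub>R s = (t *\<^sub>R z - (P (y + t *\<^sub>R z) - P y)) /\<^sub>R t"
      by (subst scaleR_left_commute) (rule arg_cong)
    then show ?case using elim by (simp add: scaleR_diff_right)
  qed
  ultimately show ?thesis by (rule Lim_transform_eventually)
qed

text \<open>At the same test point \<open>P (y + t z)\<close>, \<open>f_expansion_prox\<close> with
  \<open>z\<close> is an equality and \<open>f_lower_expansion\<close> with \<open>z'\<close> an
  inequality; the second-order terms are compared as \<open>t\<close> tends to \<open>0\<close>.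
  Thus \<open>z' = z\<close> maximizes the left side.\<close>

lemma second_order_inequality:
  "A z' \<bullet> z' - s * (norm (prox_deriv A z - z'))\<^sup>2 \<le> A z \<bullet> z - s * (norm (prox_deriv A z - z))\<^sup>2"
proof (rule tendsto_le[OF trivial_limit_at_right_real])
  let ?u = "\<lambda>t. (P (y + t *\<^sub>R z) - P y) /\<^sub>R t"
  show "((\<lambda>t. env_quot y t z - s * (norm (?u t - z))\<^sup>2) \<longlongrightarrow> A z \<bullet> z - s * (norm (prox_deriv A z - z))\<^sup>2) (at_right 0)"
    by (intro tendsto_intros env_quot_tendsto prox_quot_tendsto)
  show "((\<lambda>t. env_quot y t z' - s * (norm (?u t - z'))\<^sup>2) \<longlongrightarrow> A z' \<bullet> z' - s * (norm (prox_deriv A z - z'))\<^sup>2) (at_right 0)"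
    by (intro tendsto_intros env_quot_tendsto prox_quot_tendsto)
  show "\<forall>\<^sub>F t in at_right 0. env_quot y t z' - s * (norm (?u t - z'))\<^sup>2 \<le> env_quot y t z - s * (norm (?u t - z))\<^sup>2"
    using eventually_at_right_less[of "0::real"]
  proof eventually_elim
    case (elim t)
    then have t: "t \<noteq> 0" by simp
    have "P y + t *\<^sub>R ?u t \<in> cball xb \<rho>" using t P_in by simp
    from f_lower_expansion[OF t this, of z'] f_expansion_prox[OF t refl, of y z]
    have "t\<^sup>2 / 2 * (env_quot y t z' - s * (norm (?u t - z'))\<^sup>2) \<le> t\<^sup>2 / 2 * (env_quot y t z - s * (norm (?u t - z))\<^sup>2)"
      by simp
    moreover have "0 < t\<^sup>2 / 2" using t by simp
    ultimately show ?case by (simp only: mult_le_cancel_left_pos)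
  qed
qed

text \<open>The first-order condition at the maximizer \<open>z' = z\<close> of
  \<open>second_order_inequality\<close>: along \<open>d\<close> the quadratic form has derivative
  \<open>A d \<bullet> z + A z \<bullet> d\<close> and the penalty
  \<open>2 * (A z \<bullet> d)\<close>, and both signs of \<open>d\<close> are allowed.\<close>

lemma A_symmetric: "A z \<bullet> d = z \<bullet> A d"
proof -
  have le: "A d \<bullet> z - A z \<bullet> d \<le> 0" for d
  proof -
    let ?b = "s * (norm d)\<^sup>2 - A d \<bullet> d"
    have ineq: "A d \<bullet> z - A z \<bullet> d \<le> \<tau> * ?b" if \<tau>: "0 < \<tau>" for \<tau>
    proof -
      let ?J = "prox_deriv A z"
      have sq: "s * (norm (?J - (z + \<tau> *\<^sub>R d)))\<^sup>2 = s * (norm (?J - z))\<^sup>2 + 2 * (\<tau> * (A z \<bullet> d)) + s * (\<tau>\<^sup>2 * (norm d)\<^sup>2)"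
      proof -
        have "?J - (z + \<tau> *\<^sub>R d) = (?J - z) + (- \<tau>) *\<^sub>R d" by simp
        then have "(norm (?J - (z + \<tau> *\<^sub>R d)))\<^sup>2 = (norm (?J - z))\<^sup>2 + 2 * (\<tau> * ((z - ?J) \<bullet> d)) + \<tau>\<^sup>2 * (norm d)\<^sup>2"
          by (simp only: norm_add_scaleR_square) (simp add: inner_diff_left algebra_simps)
        moreover have "A z \<bullet> d = s * ((z - ?J) \<bullet> d)" by (subst A_eq_prox_deriv) simp
        ultimately show ?thesis by (simp add: distrib_left)
      qed
      have "A (z + \<tau> *\<^sub>R d) \<bullet> (z + \<tau> *\<^sub>R d) = A z \<bullet> z + \<tau> * (A d \<bullet> z + A z \<bullet> d) + \<tau>\<^sup>2 * (A d \<bullet> d)"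
        by (simp add: linear_add[OF linear_A] linear_scale[OF linear_A] inner_add_left inner_add_right
            power2_eq_square algebra_simps)
      with second_order_inequality[of "z + \<tau> *\<^sub>R d" z]
      have "\<tau> * (A d \<bullet> z - A z \<bullet> d) \<le> \<tau> * (\<tau> * ?b)"
        unfolding sq by (simp add: power2_eq_square algebra_simps)
      then show ?thesis using \<tau> by (simp only: mult_le_cancel_left_pos)
    qed
    have "((\<lambda>\<tau>. \<tau> * ?b) \<longlongrightarrow> 0 * ?b) (at_right 0)" by (intro tendsto_intros)
    moreover have "\<forall>\<^sub>F \<tau> in at_right 0. A d \<bullet> z - A z \<bullet> d \<le> \<tau> * ?b"
      using eventually_at_right_less[of "0::real"] by eventually_elim (rule ineq)
    ultimately have "A d \<bullet> z - A z \<bullet> d \<le> 0 * ?b"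
      by (rule tendsto_lowerbound) simp
    then show ?thesis by simp
  qed
  from le[of d] le[of "- d"] show ?thesis
    by (simp add: linear_neg[OF linear_A] inner_commute)
qed

lemma linear_prox_deriv: "linear (prox_deriv A)"
  using linear_A by (rule linear_prox_derivI)

lemma prox_deriv_symmetric: "prox_deriv A z \<bullet> d = z \<bullet> prox_deriv A d"
  using A_symmetric[of z d] by (simp add: prox_deriv_def inner_diff_left inner_diff_right)

lemma norm_A_le: "norm (A z) \<le> 3 * s * norm z"
proof (rule tendsto_le[OF trivial_limit_at_right_real])
  show "((\<lambda>t. 3 * s * norm z) \<longlongrightarrow> 3 * s * norm z) (at_right (0::real))" by simp
  show "((\<lambda>t. norm ((G (y + t *\<^sub>R z) - G y) /\<^sub>R t)) \<longlongrightarrow> norm (A z)) (at_right 0)"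
    using A_lim[of z] by (intro tendsto_norm) (simp add: filterlim_at_split)
  show "\<forall>\<^sub>F t in at_right 0. norm ((G (y + t *\<^sub>R z) - G y) /\<^sub>R t) \<le> 3 * s * norm z"
    using ball_along[of z] eventually_at_right_less[of "0::real"]
  proof eventually_elim
    case (elim t)
    then show ?case
      using G_lipschitz[OF elim(1) y] unfolding norm_scaleR by (simp add: divide_simps mult.commute mult.left_commute)
  qed
qed

text \<open>The limit of \<open>f_lower_expansion\<close>, one bound for each \<open>z\<close>;
  their supremum turns out to be the second subderivative.\<close>

lemma second_subderivative_ge_at_Gateaux:
  "ereal (A z \<bullet> z - s * (norm (w - z))\<^sup>2) \<le> second_subderivative f (P y) (G y) w"
proof (rule second_subderivative_geI[of f "P y" "fP y" "\<lambda>(t, u). env_quot y t z - s * (norm (u - z))\<^sup>2"])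
  show "f (P y) = ereal (fP y)" by (rule f_P)
  have snd: "(snd \<longlongrightarrow> w) (at_right (0::real) \<times>\<^sub>F nhds w)" by (rule filterlim_snd)
  have fst: "(fst \<longlongrightarrow> 0) (at_right (0::real) \<times>\<^sub>F nhds w)"
    by (rule filterlim_mono[OF filterlim_fst _ order_refl]) (simp add: at_within_def)
  have "((\<lambda>p. env_quot y (fst p) z) \<longlongrightarrow> A z \<bullet> z) (at_right 0 \<times>\<^sub>F nhds w)"
    by (rule filterlim_compose[OF env_quot_tendsto filterlim_fst])
  then show "((\<lambda>(t, u). env_quot y t z - s * (norm (u - z))\<^sup>2) \<longlongrightarrow> A z \<bullet> z - s * (norm (w - z))\<^sup>2) (at_right 0 \<times>\<^sub>F nhds w)"
    unfolding case_prod_unfold by (intro tendsto_intros snd)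
  have "((\<lambda>p. P y + fst p *\<^sub>R snd p) \<longlongrightarrow> P y + 0 *\<^sub>R w) (at_right 0 \<times>\<^sub>F nhds w)"
    by (intro tendsto_intros fst snd)
  then have "\<forall>\<^sub>F p in at_right 0 \<times>\<^sub>F nhds w. P y + fst p *\<^sub>R snd p \<in> ball xb \<rho>"
    using topological_tendstoD[OF _ open_ball P_ball[OF y]] by simp
  moreover have "\<forall>\<^sub>F p in at_right (0::real) \<times>\<^sub>F nhds w. 0 < fst p"
    by (rule eventually_compose_filterlim[OF eventually_at_right_less filterlim_fst])
  ultimately show "\<forall>\<^sub>F (t, u) in at_right 0 \<times>\<^sub>F nhds w. ereal (fP y + t * (G y \<bullet> u) + t\<^sup>2 / 2 *
      (case (t, u) of (t, u) \<Rightarrow> env_quot y t z - s * (norm (u - z))\<^sup>2)) \<le> f (P y + t *\<^sub>R u)"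
  proof eventually_elim
    case (elim p)
    then show ?case using f_lower_expansion[of "fst p" y "snd p" z] by (simp add: case_prod_unfold)
  qed
qed

text \<open>On the range of \<open>prox_deriv A\<close> the bound with a preimage \<open>z\<close>
  is attained along the proximal path; off the range, multiples of a kernel vector make the bounds
  arbitrarily large.\<close>

lemma second_subderivative_at_Gateaux:
  "second_subderivative f (P y) (G y) = resolvent_form s (prox_deriv A)"
proof
  fix w
  let ?J = "prox_deriv A"
  show "second_subderivative f (P y) (G y) w = resolvent_form s ?J w"
  proof (cases "w \<in> range ?J")
    case True
    then obtain z where w: "w = ?J z" by blast
    let ?u = "\<lambda>t. (P (y + t *\<^sub>R z) - P y) /\<^sub>R t"
    have val: "A z \<bullet> z - s * (norm (?J z - z))\<^sup>2 = s * ((z - ?J z) \<bullet> ?J z)"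
    proof -
      have "A z \<bullet> z = s * ((z - ?J z) \<bullet> z)" by (subst A_eq_prox_deriv) simp
      then show ?thesis
        by (simp add: power2_norm_eq_inner inner_diff_left inner_diff_right inner_commute algebra_simps)
    qed
    have "second_subderivative f (P y) (G y) (?J z) \<le> ereal (A z \<bullet> z - s * (norm (?J z - z))\<^sup>2)"
    proof (rule second_subderivative_leI[of f "P y" "fP y" ?u])
      show "((\<lambda>t. env_quot y t z - s * (norm (?u t - z))\<^sup>2) \<longlongrightarrow> A z \<bullet> z - s * (norm (?J z - z))\<^sup>2) (at_right 0)"
        by (intro tendsto_intros env_quot_tendsto prox_quot_tendsto)
      show "\<forall>\<^sub>F t in at_right 0. f (P y + t *\<^sub>R ?u t) = ereal (fP y + t * (G y \<bullet> ?u t) +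
          t\<^sup>2 / 2 * (env_quot y t z - s * (norm (?u t - z))\<^sup>2))"
        using eventually_at_right_less[of "0::real"] by eventually_elim (rule f_expansion_prox, auto)
    qed (rule f_P prox_quot_tendsto)+
    with second_subderivative_ge_at_Gateaux[of z "?J z"]
    show ?thesis unfolding w resolvent_form_apply[OF linear_prox_deriv prox_deriv_symmetric] val by (rule antisym[rotated])
  next
    case False
    obtain n where n: "?J n = 0" "0 < n \<bullet> w"
      by (rule kernel_vector_off_range[OF linear_prox_deriv prox_deriv_symmetric False])
    have "ereal B \<le> second_subderivative f (P y) (G y) w" for B
    proof -
      define \<tau> where "\<tau> = (B / s + (norm w)\<^sup>2) / (2 * (n \<bullet> w))"
      have "A n = s *\<^sub>R n" using A_eq_prox_deriv[of A n] n(1) by simp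
      then have "A (\<tau> *\<^sub>R n) \<bullet> (\<tau> *\<^sub>R n) - s * (norm (w - \<tau> *\<^sub>R n))\<^sup>2 = s * (\<tau> * (2 * (n \<bullet> w)) - (norm w)\<^sup>2)"
        by (simp add: linear_scale[OF linear_A] power2_norm_eq_inner inner_diff_left inner_diff_right inner_commute
            algebra_simps)
      also have "\<dots> = B" using n(2) s_ge by (simp add: \<tau>_def)
      finally show ?thesis using second_subderivative_ge_at_Gateaux[of "\<tau> *\<^sub>R n" w] by simp
    qed
    then show ?thesis using False by (simp add: resolvent_form_def ereal_top)
  qed
qed

text \<open>The prox-regularity bound read off for the form; it is the uniform lower bound demanded
  by \<open>epi_converges_resolvent_form\<close>.\<close>

lemma prox_deriv_lower: "- (r * (norm (prox_deriv A z))\<^sup>2) \<le> s * ((z - prox_deriv A z) \<bullet> prox_deriv A z)"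
  using second_subderivative_P_ge[OF y, of "prox_deriv A z"]
  by (simp add: second_subderivative_at_Gateaux resolvent_form_apply[OF linear_prox_deriv prox_deriv_symmetric])

end

end

subsection \<open>Positive quadratic bundle implies tilt stability\<close>

lemma tilt_argmin_eqI:
  assumes m: "m \<in> cball xb \<gamma>" and fm: "f m = ereal a" and c: "0 < c"
    and growth: "\<And>x. x \<in> cball xb \<gamma> \<Longrightarrow> ereal (a + v \<bullet> (x - m) + c / 2 * (norm (x - m))\<^sup>2) \<le> f x"
  shows "tilt_argmin f xb \<gamma> v = {m}"
proof -
  have le: "ereal (a - v \<bullet> m + c / 2 * (norm (x - m))\<^sup>2) \<le> f x - ereal (v \<bullet> x)" if "x \<in> cball xb \<gamma>" for x
    using growth[OF that] by (cases "f x") (auto simp: inner_diff_right)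
  have "is_arg_min (\<lambda>x. f x - ereal (v \<bullet> x)) (\<lambda>x. x \<in> cball xb \<gamma>) m"
    unfolding is_arg_min_def
  proof (intro conjI notI m)
    assume "\<exists>y. y \<in> cball xb \<gamma> \<and> f y - ereal (v \<bullet> y) < f m - ereal (v \<bullet> m)"
    then obtain y where y: "y \<in> cball xb \<gamma>" "f y - ereal (v \<bullet> y) < ereal (a - v \<bullet> m)" by (auto simp: fm)
    have "ereal (a - v \<bullet> m + c / 2 * (norm (y - m))\<^sup>2) < ereal (a - v \<bullet> m)"
      using le[OF y(1)] y(2) by (rule le_less_trans)
    then show False using c by (simp add: mult_less_0_iff)
  qed
  moreover have "x = m" if "is_arg_min (\<lambda>x. f x - ereal (v \<bullet> x)) (\<lambda>x. x \<in> cball xb \<gamma>) x" for x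
  proof -
    have x: "x \<in> cball xb \<gamma>" "f x - ereal (v \<bullet> x) \<le> ereal (a - v \<bullet> m)"
      using that m fm unfolding is_arg_min_def by (auto simp: not_less)
    have "ereal (a - v \<bullet> m + c / 2 * (norm (x - m))\<^sup>2) \<le> ereal (a - v \<bullet> m)"
      using le[OF x(1)] x(2) by (rule order_trans)
    then have "c * (norm (x - m))\<^sup>2 \<le> 0" by simp
    then show ?thesis using c by (simp add: mult_le_0_iff)
  qed
  ultimately show ?thesis unfolding tilt_argmin_def by blast
qed

context prox_regular_at
begin

text \<open>\<open>Rademacher_Gateaux\<close> is about globally Lipschitz maps, so \<open>G\<close>
  is composed with the projection onto a closed ball, which changes nothing inside that
  ball.\<close>

lemma G_Gateaux_off_null_set:
  obtains N where "N \<in> null_sets lborel" "\<And>y. y \<in> ball xb (R / 2) - N \<Longrightarrow> \<exists>A. G_Gateaux y A"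
proof -
  let ?B = "cball xb (R / 2)"
  define G' where "G' y = G (closest_point ?B y)" for y
  have B: "?B \<noteq> {}" "convex ?B" "closed ?B" "?B \<subseteq> ball xb R" using R_pos by auto
  have "(3 * s)-lipschitz_on UNIV G'"
  proof (rule lipschitz_onI)
    fix x y
    have "closest_point ?B x \<in> ball xb R" "closest_point ?B y \<in> ball xb R"
      using closest_point_in_set[OF B(3,1)] B(4) by blast+
    from G_lipschitz[OF this]
    have "dist (G' x) (G' y) \<le> 3 * s * dist (closest_point ?B x) (closest_point ?B y)"
      by (simp add: G'_def dist_norm)
    also have "\<dots> \<le> 3 * s * dist x y"
      using closest_point_lipschitz[OF B(2,3,1)] s_ge by (intro mult_left_mono) auto
    finally show "dist (G' x) (G' y) \<le> 3 * s * dist x y" .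
  qed (use s_ge in simp)
  from AE_E[OF Rademacher_Gateaux[OF this]] obtain N where
    N: "{y \<in> space lborel. \<not> (\<exists>A. linear A \<and> (\<forall>w. ((\<lambda>t. (G' (y + t *\<^sub>R w) - G' y) /\<^sub>R t) \<longlongrightarrow> A w) (at 0)))} \<subseteq> N"
       "emeasure lborel N = 0" "N \<in> sets lborel" .
  show ?thesis
  proof (rule that)
    show "N \<in> null_sets lborel" using N(2,3) by auto
    fix y assume y: "y \<in> ball xb (R / 2) - N"
    then have "\<exists>A. linear A \<and> (\<forall>w. ((\<lambda>t. (G' (y + t *\<^sub>R w) - G' y) /\<^sub>R t) \<longlongrightarrow> A w) (at 0))"
      using N(1) unfolding space_lborel space_borel by blast
    then obtain A where A: "linear A" "\<And>w. ((\<lambda>t. (G' (y + t *\<^sub>R w) - G' y) /\<^sub>R t) \<longlongrightarrow> A w) (at 0)"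
      by blast
    have eq: "G' z = G z" if "z \<in> ball xb (R / 2)" for z
      using that by (simp add: G'_def closest_point_self)
    have "((\<lambda>t. (G (y + t *\<^sub>R w) - G y) /\<^sub>R t) \<longlongrightarrow> A w) (at 0)" for w
    proof (rule Lim_transform_eventually[OF A(2)])
      have "((\<lambda>t. y + t *\<^sub>R w) \<longlongrightarrow> y + 0 *\<^sub>R w) (at 0)" by (intro tendsto_intros)
      then have "\<forall>\<^sub>F t in at 0. y + t *\<^sub>R w \<in> ball xb (R / 2)"
        using topological_tendstoD[OF _ open_ball] y by fastforce
      then show "\<forall>\<^sub>F t in at 0. (G' (y + t *\<^sub>R w) - G' y) /\<^sub>R t = (G (y + t *\<^sub>R w) - G y) /\<^sub>R t"
        by eventually_elim (use y in \<open>simp add: eq\<close>)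
    qed
    then show "\<exists>A. G_Gateaux y A" using A(1) by (auto simp: G_Gateaux_def)
  qed
qed

lemma resolvent_form_in_quad_bundle:
  assumes y: "\<And>k. y k \<in> ball xb R" "y \<longlonglongrightarrow> xb" and gat: "\<And>k. G_Gateaux (y k) (A k)"
    and lin: "linear A0" and lim: "\<And>z. (\<lambda>k. A k z) \<longlonglongrightarrow> A0 z"
  shows "resolvent_form s (prox_deriv A0) \<in> quad_bundle f xb 0"
    and "\<And>x z. prox_deriv A0 x \<bullet> z = x \<bullet> prox_deriv A0 z"
proof -
  note lin0 = linear_prox_derivI[OF lin]
  have lim0: "(\<lambda>k. prox_deriv (A k) z) \<longlonglongrightarrow> prox_deriv A0 z" for z
    unfolding prox_deriv_def by (intro tendsto_intros lim)
  note conv = epi_converges_resolvent_form[of "\<lambda>k. prox_deriv (A k)", OF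
      linear_prox_deriv[OF y(1) gat] prox_deriv_symmetric[OF y(1) gat] lin0 lim0 s_ge(3) prox_deriv_lower[OF y(1) gat]]
  show sym0: "\<And>x z. prox_deriv A0 x \<bullet> z = x \<bullet> prox_deriv A0 z" by (rule conv(1))
  have d: "(\<lambda>k. norm (y k - xb)) \<longlonglongrightarrow> 0"
    using tendsto_norm[OF LIM_zero[OF y(2)]] by simp
  have "(\<lambda>k. P (y k) - xb) \<longlonglongrightarrow> 0"
    by (rule Lim_null_comparison[OF always_eventually tendsto_mult_right_zero[OF d]]) (use P_near in auto)
  then have "(\<lambda>k. P (y k)) \<longlonglongrightarrow> xb" by (rule LIM_zero_cancel)
  moreover have "(\<lambda>k. G (y k)) \<longlonglongrightarrow> 0"
    by (rule Lim_null_comparison[OF always_eventually tendsto_mult_right_zero[OF d]]) (use norm_G in auto)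
  ultimately have PG: "(\<lambda>k. (P (y k), G (y k))) \<longlonglongrightarrow> (xb, 0)" by (rule tendsto_Pair)
  show "resolvent_form s (prox_deriv A0) \<in> quad_bundle f xb 0"
    unfolding quad_bundle_def mem_Collect_eq
  proof (intro conjI exI allI)
    show "is_GQF (resolvent_form s (prox_deriv A0))" by (rule is_GQF_resolvent_form[OF lin0 sym0])
    show "(P (y k), G (y k)) \<in> gph_subdifferential f" for k using P_gph[OF y(1)] .
    show "is_GQF (second_subderivative f (P (y k)) (G (y k)))" for k
      unfolding second_subderivative_at_Gateaux[OF y(1) gat]
      by (rule is_GQF_resolvent_form[OF linear_prox_deriv[OF y(1) gat] prox_deriv_symmetric[OF y(1) gat]])
    show "epi_converges (\<lambda>k. second_subderivative f (P (y k)) (G (y k))) (resolvent_form s (prox_deriv A0))"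
      unfolding second_subderivative_at_Gateaux[OF y(1) gat] by (rule conv(2))
  qed (rule PG)
qed

text \<open>Otherwise there are points tending to \<open>xb\<close> and unit vectors at which the
  derivatives have quadratic values below \<open>1 / (n + 1)\<close>. The derivatives are bounded by
  \<open>3 s\<close>, so a subsequence converges; the form of the limit lies in the quadratic
  bundle, and its positivity contradicts the limiting inequality.\<close>

lemma Gateaux_derivatives_positive:
  assumes pos: "\<And>q w. q \<in> quad_bundle f xb 0 \<Longrightarrow> w \<noteq> 0 \<Longrightarrow> 0 < q w"
  obtains c \<eta> where "0 < c" "0 < \<eta>" "\<eta> \<le> R / 2"
    "\<And>y A z. y \<in> ball xb \<eta> \<Longrightarrow> G_Gateaux y A \<Longrightarrow> c * (norm z)\<^sup>2 \<le> A z \<bullet> z"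
proof (rule ccontr)
  assume contr: "\<not> thesis"
  have "\<exists>y A z. y \<in> ball xb (R / 2 * inverse (Suc n)) \<and> G_Gateaux y A \<and> norm z = 1 \<and> A z \<bullet> z < inverse (Suc n)" for n
  proof -
    have "R / 2 * inverse (Suc n) \<le> R / 2 * 1" using R_pos by (intro mult_left_mono) (auto simp: field_simps)
    then have "\<exists>y A z. y \<in> ball xb (R / 2 * inverse (Suc n)) \<and> G_Gateaux y A \<and> A z \<bullet> z < inverse (Suc n) * (norm z)\<^sup>2"
      using contr that[of "inverse (real (Suc n))" "R / 2 * inverse (Suc n)"] R_pos by (force simp: not_le)
    then obtain y A z where yA: "y \<in> ball xb (R / 2 * inverse (Suc n))" "G_Gateaux y A"
       "A z \<bullet> z < inverse (Suc n) * (norm z)\<^sup>2" by blast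
    have lin: "linear A" using yA(2) by (simp add: G_Gateaux_def)
    have "z \<noteq> 0" using yA(3) by auto
    then have "0 < (norm z)\<^sup>2" by simp
    have "A (z /\<^sub>R norm z) \<bullet> (z /\<^sub>R norm z) = (A z \<bullet> z) / (norm z)\<^sup>2"
      by (simp add: linear_scale[OF lin] power2_eq_square divide_inverse mult.commute)
    also have "\<dots> < inverse (Suc n)" using yA(3) \<open>0 < (norm z)\<^sup>2\<close> by (simp only: pos_divide_less_eq)
    finally show ?thesis using yA(1,2) \<open>z \<noteq> 0\<close>
      by (intro exI[of _ y] exI[of _ A] exI[of _ "z /\<^sub>R norm z"]) auto
  qed
  then obtain y A z where y: "\<And>n. y n \<in> ball xb (R / 2 * inverse (Suc n))" and gat: "\<And>n. G_Gateaux (y n) (A n)"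
    and z: "\<And>n. norm (z n) = 1" and Az: "\<And>n. A n (z n) \<bullet> z n < inverse (real (Suc n))"
    by metis
  have yR: "y n \<in> ball xb R" for n
  proof -
    have "R / 2 * inverse (Suc n) \<le> R * 1" using R_pos by (intro mult_mono) (auto simp: field_simps)
    then show ?thesis using y[of n] by auto
  qed
  have inv0: "(\<lambda>n. inverse (real (Suc n))) \<longlonglongrightarrow> 0" by (rule LIMSEQ_inverse_real_of_nat)
  have ylim: "y \<longlonglongrightarrow> xb"
  proof (rule LIM_zero_cancel, rule Lim_null_comparison)
    show "(\<lambda>n. R / 2 * inverse (real (Suc n))) \<longlonglongrightarrow> 0" by (rule tendsto_mult_right_zero[OF inv0])
    show "\<forall>\<^sub>F n in sequentially. norm (y n - xb) \<le> R / 2 * inverse (real (Suc n))"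
      using y by (intro always_eventually allI) (simp add: dist_norm norm_minus_commute less_imp_le)
  qed
  define B where "B n = Blinfun (A n)" for n
  have B: "blinfun_apply (B n) = A n" for n
    using linear_A[OF yR gat] by (simp add: B_def bounded_linear_Blinfun_apply linear_conv_bounded_linear)
  have "bounded (range (\<lambda>n. (B n, z n)))"
  proof (rule bounded_subset)
    show "bounded (cball (0 :: 'a \<Rightarrow>\<^sub>L 'a) (3 * s) \<times> cball (0 :: 'a) 1)" by (intro bounded_Times bounded_cball)
    have "norm (B n) \<le> 3 * s" for n
      using s_ge norm_A_le[OF yR gat] by (intro norm_blinfun_bound) (auto simp: B)
    then show "range (\<lambda>n. (B n, z n)) \<subseteq> cball 0 (3 * s) \<times> cball 0 1" using z by auto
  qed
  from bounded_imp_convergent_subsequence[OF this]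
  obtain l r where r: "strict_mono (r :: nat \<Rightarrow> nat)" and l: "((\<lambda>n. (B n, z n)) \<circ> r) \<longlonglongrightarrow> l" by blast
  define B0 z0 where "B0 = fst l" and "z0 = snd l"
  have Bl: "(\<lambda>n. B (r n)) \<longlonglongrightarrow> B0" and zl: "(\<lambda>n. z (r n)) \<longlonglongrightarrow> z0"
    using tendsto_fst[OF l] tendsto_snd[OF l] by (simp_all add: B0_def z0_def o_def)
  let ?J = "prox_deriv (blinfun_apply B0)"
  have lin0: "linear (blinfun_apply B0)" by (rule bounded_linear.linear[OF blinfun.bounded_linear_right])
  have Al: "(\<lambda>n. A (r n) x) \<longlonglongrightarrow> blinfun_apply B0 x" for x
    unfolding B[symmetric] by (intro blinfun.tendsto Bl tendsto_const)
  have yrl: "(\<lambda>n. y (r n)) \<longlonglongrightarrow> xb" using LIMSEQ_subseq_LIMSEQ[OF ylim r] by (simp add: o_def)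
  note in_bundle = resolvent_form_in_quad_bundle[OF yR yrl gat lin0 Al]
  have "norm z0 = 1" using tendsto_norm[OF zl] z LIMSEQ_unique[OF _ tendsto_const] by fastforce
  then have z0: "z0 \<noteq> 0" by auto
  note linJ = linear_prox_derivI[OF lin0]
  \<comment> \<open>The value of the form at \<open>?J z0\<close> plus a proximal penalty. If
    \<open>?J z0 = 0\<close> the form contributes nothing and the penalty alone is positive.\<close>
  have "blinfun_apply B0 z0 \<bullet> z0 = s * ((z0 - ?J z0) \<bullet> ?J z0) + s * (norm (z0 - ?J z0))\<^sup>2"
    by (subst A_eq_prox_deriv) (simp add: power2_norm_eq_inner inner_diff_right algebra_simps)
  also have "0 < \<dots>"
  proof (cases "?J z0 = 0")
    case True
    then show ?thesis using z0 s_ge by simp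
  next
    case False
    have "0 < resolvent_form s ?J (?J z0)" using pos[OF in_bundle(1) False] .
    then have "0 < s * ((z0 - ?J z0) \<bullet> ?J z0)" by (simp add: resolvent_form_apply[OF linJ in_bundle(2)])
    moreover have "0 \<le> s * (norm (z0 - ?J z0))\<^sup>2" using s_ge by simp
    ultimately show ?thesis by linarith
  qed
  finally have "0 < blinfun_apply B0 z0 \<bullet> z0" .
  moreover have "blinfun_apply B0 z0 \<bullet> z0 \<le> 0"
  proof (rule LIMSEQ_le)
    show "(\<lambda>n. blinfun_apply (B (r n)) (z (r n)) \<bullet> z (r n)) \<longlonglongrightarrow> blinfun_apply B0 z0 \<bullet> z0"
      by (intro tendsto_inner blinfun.tendsto Bl zl)
    show "(\<lambda>n. inverse (real (Suc (r n)))) \<longlonglongrightarrow> 0" using LIMSEQ_subseq_LIMSEQ[OF inv0 r] by (simp add: o_def)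
    show "\<exists>N. \<forall>n\<ge>N. blinfun_apply (B (r n)) (z (r n)) \<bullet> z (r n) \<le> inverse (real (Suc (r n)))"
      using Az by (auto simp: B intro: less_imp_le)
  qed
  ultimately show False by simp
qed

end

section \<open>Strong convexity of the envelope and uniform quadratic growth of
  \<open>f\<close>\<close>

locale prox_regular_positive = prox_regular_at +
  fixes c \<eta> :: real
  assumes c_pos: "0 < c" and eta_pos: "0 < \<eta>" and eta_le: "\<eta> \<le> R / 2"
    and hess: "\<And>y A z. y \<in> ball xb \<eta> \<Longrightarrow> G_Gateaux y A \<Longrightarrow> c * (norm z)\<^sup>2 \<le> A z \<bullet> z"
begin

lemma eta_ball: "y \<in> ball xb \<eta> \<Longrightarrow> y \<in> ball xb R"
  using eta_le R_pos by simp

text \<open>\<open>integral_le_increment\<close> for \<open>G (y + t w) \<bullet> w\<close> with the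
  constant lower slope \<open>c * (norm w)\<^sup>2\<close>, which \<open>hess\<close> provides at
  almost every \<open>t\<close>.\<close>

lemma G_monotone_on_generic_segment:
  assumes N: "\<And>y. y \<in> ball xb (R / 2) - N \<Longrightarrow> \<exists>A. G_Gateaux y A"
    and seg: "y \<in> ball xb \<eta>" "y + w \<in> ball xb \<eta>"
    and ae: "AE t in lborel. t \<in> {0..1::real} \<longrightarrow> y + t *\<^sub>R w \<notin> N"
  shows "c * (norm w)\<^sup>2 \<le> (G (y + w) - G y) \<bullet> w"
proof -
  have segt: "y + t *\<^sub>R w \<in> ball xb \<eta>" if "t \<in> {0..1}" for t
  proof -
    have "(1 - t) *\<^sub>R y + t *\<^sub>R (y + w) \<in> ball xb \<eta>"
      using convexD_alt[OF convex_ball seg(1) seg(2)] that by simp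
    then show ?thesis by (simp add: algebra_simps)
  qed
  define \<psi> where "\<psi> t = G (y + t *\<^sub>R w) \<bullet> w" for t
  obtain N' where N': "{t \<in> space lborel. \<not> (t \<in> {0..1::real} \<longrightarrow> y + t *\<^sub>R w \<notin> N)} \<subseteq> N'"
     "emeasure lborel N' = 0" "N' \<in> sets lborel" using AE_E[OF ae] .
  have "integral {0..1} (\<lambda>t::real. c * (norm w)\<^sup>2) \<le> \<psi> 1 - \<psi> 0"
  proof (rule integral_le_increment)
    show "(3 * s * norm w * norm w)-lipschitz_on {0..1} \<psi>"
    proof (rule lipschitz_onI)
      fix t u :: real assume tu: "t \<in> {0..1}" "u \<in> {0..1}"
      have "\<bar>(G (y + t *\<^sub>R w) - G (y + u *\<^sub>R w)) \<bullet> w\<bar> \<le> norm (G (y + t *\<^sub>R w) - G (y + u *\<^sub>R w)) * norm w"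
        by (rule Cauchy_Schwarz_ineq2)
      also have "\<dots> \<le> 3 * s * norm ((y + t *\<^sub>R w) - (y + u *\<^sub>R w)) * norm w"
        using tu segt eta_ball by (intro mult_right_mono G_lipschitz) auto
      also have "(y + t *\<^sub>R w) - (y + u *\<^sub>R w) = (t - u) *\<^sub>R w" by (simp add: algebra_simps)
      finally show "dist (\<psi> t) (\<psi> u) \<le> 3 * s * norm w * norm w * dist t u"
        by (simp add: \<psi>_def dist_real_def inner_diff_left mult_ac)
    qed (use s_ge in auto)
    show "negligible N'" using N'(2,3) by (auto simp: negligible_iff_null_sets intro: null_sets_completionI)
    show "\<bar>c * (norm w)\<^sup>2\<bar> \<le> c * (norm w)\<^sup>2" using c_pos by simp
    fix t e d :: real assume t: "t \<in> {0<..<1} - N'" and e: "0 < e" and d: "0 < d"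
    let ?y = "y + t *\<^sub>R w"
    have "?y \<notin> N" using t subsetD[OF N'(1), of t] by auto
    moreover have yb: "?y \<in> ball xb \<eta>" using segt[of t] t by simp
    ultimately obtain A where A: "G_Gateaux ?y A" using N[of ?y] eta_le by auto
    have "((\<lambda>\<tau>. ((G (?y + \<tau> *\<^sub>R w) - G ?y) /\<^sub>R \<tau>) \<bullet> w) \<longlongrightarrow> A w \<bullet> w) (at 0)"
      using A by (intro tendsto_intros) (simp add: G_Gateaux_def)
    moreover have "c * (norm w)\<^sup>2 - e < A w \<bullet> w" using hess[OF yb A, of w] e by simp
    ultimately have "\<forall>\<^sub>F \<tau> in at 0. c * (norm w)\<^sup>2 - e < ((G (?y + \<tau> *\<^sub>R w) - G ?y) /\<^sub>R \<tau>) \<bullet> w"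
      by (rule order_tendstoD(1))
    then obtain d' where d': "0 < d'" "\<And>\<tau>. \<tau> \<noteq> 0 \<Longrightarrow> \<bar>\<tau>\<bar> < d' \<Longrightarrow>
        c * (norm w)\<^sup>2 - e < ((G (?y + \<tau> *\<^sub>R w) - G ?y) /\<^sub>R \<tau>) \<bullet> w"
      by (auto simp: eventually_at dist_real_def)
    define \<tau> where "\<tau> = min d d' / 2"
    have \<tau>: "\<tau> \<noteq> 0" "\<bar>\<tau>\<bar> < d" "\<bar>\<tau>\<bar> < d'" using d d'(1) by (auto simp: \<tau>_def)
    have "(\<psi> (t + \<tau>) - \<psi> t) / \<tau> = ((G (?y + \<tau> *\<^sub>R w) - G ?y) /\<^sub>R \<tau>) \<bullet> w"
      by (simp add: \<psi>_def scaleR_add_left add.assoc inner_diff_left divide_inverse mult.commute)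
    then show "\<exists>\<tau>. \<tau> \<noteq> 0 \<and> \<bar>\<tau>\<bar> < d \<and> c * (norm w)\<^sup>2 - e \<le> (\<psi> (t + \<tau>) - \<psi> t) / \<tau>"
      using d'(2)[OF \<tau>(1,3)] \<tau> by (intro exI[of _ \<tau>]) auto
  qed auto
  then show ?thesis by (simp add: \<psi>_def inner_diff_left)
qed

text \<open>The segment from \<open>y0\<close> to \<open>y1\<close> may run inside the exceptional
  set, but almost every parallel translate meets it in a null set only. The endpoints are
  approximated by \<open>Y n\<close> and \<open>Y n + w\<close>, and \<open>G\<close> is
  continuous.\<close>

lemma G_strongly_monotone:
  assumes y: "y0 \<in> ball xb \<eta>" "y1 \<in> ball xb \<eta>"
  shows "c * (norm (y1 - y0))\<^sup>2 \<le> (G y1 - G y0) \<bullet> (y1 - y0)"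
proof -
  define w where "w = y1 - y0"
  obtain N where N: "N \<in> null_sets lborel" "\<And>y. y \<in> ball xb (R / 2) - N \<Longrightarrow> \<exists>A. G_Gateaux y A"
    using G_Gateaux_off_null_set by blast
  obtain N' where N': "{y \<in> space lborel. \<not> (AE t in lborel. t \<in> {0..1::real} \<longrightarrow> y + t *\<^sub>R w \<notin> N)} \<subseteq> N'"
     "emeasure lborel N' = 0" "N' \<in> sets lborel" using AE_E[OF AE_along_direction[OF N(1), of w]] .
  have neg: "negligible N'" using N'(2,3) by (auto simp: negligible_iff_null_sets intro: null_sets_completionI)
  have "\<exists>y. y \<in> ball y0 (inverse (Suc n)) \<and> y \<notin> N'" for n
  proof (rule ccontr)
    assume "\<not> ?thesis"
    then have "ball y0 (inverse (Suc n)) \<subseteq> N'" by blast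
    then have "negligible (ball y0 (inverse (Suc n)))" using neg negligible_subset by blast
    then show False using open_not_negligible[OF open_ball, of y0 "inverse (Suc n)"] by simp
  qed
  then obtain Y where Y: "\<And>n. Y n \<in> ball y0 (inverse (Suc n))" "\<And>n. Y n \<notin> N'" by metis
  have Y0: "Y \<longlonglongrightarrow> y0"
  proof (rule LIM_zero_cancel, rule Lim_null_comparison)
    show "(\<lambda>n. inverse (real (Suc n))) \<longlonglongrightarrow> 0" by (rule LIMSEQ_inverse_real_of_nat)
    show "\<forall>\<^sub>F n in sequentially. norm (Y n - y0) \<le> inverse (real (Suc n))"
      using Y(1) by (intro always_eventually allI) (simp add: dist_norm norm_minus_commute less_imp_le)
  qed
  have "y0 + w = y1" by (simp add: w_def)
  with tendsto_add[OF Y0 tendsto_const, of w] have Y1: "(\<lambda>n. Y n + w) \<longlonglongrightarrow> y1" by simp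
  have contG: "isCont G y" if "y \<in> ball xb \<eta>" for y
  proof -
    have "(3 * s)-lipschitz_on (ball xb R) G"
      using s_ge G_lipschitz by (intro lipschitz_onI) (auto simp: dist_norm)
    then have "continuous_on (ball xb R) G" by (rule lipschitz_on_continuous_on)
    then show ?thesis using eta_ball[OF that] by (simp add: continuous_on_eq_continuous_at)
  qed
  have "c * (norm w)\<^sup>2 \<le> (G y1 - G y0) \<bullet> w"
  proof (rule tendsto_le[OF sequentially_bot _ tendsto_const])
    show "(\<lambda>n. (G (Y n + w) - G (Y n)) \<bullet> w) \<longlonglongrightarrow> (G y1 - G y0) \<bullet> w"
      by (intro tendsto_intros isCont_tendsto_compose[OF contG[OF y(2)] Y1] isCont_tendsto_compose[OF contG[OF y(1)] Y0])
    show "\<forall>\<^sub>F n in sequentially. c * (norm w)\<^sup>2 \<le> (G (Y n + w) - G (Y n)) \<bullet> w"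
      using topological_tendstoD[OF Y0 open_ball y(1)] topological_tendstoD[OF Y1 open_ball y(2)]
    proof eventually_elim
      case (elim n)
      have "AE t in lborel. t \<in> {0..1::real} \<longrightarrow> Y n + t *\<^sub>R w \<notin> N" using Y(2)[of n] N'(1) by auto
      then show ?case using G_monotone_on_generic_segment[of N "Y n" w] N(2) elim by blast
    qed
  qed
  then show ?thesis by (simp add: w_def)
qed

lemma env_strongly_convex:
  assumes y: "y \<in> ball xb \<eta>" "y' \<in> ball xb \<eta>"
  shows "env y + G y \<bullet> (y' - y) + c / 2 * (norm (y' - y))\<^sup>2 \<le> env y'"
proof -
  define w where "w = y' - y"
  define k where "k t = env (y + t *\<^sub>R w) - t * (G y \<bullet> w) - c / 2 * t\<^sup>2 * (norm w)\<^sup>2" for t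
  have "k 0 \<le> k 1"
  proof (rule DERIV_nonneg_imp_nondecreasing[of 0 1 k])
    fix t :: real assume t: "0 \<le> t" "t \<le> 1"
    have "(1 - t) *\<^sub>R y + t *\<^sub>R y' \<in> ball xb \<eta>"
      using convexD_alt[OF convex_ball y] t by simp
    then have yt: "y + t *\<^sub>R w \<in> ball xb \<eta>" by (simp add: w_def algebra_simps)
    have "((\<lambda>t. y + t *\<^sub>R w) has_derivative (\<lambda>h. h *\<^sub>R w)) (at t)"
      by (auto intro!: derivative_eq_intros)
    from has_derivative_compose[OF this env_has_derivative[OF eta_ball[OF yt]]]
    have "((\<lambda>t. env (y + t *\<^sub>R w)) has_real_derivative G (y + t *\<^sub>R w) \<bullet> w) (at t)"
      by (simp add: has_field_derivative_def mult_commute_abs)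
    then have "(k has_real_derivative (G (y + t *\<^sub>R w) - G y) \<bullet> w - c * t * (norm w)\<^sup>2) (at t)"
      unfolding k_def by (auto intro!: derivative_eq_intros simp: inner_diff_left)
    moreover have "0 \<le> (G (y + t *\<^sub>R w) - G y) \<bullet> w - c * t * (norm w)\<^sup>2"
    proof (cases "t = 0")
      case False
      then have "0 < t" using t by simp
      have "t * (c * t * (norm w)\<^sup>2) \<le> t * ((G (y + t *\<^sub>R w) - G y) \<bullet> w)"
        using G_strongly_monotone[OF y(1) yt] by (simp add: power_mult_distrib power2_eq_square mult_ac)
      then have "c * t * (norm w)\<^sup>2 \<le> (G (y + t *\<^sub>R w) - G y) \<bullet> w"
        using \<open>0 < t\<close> by (simp only: mult_le_cancel_left_pos)
      then show ?thesis by simp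
    qed simp
    ultimately show "\<exists>d. (k has_real_derivative d) (at t) \<and> 0 \<le> d" by blast
  qed simp
  then show ?thesis by (simp add: k_def w_def)
qed

text \<open>Strong convexity of \<open>env\<close> between \<open>y\<close> and
  \<open>y' = x + G y / s\<close>. This \<open>y'\<close> has the same offset from \<open>x\<close>
  as \<open>y\<close> from \<open>P y\<close>, so the proximal penalties cancel and
  \<open>y' - y = x - P y\<close>.\<close>

lemma f_growth:
  assumes y: "y \<in> ball xb \<eta>" and x: "x \<in> cball xb \<rho>" "x + G y /\<^sub>R s \<in> ball xb \<eta>"
  shows "ereal (fP y + G y \<bullet> (x - P y) + c / 2 * (norm (x - P y))\<^sup>2) \<le> f x"
proof -
  let ?y = "x + G y /\<^sub>R s"
  have yP: "y = P y + G y /\<^sub>R s" using s_ge by (simp add: G_def)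
  then have diff: "?y - y = x - P y" by (metis add_diff_cancel_right)
  have "norm (x - ?y) = norm (P y - y)" by (subst (2) yP) simp
  then show ?thesis
    using env_strongly_convex[OF y x(2)] env_le'[OF x(1), of ?y] unfolding diff env_def[of y]
    by (intro order_trans[OF _ env_le'[OF x(1), of ?y]]) simp
qed

text \<open>Growth of \<open>f\<close> at \<open>xb\<close> confines a minimizer \<open>m\<close> of
  the tilted function to distance \<open>2 / c * norm v\<close>. Then \<open>y = m + v / s\<close>
  satisfies \<open>P y = m\<close> and \<open>G y = v\<close>, and \<open>f_growth\<close> at
  \<open>y\<close> is the claim. The bound on \<open>v\<close> gives
  \<open>norm (y - xb) < \<eta> / 8\<close>, so \<open>P_near\<close> puts \<open>P y\<close> within
  \<open>\<eta> / 2\<close> of \<open>xb\<close>.\<close>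

lemma tilt_minimizer:
  assumes v: "norm v < \<eta> / (8 * (2 / c + 1 / s))"
  obtains m a where "m \<in> cball xb (\<eta> / 2)" "f m = ereal a"
    "\<And>x. x \<in> cball xb (\<eta> / 2) \<Longrightarrow> ereal (a + v \<bullet> (x - m) + c / 2 * (norm (x - m))\<^sup>2) \<le> f x"
proof -
  let ?B = "cball xb (\<eta> / 2)"
  have k: "0 < 2 / c + 1 / s" using c_pos s_ge by (intro add_pos_pos) auto
  have eta_rho: "\<eta> / 2 < \<rho>" using eta_le eta_pos R_le R_pos by linarith
  then have sub: "x \<in> cball xb \<rho>" if "x \<in> ?B" for x using that by simp
  have vk: "norm v * (2 / c + 1 / s) < \<eta> / 8" using v k by (simp add: field_simps)
  have vs: "norm v / s \<le> norm v * (2 / c + 1 / s)" using c_pos by (simp add: distrib_left)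
  obtain m where m: "m \<in> ?B" "\<And>x. x \<in> ?B \<Longrightarrow> f m + ereal (- (v \<bullet> m)) \<le> f x + ereal (- (v \<bullet> x))"
    by (rule lsc_plus_continuous_attains_inf[of ?B f "\<lambda>x. - (v \<bullet> x)"])
      (use eta_pos lsc sub in \<open>auto intro!: continuous_intros\<close>)
  have xbB: "xb \<in> ?B" using eta_pos by simp
  have "f m \<noteq> \<infinity>" using m(2)[OF xbB] by (auto simp: f_xb)
  moreover have "f m \<noteq> -\<infinity>" using growth_xb[OF sub[OF m(1)]] by auto
  ultimately obtain a where a: "f m = ereal a" by (cases "f m") auto
  have min: "ereal (a + v \<bullet> (x - m)) \<le> f x" if "x \<in> ?B" for x
    using m(2)[OF that] by (cases "f x") (auto simp: a inner_diff_right)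
  have near: "norm (m - xb) \<le> 2 / c * norm v"
  proof -
    have "fb + c / 2 * (norm (m - xb))\<^sup>2 \<le> a"
      using f_growth[of xb m] m(1) sub[OF m(1)] eta_pos by (simp add: G_xb P_xb fP_def f_xb a)
    moreover have "a + v \<bullet> (xb - m) \<le> fb" using min[OF xbB] by (simp add: f_xb)
    ultimately have "c / 2 * (norm (m - xb))\<^sup>2 \<le> v \<bullet> (m - xb)" by (simp add: inner_diff_right)
    also have "\<dots> \<le> norm v * norm (m - xb)" by (rule norm_cauchy_schwarz)
    finally have "c / 2 * norm (m - xb) * norm (m - xb) \<le> norm v * norm (m - xb)" by (simp add: power2_eq_square)
    then have "m \<noteq> xb \<Longrightarrow> c / 2 * norm (m - xb) \<le> norm v" by simp
    then show ?thesis using c_pos by (cases "m = xb") (auto simp: field_simps)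
  qed
  define y where "y = m + v /\<^sub>R s"
  have "norm (y - xb) \<le> norm (m - xb) + norm (v /\<^sub>R s)"
    unfolding y_def using norm_triangle_ineq[of "m - xb" "v /\<^sub>R s"] by (simp add: algebra_simps)
  also have "norm (v /\<^sub>R s) = norm v / s" using s_ge by (simp add: divide_inverse mult.commute)
  finally have "norm (y - xb) \<le> norm v * (2 / c + 1 / s)" using near by (simp add: distrib_left mult.commute)
  with vk have ny: "norm (y - xb) < \<eta> / 8" by linarith
  have y: "y \<in> ball xb \<eta>" using ny eta_pos by (simp add: dist_norm norm_minus_commute)
  \<comment> \<open>\<open>m\<close> minimizes the tilted function and \<open>P y\<close> the
    proximal one; testing each at the other and adding leaves
    \<open>s / 2 * (norm (P y - m))\<^sup>2 \<le> 0\<close>.\<close>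
  have Py: "P y = m"
  proof -
    have PB: "P y \<in> ?B" using P_near[of y] ny by (simp add: dist_norm norm_minus_commute)
    have "fP y + s / 2 * (norm (P y - y))\<^sup>2 \<le> a + s / 2 * (norm (m - y))\<^sup>2"
      using P_le[OF sub[OF m(1)], of y] by (simp add: f_P a)
    moreover have "a + v \<bullet> (P y - m) \<le> fP y" using min[OF PB] by (simp add: f_P)
    moreover have "s / 2 * (norm (P y - y))\<^sup>2 = s / 2 * (norm (m - y))\<^sup>2 - v \<bullet> (P y - m) + s / 2 * (norm (P y - m))\<^sup>2"
    proof -
      have "P y - y = (m - y) + 1 *\<^sub>R (P y - m)" by simp
      then have sq: "(norm (P y - y))\<^sup>2 = (norm (m - y))\<^sup>2 + 2 * ((m - y) \<bullet> (P y - m)) + (norm (P y - m))\<^sup>2"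
        using norm_add_scaleR_square[of "m - y" 1 "P y - m"] by simp
      have "s * ((m - y) \<bullet> (P y - m)) = - (v \<bullet> (P y - m))" using s_ge by (simp add: y_def)
      then show ?thesis unfolding sq by (simp add: distrib_left)
    qed
    ultimately have "s / 2 * (norm (P y - m))\<^sup>2 \<le> 0" by linarith
    then show ?thesis using s_ge by (simp add: mult_le_0_iff)
  qed
  have "G y = s *\<^sub>R (y - m)" by (simp add: G_def Py)
  then have Gy: "G y = v" using s_ge by (simp add: y_def)
  have fPy: "fP y = a" by (simp add: fP_def Py a)
  show ?thesis
  proof (rule that[OF m(1) a])
    fix x assume x: "x \<in> ?B"
    have "norm (x + v /\<^sub>R s - xb) \<le> norm (x - xb) + norm (v /\<^sub>R s)"
      using norm_triangle_ineq[of "x - xb" "v /\<^sub>R s"] by (simp add: algebra_simps)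
    also have "norm (v /\<^sub>R s) = norm v / s" using s_ge by (simp add: divide_inverse mult.commute)
    also have "norm (x - xb) + norm v / s < \<eta>"
    proof -
      have "norm (x - xb) \<le> \<eta> / 2" using x by (simp add: dist_norm norm_minus_commute)
      then show ?thesis using vs vk eta_pos by linarith
    qed
    finally have "x + G y /\<^sub>R s \<in> ball xb \<eta>" by (simp add: Gy dist_norm norm_minus_commute)
    from f_growth[OF y sub[OF x] this]
    show "ereal (a + v \<bullet> (x - m) + c / 2 * (norm (x - m))\<^sup>2) \<le> f x" by (simp add: Py Gy fPy)
  qed
qed

lemma tilt_stable: "tilt_stable_local_minimizer f xb"
proof -
  let ?B = "cball xb (\<eta> / 2)"
  define \<delta> where "\<delta> = \<eta> / (8 * (2 / c + 1 / s))"
  have \<delta>: "0 < \<delta>" using c_pos s_ge eta_pos by (auto simp: \<delta>_def intro!: divide_pos_pos add_pos_pos)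
  have "\<forall>v\<in>ball 0 \<delta>. \<exists>m. m \<in> ?B \<and> (\<exists>a. f m = ereal a \<and>
      (\<forall>x\<in>?B. ereal (a + v \<bullet> (x - m) + c / 2 * (norm (x - m))\<^sup>2) \<le> f x))"
  proof
    fix v :: 'a assume "v \<in> ball 0 \<delta>"
    then have "norm v < \<eta> / (8 * (2 / c + 1 / s))" by (simp add: \<delta>_def)
    from tilt_minimizer[OF this] show "\<exists>m. m \<in> ?B \<and> (\<exists>a. f m = ereal a \<and>
      (\<forall>x\<in>?B. ereal (a + v \<bullet> (x - m) + c / 2 * (norm (x - m))\<^sup>2) \<le> f x))" by metis
  qed
  from bchoice[OF this] obtain m where m: "\<And>v. v \<in> ball 0 \<delta> \<Longrightarrow> m v \<in> ?B \<and> (\<exists>a. f (m v) = ereal a \<and>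
      (\<forall>x\<in>?B. ereal (a + v \<bullet> (x - m v) + c / 2 * (norm (x - m v))\<^sup>2) \<le> f x))" by blast
  have arg: "tilt_argmin f xb (\<eta> / 2) v = {m v}" if v: "v \<in> ball 0 \<delta>" for v
  proof -
    obtain a where "f (m v) = ereal a" "\<And>x. x \<in> ?B \<Longrightarrow> ereal (a + v \<bullet> (x - m v) + c / 2 * (norm (x - m v))\<^sup>2) \<le> f x"
      using m[OF v] by blast
    then show ?thesis using m[OF v] c_pos by (intro tilt_argmin_eqI[of _ _ _ f a c]) auto
  qed
  have "tilt_argmin f xb (\<eta> / 2) 0 = {xb}"
  proof (rule tilt_argmin_eqI[of _ _ _ f fb c])
    fix x assume x: "x \<in> ?B"
    have "x \<in> cball xb \<rho>" using x eta_le eta_pos R_le R_pos by simp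
    then show "ereal (fb + 0 \<bullet> (x - xb) + c / 2 * (norm (x - xb))\<^sup>2) \<le> f x"
      using f_growth[of xb x] x eta_pos by (simp add: G_xb P_xb fP_def f_xb)
  qed (use eta_pos f_xb c_pos in auto)
  moreover have "(1 / c)-lipschitz_on (ball 0 \<delta>) m"
  proof (rule lipschitz_onI)
    fix v w :: 'a assume v: "v \<in> ball 0 \<delta>" and w: "w \<in> ball 0 \<delta>"
    obtain a where a: "f (m v) = ereal a" "\<And>x. x \<in> ?B \<Longrightarrow> ereal (a + v \<bullet> (x - m v) + c / 2 * (norm (x - m v))\<^sup>2) \<le> f x"
      using m[OF v] by blast
    obtain b where b: "f (m w) = ereal b" "\<And>x. x \<in> ?B \<Longrightarrow> ereal (b + w \<bullet> (x - m w) + c / 2 * (norm (x - m w))\<^sup>2) \<le> f x"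
      using m[OF w] by blast
    let ?d = "m v - m w"
    \<comment> \<open>Each growth inequality is tested at the other minimizer; their sum is strong
      monotonicity of the inverse of \<open>m\<close>.\<close>
    have "a + v \<bullet> (m w - m v) + c / 2 * (norm ?d)\<^sup>2 \<le> b"
      using a(2)[of "m w"] m[OF w] by (simp add: b(1) norm_minus_commute)
    moreover have "b + w \<bullet> (m v - m w) + c / 2 * (norm ?d)\<^sup>2 \<le> a"
      using b(2)[of "m v"] m[OF v] by (simp add: a(1))
    ultimately have "c * (norm ?d)\<^sup>2 \<le> (v - w) \<bullet> ?d"
      by (simp add: inner_diff_left inner_diff_right)
    also have "\<dots> \<le> norm (v - w) * norm ?d" by (rule norm_cauchy_schwarz)
    finally have "c * norm ?d * norm ?d \<le> norm (v - w) * norm ?d" by (simp add: power2_eq_square)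
    then have "?d \<noteq> 0 \<Longrightarrow> c * norm ?d \<le> norm (v - w)" by (simp add: mult_le_cancel_right)
    then show "dist (m v) (m w) \<le> 1 / c * dist v w"
      using c_pos by (cases "?d = 0") (auto simp: dist_norm field_simps)
  qed (use c_pos in simp)
  ultimately show ?thesis
    unfolding tilt_stable_local_minimizer_def using eta_pos \<delta> f_xb arg
    by (intro conjI exI[of _ "\<eta> / 2"] exI[of _ "ball 0 \<delta>"] exI[of _ m] exI[of _ "1 / c"]) auto
qed

end

theorem tilt_stable_if_quad_bundle_positive:
  assumes prox: "prox_regular f xb 0"
    and pos: "\<And>q w. q \<in> quad_bundle f xb 0 \<Longrightarrow> w \<noteq> 0 \<Longrightarrow> 0 < q w"
  shows "tilt_stable_local_minimizer f xb"
proof -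
  obtain \<rho> r fb where "prox_regular_at f xb \<rho> r fb" using prox_regular_locale[OF prox] .
  then interpret prox_regular_at f xb \<rho> r fb .
  obtain c \<eta> where "0 < c" "0 < \<eta>" "\<eta> \<le> R / 2"
    "\<And>y A z. y \<in> ball xb \<eta> \<Longrightarrow> G_Gateaux y A \<Longrightarrow> c * (norm z)\<^sup>2 \<le> A z \<bullet> z"
  proof (rule Gateaux_derivatives_positive)
    show "0 < q w" if "q \<in> quad_bundle f xb 0" "w \<noteq> 0" for q w using that by (rule pos)
  qed (rule that)
  then interpret prox_regular_positive f xb \<rho> r fb c \<eta> by unfold_locales
  show ?thesis by (rule tilt_stable)
qed

subsection \<open>Tilt stability implies positive quadratic bundle\<close>

locale tilt_stable_at = prox_regular_at +
  fixes \<gamma> \<kappa> \<delta> :: real and m :: "'a \<Rightarrow> 'a"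
  assumes gamma_pos: "0 < \<gamma>" and kappa_pos: "0 < \<kappa>" and delta_pos: "0 < \<delta>"
    and argmin_zero: "tilt_argmin f xb \<gamma> 0 = {xb}"
    and argmin: "\<And>v. v \<in> ball 0 \<delta> \<Longrightarrow> tilt_argmin f xb \<gamma> v = {m v}"
    and m_lip: "\<And>v w. v \<in> ball 0 \<delta> \<Longrightarrow> w \<in> ball 0 \<delta> \<Longrightarrow> norm (m v - m w) \<le> \<kappa> * norm (v - w)"
begin

definition fm :: "'a \<Rightarrow> real" where "fm v = real_of_ereal (f (m v))"

text \<open>On \<open>ball 0 \<delta>\<close> this is the conjugate of \<open>f\<close> restricted to \<open>cball xb \<gamma>\<close>, and \<open>m\<close> is its gradient.\<close>

definition g :: "'a \<Rightarrow> real" where "g v = v \<bullet> m v - fm v"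

lemma m_zero: "m 0 = xb" using argmin[of 0] argmin_zero delta_pos by simp

lemma argmin_le:
  assumes v: "v \<in> ball 0 \<delta>"
  shows "m v \<in> cball xb \<gamma>" "x \<in> cball xb \<gamma> \<Longrightarrow> f (m v) - ereal (v \<bullet> m v) \<le> f x - ereal (v \<bullet> x)"
proof -
  have "m v \<in> tilt_argmin f xb \<gamma> v" using argmin[OF v] by simp
  then show "m v \<in> cball xb \<gamma>" "x \<in> cball xb \<gamma> \<Longrightarrow> f (m v) - ereal (v \<bullet> m v) \<le> f x - ereal (v \<bullet> x)"
    unfolding tilt_argmin_def is_arg_min_def mem_Collect_eq not_less[symmetric] by blast+
qed

lemma f_ge_fb: "x \<in> cball xb \<gamma> \<Longrightarrow> ereal fb \<le> f x"
  using argmin_le(2)[of 0 x] delta_pos by (cases "f x") (simp_all add: m_zero f_xb)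

lemma f_m: "v \<in> ball 0 \<delta> \<Longrightarrow> f (m v) = ereal (fm v)"
proof -
  assume v: "v \<in> ball 0 \<delta>"
  have "f (m v) \<noteq> \<infinity>" using argmin_le(2)[OF v, of xb] gamma_pos by (auto simp: f_xb)
  moreover have "f (m v) \<noteq> -\<infinity>" using f_ge_fb[OF argmin_le(1)[OF v]] by auto
  ultimately show ?thesis by (cases "f (m v)") (auto simp: fm_def)
qed

lemma support:
  assumes "v \<in> ball 0 \<delta>" "x \<in> cball xb \<gamma>"
  shows "ereal (fm v + v \<bullet> (x - m v)) \<le> f x"
  using argmin_le(2)[OF assms] by (cases "f x") (auto simp: f_m[OF assms(1)] inner_diff_right)

lemma g_ge:
  assumes "v \<in> ball 0 \<delta>" "w \<in> ball 0 \<delta>"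
  shows "g v + (w - v) \<bullet> m v \<le> g w"
  using support[OF assms(2) argmin_le(1)[OF assms(1)]]
  by (simp add: f_m[OF assms(1)] g_def inner_diff_left inner_diff_right)

text \<open>\<open>g_ge\<close> with the points exchanged, and the Lipschitz bound for
  \<open>m\<close>: the conjugate is smooth.\<close>

lemma g_le:
  assumes v: "v \<in> ball 0 \<delta>" and w: "w \<in> ball 0 \<delta>"
  shows "g w \<le> g v + (w - v) \<bullet> m v + \<kappa> * (norm (w - v))\<^sup>2"
proof -
  have "(w - v) \<bullet> (m w - m v) \<le> norm (w - v) * norm (m w - m v)" by (rule norm_cauchy_schwarz)
  also have "\<dots> \<le> norm (w - v) * (\<kappa> * norm (w - v))" using m_lip[OF w v] by (intro mult_left_mono) auto
  finally show ?thesis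
    using g_ge[OF w v] by (simp add: power2_eq_square inner_diff_left inner_diff_right mult.left_commute)
qed

text \<open>Smoothness of the conjugate dualizes to growth of \<open>f\<close>:
  \<open>support\<close> is applied at a dual point \<open>w\<close> near \<open>v\<close>, and
  \<open>g_le\<close> estimates \<open>g w\<close>.\<close>

lemma growth_at_m:
  assumes v: "v \<in> ball 0 (\<delta> / 2)" and u: "u \<in> cball xb \<gamma>" "norm (u - m v) < \<kappa> * \<delta>"
  shows "ereal (fm v + v \<bullet> (u - m v) + 1 / (2 * \<kappa>) / 2 * (norm (u - m v))\<^sup>2) \<le> f u"
proof -
  define d where "d = u - m v"
  \<comment> \<open>This \<open>w\<close> maximizes
    \<open>(w - v) \<bullet> d - \<kappa> * (norm (w - v))\<^sup>2\<close>, with value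
    \<open>(norm d)\<^sup>2 / (4 * \<kappa>)\<close>; the restriction
    \<open>norm d < \<kappa> * \<delta>\<close> keeps it in \<open>ball 0 \<delta>\<close>.\<close>
  define w where "w = v + (1 / (2 * \<kappa>)) *\<^sub>R d"
  have v': "v \<in> ball 0 \<delta>" using v delta_pos by simp
  have "norm w \<le> norm v + norm ((1 / (2 * \<kappa>)) *\<^sub>R d)" unfolding w_def by (rule norm_triangle_ineq)
  also have "\<dots> < \<delta> / 2 + \<delta> / 2"
  proof (rule add_strict_mono)
    have "norm ((1 / (2 * \<kappa>)) *\<^sub>R d) = norm d / (2 * \<kappa>)" using kappa_pos by simp
    also have "\<dots> < \<delta> / 2" using u(2) kappa_pos by (simp add: d_def field_simps)
    finally show "norm ((1 / (2 * \<kappa>)) *\<^sub>R d) < \<delta> / 2" .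
  qed (use v in simp)
  finally have w: "w \<in> ball 0 \<delta>" by simp
  have sub: "w - v = (1 / (2 * \<kappa>)) *\<^sub>R d" by (simp add: w_def)
  have "(w - v) \<bullet> d - \<kappa> * (norm (w - v))\<^sup>2 = 1 / (2 * \<kappa>) / 2 * (norm d)\<^sup>2"
    using kappa_pos unfolding sub by (simp add: power_mult_distrib power_divide power2_eq_square[of \<kappa>] field_simps flip: power2_norm_eq_inner)
  moreover have "w \<bullet> u - g w \<ge> w \<bullet> u - (g v + (w - v) \<bullet> m v + \<kappa> * (norm (w - v))\<^sup>2)"
    using g_le[OF v' w] by simp
  moreover have "w \<bullet> u = v \<bullet> u + (w - v) \<bullet> m v + (w - v) \<bullet> d"
    by (simp add: d_def inner_diff_left inner_diff_right)
  ultimately have "fm v + v \<bullet> (u - m v) + 1 / (2 * \<kappa>) / 2 * (norm d)\<^sup>2 \<le> w \<bullet> u - g w"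
    by (simp add: g_def inner_diff_right)
  also have "ereal (w \<bullet> u - g w) \<le> f u" using support[OF w u(1)] by (simp add: g_def inner_diff_right algebra_simps)
  finally show ?thesis by (simp add: d_def)
qed

lemma g_continuous: "continuous_on (ball 0 \<delta>) g"
proof (rule lipschitz_on_continuous_on[OF lipschitz_onI])
  fix v w :: 'a assume vw: "v \<in> ball 0 \<delta>" "w \<in> ball 0 \<delta>"
  have le: "g w - g v \<le> (norm xb + \<gamma>) * norm (v - w)" if "v \<in> ball 0 \<delta>" "w \<in> ball 0 \<delta>" for v w
  proof -
    have "norm (m w) \<le> norm xb + norm (m w - xb)" using norm_triangle_sub by blast
    also have "\<dots> \<le> norm xb + \<gamma>" using argmin_le(1)[OF that(2)] by (simp add: dist_norm norm_minus_commute)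
    finally have mw: "norm (m w) \<le> norm xb + \<gamma>" .
    have "g w - g v \<le> (w - v) \<bullet> m w" using g_ge[OF that(2,1)] by (simp add: inner_diff_left)
    also have "\<dots> \<le> norm (w - v) * norm (m w)" by (rule norm_cauchy_schwarz)
    also have "\<dots> \<le> norm (w - v) * (norm xb + \<gamma>)" using mw by (rule mult_left_mono) simp
    finally show ?thesis by (simp add: norm_minus_commute mult.commute)
  qed
  show "dist (g v) (g w) \<le> (norm xb + \<gamma>) * dist v w"
    using le[OF vw] le[OF vw(2,1)] by (simp add: dist_real_def dist_norm abs_le_iff norm_minus_commute)
qed (use gamma_pos in simp)

text \<open>Minimizing \<open>w \<mapsto> |w|\<^sup>2 / 2 + \<sigma> g w - b \<bullet> w\<close> solves \<open>w + \<sigma> m w = b\<close>.\<close>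

lemma resolvent_equation:
  assumes \<sigma>: "0 < \<sigma>" and b: "4 * norm (b - \<sigma> *\<^sub>R xb) < \<delta>"
  obtains w where "norm w \<le> 2 * norm (b - \<sigma> *\<^sub>R xb)" "w + \<sigma> *\<^sub>R m w = b"
proof -
  define \<phi> where "\<phi> w = (norm w)\<^sup>2 / 2 + \<sigma> * g w - b \<bullet> w" for w
  have sub: "cball 0 (\<delta> / 2) \<subseteq> ball (0::'a) \<delta>" using delta_pos by auto
  have "continuous_on (cball 0 (\<delta> / 2)) \<phi>"
    unfolding \<phi>_def by (intro continuous_intros continuous_on_subset[OF g_continuous sub]) auto
  then obtain w where w: "w \<in> cball 0 (\<delta> / 2)" "\<And>z. z \<in> cball 0 (\<delta> / 2) \<Longrightarrow> \<phi> w \<le> \<phi> z"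
    using continuous_attains_inf[of "cball (0::'a) (\<delta> / 2)" \<phi>] delta_pos by auto
  have wd: "w \<in> ball 0 \<delta>" using w(1) sub by blast
  \<comment> \<open>Comparison with \<open>\<phi> 0\<close> bounds the minimizer; by the hypothesis
    on \<open>b\<close> it lies in the open ball, so the constraint is inactive.\<close>
  have nw: "norm w \<le> 2 * norm (b - \<sigma> *\<^sub>R xb)"
  proof -
    have "g 0 + w \<bullet> xb \<le> g w" using g_ge[OF _ wd, of 0] delta_pos by (simp add: m_zero)
    then have "\<sigma> * (w \<bullet> xb) \<le> \<sigma> * (g w - g 0)" using \<sigma> by (intro mult_left_mono) auto
    moreover have "\<phi> w \<le> \<phi> 0" using delta_pos by (intro w(2)) simp
    ultimately have "(norm w)\<^sup>2 / 2 \<le> (b - \<sigma> *\<^sub>R xb) \<bullet> w"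
      by (simp add: \<phi>_def algebra_simps inner_commute)
    also have "\<dots> \<le> norm (b - \<sigma> *\<^sub>R xb) * norm w" by (rule norm_cauchy_schwarz)
    finally have "norm w * norm w \<le> (2 * norm (b - \<sigma> *\<^sub>R xb)) * norm w" by (simp add: power2_eq_square)
    then show ?thesis by (cases "w = 0") (auto simp: mult_le_cancel_right)
  qed
  \<comment> \<open>The gradient of \<open>\<phi>\<close> at \<open>w\<close>. A small step
    \<open>- \<tau> E\<close> stays in the ball, and minimality with \<open>g_le\<close> gives
    \<open>(norm E)\<^sup>2 \<le> \<tau> * ?C\<close>.\<close>
  define E where "E = w + \<sigma> *\<^sub>R m w - b"
  have "(norm E)\<^sup>2 \<le> 0"
  proof (rule tendsto_lowerbound)
    let ?C = "(norm E)\<^sup>2 / 2 + \<sigma> * \<kappa> * (norm E)\<^sup>2"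
    have "((\<lambda>\<tau>. \<tau> * ?C) \<longlongrightarrow> 0 * ?C) (at_right 0)" by (intro tendsto_intros)
    then show "((\<lambda>\<tau>. \<tau> * ?C) \<longlongrightarrow> 0) (at_right 0)" by simp
    have "norm w < \<delta> / 2" using nw b by simp
    then have "w \<in> ball 0 (\<delta> / 2)" by simp
    moreover have "((\<lambda>\<tau>. w - \<tau> *\<^sub>R E) \<longlongrightarrow> w - 0 *\<^sub>R E) (at_right 0)" by (intro tendsto_intros)
    ultimately have "\<forall>\<^sub>F \<tau> in at_right 0. w - \<tau> *\<^sub>R E \<in> ball 0 (\<delta> / 2)"
      using topological_tendstoD[OF _ open_ball] by fastforce
    with eventually_at_right_less[of "0::real"] show "\<forall>\<^sub>F \<tau> in at_right 0. (norm E)\<^sup>2 \<le> \<tau> * ?C"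
    proof eventually_elim
      case (elim \<tau>)
      let ?w = "w - \<tau> *\<^sub>R E"
      have w': "?w \<in> ball 0 \<delta>" using elim(2) delta_pos by simp
      have "\<phi> w \<le> \<phi> ?w" using elim(2) by (intro w(2)) simp
      then have "(norm w)\<^sup>2 / 2 + \<sigma> * g w \<le> (norm ?w)\<^sup>2 / 2 + \<sigma> * g ?w + \<tau> * (b \<bullet> E)"
        by (simp add: \<phi>_def inner_diff_right)
      moreover have "\<sigma> * g ?w \<le> \<sigma> * g w - \<tau> * (\<sigma> * (E \<bullet> m w)) + \<tau> * (\<tau> * (\<sigma> * \<kappa> * (norm E)\<^sup>2))"
      proof -
        have "\<sigma> * g ?w \<le> \<sigma> * (g w - \<tau> * (E \<bullet> m w) + \<kappa> * (\<tau>\<^sup>2 * (norm E)\<^sup>2))"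
          using g_le[OF wd w'] \<sigma> by (intro mult_left_mono) (auto simp: power_mult_distrib)
        then show ?thesis by (simp add: algebra_simps power2_eq_square[of \<tau>])
      qed
      moreover have "(norm ?w)\<^sup>2 = (norm w)\<^sup>2 - 2 * (\<tau> * (w \<bullet> E)) + \<tau> * (\<tau> * (norm E)\<^sup>2)"
        using norm_add_scaleR_square[of w "- \<tau>" E] by (simp add: power2_eq_square[of \<tau>])
      moreover have "\<tau> * (w \<bullet> E + \<sigma> * (E \<bullet> m w) - b \<bullet> E)
          = \<tau> * (w \<bullet> E) + \<tau> * (\<sigma> * (E \<bullet> m w)) - \<tau> * (b \<bullet> E)"
        by (simp add: algebra_simps)
      moreover have "\<tau> * (\<tau> * ?C) = \<tau> * (\<tau> * (norm E)\<^sup>2) / 2 + \<tau> * (\<tau> * (\<sigma> * \<kappa> * (norm E)\<^sup>2))"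
        by (simp add: algebra_simps)
      ultimately have "\<tau> * (w \<bullet> E + \<sigma> * (E \<bullet> m w) - b \<bullet> E) \<le> \<tau> * (\<tau> * ?C)"
        by linarith
      moreover have "w \<bullet> E + \<sigma> * (E \<bullet> m w) - b \<bullet> E = (norm E)\<^sup>2"
      proof -
        have "(norm E)\<^sup>2 = (w + \<sigma> *\<^sub>R m w - b) \<bullet> E" by (simp add: power2_norm_eq_inner E_def)
        then show ?thesis by (simp add: inner_add_left inner_diff_left inner_commute[of E "m w"])
      qed
      ultimately show ?case using elim(1) by (simp only: mult_le_cancel_left_pos)
    qed
  qed simp
  then have "w + \<sigma> *\<^sub>R m w = b" by (simp add: E_def)
  with nw show ?thesis by (rule that)
qed

text \<open>Minty's device: with \<open>w + (r + 1) m w = v + (r + 1) x\<close> one has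
  \<open>v - w = (r + 1) (m w - x)\<close>. Prox-regularity at \<open>(x, v)\<close> tested at
  \<open>m w\<close>, and \<open>support\<close> for \<open>w\<close> tested at \<open>x\<close>,
  bound \<open>(v - w) \<bullet> (m w - x)\<close> by \<open>r / 2\<close> times the squared
  distance. This forces \<open>m w = x\<close>, hence \<open>w = v\<close>.\<close>

lemma subgradient_is_argmin:
  assumes v: "v \<in> limiting_subdifferential f x" and x: "x \<in> cball xb \<rho>" "x \<in> cball xb \<gamma>" and nv: "norm v \<le> \<rho>"
    and fx: "f x < f xb + ereal \<rho>"
    and small: "4 * (norm v + (r + 1) * norm (x - xb)) < \<delta>" "2 * \<kappa> * (norm v + (r + 1) * norm (x - xb)) \<le> \<rho>"
  shows "x = m v"
proof -
  let ?\<sigma> = "r + 1"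
  let ?b = "v + ?\<sigma> *\<^sub>R x"
  have "norm (?b - ?\<sigma> *\<^sub>R xb) \<le> norm v + norm (?\<sigma> *\<^sub>R (x - xb))"
    using norm_triangle_ineq[of v "?\<sigma> *\<^sub>R (x - xb)"] by (simp add: algebra_simps)
  then have nb: "norm (?b - ?\<sigma> *\<^sub>R xb) \<le> norm v + ?\<sigma> * norm (x - xb)" using r_nonneg by simp
  have "0 < ?\<sigma>" using r_nonneg by simp
  moreover have "4 * norm (?b - ?\<sigma> *\<^sub>R xb) < \<delta>"
    by (rule le_less_trans[OF mult_left_mono[OF nb] small(1)]) simp
  ultimately obtain w where w: "norm w \<le> 2 * norm (?b - ?\<sigma> *\<^sub>R xb)" "w + ?\<sigma> *\<^sub>R m w = ?b"
    by (rule resolvent_equation)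
  have "2 * norm w \<le> 4 * norm (?b - ?\<sigma> *\<^sub>R xb)" using w(1) by linarith
  also have "\<dots> \<le> 4 * (norm v + ?\<sigma> * norm (x - xb))" using nb by (rule mult_left_mono) simp
  also have "\<dots> < \<delta>" by (rule small(1))
  finally have "2 * norm w < \<delta>" .
  then have "norm w < \<delta>" using norm_ge_zero[of w] by linarith
  then have wd: "w \<in> ball 0 \<delta>" by simp
  have "norm (m w - xb) \<le> \<kappa> * norm w" using m_lip[OF wd, of 0] delta_pos by (simp add: m_zero)
  also have "\<dots> \<le> \<kappa> * (2 * (norm v + ?\<sigma> * norm (x - xb)))" using w(1) nb kappa_pos by (intro mult_left_mono) auto
  also have "\<dots> \<le> \<rho>" using small(2) by (simp add: mult_ac)
  finally have mw: "m w \<in> cball xb \<rho>" by (simp add: dist_norm norm_minus_commute)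
  obtain a where a: "f x = ereal a" using v by (cases "f x") (auto simp: limiting_subdifferential_def)
  have "a + v \<bullet> (m w - x) - r / 2 * (norm (m w - x))\<^sup>2 \<le> fm w"
    using prox[OF v x(1) nv fx mw] by (simp add: a f_m[OF wd])
  moreover have "fm w + w \<bullet> (x - m w) \<le> a" using support[OF wd x(2)] by (simp add: a)
  ultimately have "(v - w) \<bullet> (m w - x) \<le> r / 2 * (norm (m w - x))\<^sup>2"
    by (simp add: inner_diff_left inner_diff_right)
  moreover have "v - w = ?\<sigma> *\<^sub>R (m w - x)" using w(2) by (simp add: algebra_simps)
  ultimately have "(r + 1) * (norm (m w - x))\<^sup>2 \<le> r / 2 * (norm (m w - x))\<^sup>2" by (simp add: power2_norm_eq_inner)
  then have "(r / 2 + 1) * (norm (m w - x))\<^sup>2 \<le> 0" by (simp add: algebra_simps)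
  then have "m w = x" using r_nonneg by (simp add: mult_le_0_iff)
  then show ?thesis using w(2) by simp
qed

text \<open>Subdifferential continuity enters here: it supplies the condition on \<open>f x\<close>
  in the prox-regularity inequality for all subgradient pairs near the base point.\<close>

lemma subdifferentially_continuous_bound:
  assumes "subdifferentially_continuous f xb 0"
  obtains \<epsilon> where "0 < \<epsilon>"
    "\<And>x v. v \<in> limiting_subdifferential f x \<Longrightarrow> dist (x, v) (xb, 0) < \<epsilon> \<Longrightarrow> f x < f xb + ereal \<rho>"
proof (rule ccontr)
  assume contr: "\<not> thesis"
  have "\<exists>x v. v \<in> limiting_subdifferential f x \<and> dist (x, v) (xb, 0) < inverse (Suc n) \<and> \<not> f x < f xb + ereal \<rho>" for n
    using contr that[of "inverse (real (Suc n))"] by auto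
  then obtain x v where xv: "\<And>n. v n \<in> limiting_subdifferential f (x n)"
     "\<And>n. dist (x n, v n) (xb, 0) < inverse (real (Suc n))" "\<And>n. \<not> f (x n) < f xb + ereal \<rho>" by metis
  have "(\<lambda>n. (x n, v n)) \<longlonglongrightarrow> (xb, 0)"
  proof (rule tendstoI)
    fix e :: real assume "0 < e"
    with LIMSEQ_inverse_real_of_nat have "\<forall>\<^sub>F n in sequentially. inverse (real (Suc n)) < e"
      by (rule order_tendstoD(2))
    then show "\<forall>\<^sub>F n in sequentially. dist (x n, v n) (xb, 0) < e"
      by eventually_elim (use xv(2) less_trans in blast)
  qed
  then have "(\<lambda>n. f (x n)) \<longlonglongrightarrow> f xb"
    using assms xv(1) unfolding subdifferentially_continuous_def by blast
  moreover have "f xb < f xb + ereal \<rho>" using rho_pos by (simp add: f_xb)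
  ultimately have "\<forall>\<^sub>F n in sequentially. f (x n) < f xb + ereal \<rho>" by (rule order_tendstoD(2))
  then show False using xv(3) by (simp add: eventually_const_iff)
qed

lemma second_subderivative_ge_near:
  assumes "subdifferentially_continuous f xb 0"
  obtains \<epsilon> where "0 < \<epsilon>" "\<And>x v w. v \<in> limiting_subdifferential f x \<Longrightarrow> dist (x, v) (xb, 0) < \<epsilon> \<Longrightarrow>
    ereal (1 / (2 * \<kappa>) * (norm w)\<^sup>2) \<le> second_subderivative f x v w"
proof -
  obtain \<epsilon>0 where \<epsilon>0: "0 < \<epsilon>0"
    "\<And>x v. v \<in> limiting_subdifferential f x \<Longrightarrow> dist (x, v) (xb, 0) < \<epsilon>0 \<Longrightarrow> f x < f xb + ereal \<rho>"
    using subdifferentially_continuous_bound[OF assms] by blast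
  \<comment> \<open>The last two entries serve the smallness conditions of
    \<open>subgradient_is_argmin\<close>, where
    \<open>norm v + (r + 1) * norm (x - xb) < \<epsilon> * (r + 2)\<close>;
    \<open>\<delta> / 2\<close> is the radius in \<open>growth_at_m\<close>.\<close>
  define \<epsilon> where "\<epsilon> = Min {\<epsilon>0, \<rho>, \<gamma>, \<delta> / 2, \<delta> / (4 * (r + 2)), \<rho> / (2 * \<kappa> * (r + 2))}"
  have \<epsilon>: "0 < \<epsilon>" using \<epsilon>0 rho_pos gamma_pos delta_pos kappa_pos r_nonneg by (simp add: \<epsilon>_def)
  have le: "\<epsilon> \<le> \<epsilon>0" "\<epsilon> \<le> \<rho>" "\<epsilon> \<le> \<gamma>" "\<epsilon> \<le> \<delta> / 2" "\<epsilon> \<le> \<delta> / (4 * (r + 2))" "\<epsilon> \<le> \<rho> / (2 * \<kappa> * (r + 2))"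
    unfolding \<epsilon>_def by (rule Min_le; simp)+
  have e1: "4 * (\<epsilon> * (r + 2)) \<le> \<delta>" using le(5) r_nonneg by (simp add: field_simps)
  have e2: "2 * \<kappa> * (\<epsilon> * (r + 2)) \<le> \<rho>"
  proof -
    have "0 < 2 * \<kappa> * (r + 2)" using r_nonneg kappa_pos by simp
    then have "\<epsilon> * (2 * \<kappa> * (r + 2)) \<le> \<rho>" using le(6) by (simp only: pos_le_divide_eq)
    then show ?thesis by (simp only: mult_ac)
  qed
  show ?thesis
  proof (rule that[OF \<epsilon>])
    fix x v w :: 'a assume v: "v \<in> limiting_subdifferential f x" and near: "dist (x, v) (xb, 0) < \<epsilon>"
    have dx: "norm (x - xb) < \<epsilon>" and dv: "norm v < \<epsilon>"
      using near dist_fst_le[of "(x, v)" "(xb, 0)"] dist_snd_le[of "(x, v)" "(xb, 0)"] by (auto simp: dist_norm)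
    have "(r + 1) * norm (x - xb) \<le> (r + 1) * \<epsilon>" using dx r_nonneg by (intro mult_left_mono) auto
    then have sum: "norm v + (r + 1) * norm (x - xb) < \<epsilon> * (r + 2)" using dv by (simp add: algebra_simps)
    have x: "x \<in> ball xb \<gamma>" "x \<in> cball xb \<rho>"
      using dx le by (auto simp: dist_norm norm_minus_commute)
    have xm: "x = m v"
    proof (rule subgradient_is_argmin[OF v x(2)])
      show "x \<in> cball xb \<gamma>" "norm v \<le> \<rho>" using x(1) dv le(2) by auto
      show "f x < f xb + ereal \<rho>" using \<epsilon>0(2)[OF v] near le(1) by simp
      show "4 * (norm v + (r + 1) * norm (x - xb)) < \<delta>"
        by (rule less_le_trans[OF mult_strict_left_mono[OF sum] e1]) simp
      have "2 * \<kappa> * (norm v + (r + 1) * norm (x - xb)) \<le> 2 * \<kappa> * (\<epsilon> * (r + 2))"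
        using sum kappa_pos by (intro mult_left_mono) auto
      then show "2 * \<kappa> * (norm v + (r + 1) * norm (x - xb)) \<le> \<rho>" using e2 by (rule order_trans)
    qed
    have vd: "v \<in> ball 0 (\<delta> / 2)" using dv le(4) by simp
    then have "v \<in> ball 0 \<delta>" using delta_pos by simp
    show "ereal (1 / (2 * \<kappa>) * (norm w)\<^sup>2) \<le> second_subderivative f x v w"
    proof (rule second_subderivative_ge_quadratic[of f x "fm v"])
      show "f x = ereal (fm v)" unfolding xm by (rule f_m) fact
      have "\<forall>\<^sub>F u in nhds x. u \<in> ball xb \<gamma>" using x(1) by (intro eventually_nhds_in_open) auto
      moreover have "\<forall>\<^sub>F u in nhds x. u \<in> ball x (\<kappa> * \<delta>)"
        using kappa_pos delta_pos by (intro eventually_nhds_in_open) auto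
      ultimately show "\<forall>\<^sub>F u in nhds x. ereal (fm v + v \<bullet> (u - x) + 1 / (2 * \<kappa>) / 2 * (norm (u - x))\<^sup>2) \<le> f u"
      proof eventually_elim
        case (elim u)
        then show ?case unfolding xm
          by (intro growth_at_m[OF vd]) (auto simp: dist_norm norm_minus_commute xm[symmetric])
      qed
    qed
  qed
qed

end

theorem quad_bundle_positive_if_tilt_stable:
  assumes prox: "prox_regular f xb 0" and cont: "subdifferentially_continuous f xb 0"
    and tilt: "tilt_stable_local_minimizer f xb"
    and q: "q \<in> quad_bundle f xb 0" and w: "w \<noteq> 0"
  shows "0 < q w"
proof -
  obtain \<rho> r fb where "prox_regular_at f xb \<rho> r fb" using prox_regular_locale[OF prox] .
  then interpret prox_regular_at f xb \<rho> r fb .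
  obtain \<gamma> V m \<kappa> where tilt: "0 < \<gamma>" "tilt_argmin f xb \<gamma> 0 = {xb}" "open V" "0 \<in> V"
    "\<And>v. v \<in> V \<Longrightarrow> tilt_argmin f xb \<gamma> v = {m v}" "\<kappa>-lipschitz_on V m"
    using tilt unfolding tilt_stable_local_minimizer_def by blast
  obtain \<delta> where \<delta>: "0 < \<delta>" "ball 0 \<delta> \<subseteq> V" using tilt(3,4) open_contains_ball by blast
  \<comment> \<open>\<open>\<kappa>\<close> may be \<open>0\<close>, while the growth constant
    divides by it; \<open>\<kappa> + 1\<close> is a positive Lipschitz constant.\<close>
  interpret tilt_stable_at f xb \<rho> r fb \<gamma> "\<kappa> + 1" \<delta> m
  proof
    show "0 < \<kappa> + 1" using lipschitz_on_nonneg[OF tilt(6)] by simp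
    show "tilt_argmin f xb \<gamma> v = {m v}" if "v \<in> ball 0 \<delta>" for v using that \<delta>(2) by (intro tilt(5)) blast
    show "norm (m v - m w) \<le> (\<kappa> + 1) * norm (v - w)" if "v \<in> ball 0 \<delta>" "w \<in> ball 0 \<delta>" for v w
    proof -
      have "v \<in> V" "w \<in> V" using that \<delta>(2) by blast+
      from lipschitz_onD[OF tilt(6) this] show ?thesis using norm_ge_zero[of "v - w"]
        unfolding dist_norm distrib_right by linarith
    qed
  qed (use tilt \<delta> in auto)
  define c where "c = 1 / (2 * (\<kappa> + 1))"
  have c: "0 < c" using kappa_pos by (simp add: c_def)
  obtain \<epsilon> where \<epsilon>: "0 < \<epsilon>" "\<And>x v w. v \<in> limiting_subdifferential f x \<Longrightarrow> dist (x, v) (xb, 0) < \<epsilon> \<Longrightarrow>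
    ereal (c * (norm w)\<^sup>2) \<le> second_subderivative f x v w"
    using second_subderivative_ge_near[OF cont] unfolding c_def by blast
  obtain xs vs where gph: "\<And>k. (xs k, vs k) \<in> gph_subdifferential f" and lim: "(\<lambda>k. (xs k, vs k)) \<longlonglongrightarrow> (xb, 0)"
    and epi: "epi_converges (\<lambda>k. second_subderivative f (xs k) (vs k)) q" and GQF: "is_GQF q"
    using q unfolding quad_bundle_def by blast
  show ?thesis
  proof (cases "q w")
    case (real \<beta>)
    then have "(w, \<beta>) \<in> epi q" by (simp add: epi_def)
    \<comment> \<open>A point of \<open>epi q\<close> is a limit of points in the epigraphs of the
      approximating forms, where the quadratic lower bound eventually holds.\<close>
    then have "(w, \<beta>) \<in> PK_inner_limit (\<lambda>k. epi (second_subderivative f (xs k) (vs k)))"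
      using epi unfolding epi_converges_def PK_converges_def by blast
    then obtain zs where zs: "\<forall>\<^sub>F k in sequentially. zs k \<in> epi (second_subderivative f (xs k) (vs k))" "zs \<longlonglongrightarrow> (w, \<beta>)"
      unfolding PK_inner_limit_def by blast
    have "c * (norm w)\<^sup>2 \<le> \<beta>"
    proof (rule tendsto_le[OF sequentially_bot])
      show "(\<lambda>k. snd (zs k)) \<longlonglongrightarrow> \<beta>" using tendsto_snd[OF zs(2)] by simp
      have "(\<lambda>k. fst (zs k)) \<longlonglongrightarrow> w" using tendsto_fst[OF zs(2)] by simp
      then show "(\<lambda>k. c * (norm (fst (zs k)))\<^sup>2) \<longlonglongrightarrow> c * (norm w)\<^sup>2" by (intro tendsto_intros)
      show "\<forall>\<^sub>F k in sequentially. c * (norm (fst (zs k)))\<^sup>2 \<le> snd (zs k)"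
        using zs(1) tendstoD[OF lim \<epsilon>(1)]
      proof eventually_elim
        case (elim k)
        have "ereal (c * (norm (fst (zs k)))\<^sup>2) \<le> second_subderivative f (xs k) (vs k) (fst (zs k))"
          using gph[of k] elim(2) by (intro \<epsilon>(2)) (auto simp: gph_subdifferential_def)
        also have "\<dots> \<le> ereal (snd (zs k))" using elim(1) by (simp add: epi_def case_prod_unfold)
        finally show ?case by simp
      qed
    qed
    moreover have "0 < c * (norm w)\<^sup>2" using c w by simp
    ultimately show ?thesis unfolding real by simp
  next
    case MInf
    then show ?thesis using GQF by (simp add: is_GQF_def proper_fun_def)
  qed simp
qed

text \<open>Tilt stability makes every element of the bundle positive, in particular a minimal one;
  conversely a positive minimal element makes all others positive, since
  \<open>q w \<ge> qbar w > 0\<close>.\<close>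

theorem corollary4p3:
  fixes f :: "'a::euclidean_space \<Rightarrow> ereal" and xbar :: 'a
  assumes "prox_regular f xbar 0"
    and "subdifferentially_continuous f xbar 0"
    and "minimal_quad_bundle_property f xbar 0"
  shows "tilt_stable_local_minimizer f xbar \<longleftrightarrow>
    (\<exists>qbar. is_minimal_quad_bundle f xbar 0 qbar \<and> (\<forall>w. w \<noteq> 0 \<longrightarrow> qbar w > 0))"
proof
  assume tilt: "tilt_stable_local_minimizer f xbar"
  obtain qbar where qbar: "is_minimal_quad_bundle f xbar 0 qbar"
    using assms(3) by (auto simp: minimal_quad_bundle_property_def)
  moreover have "0 < qbar w" if "w \<noteq> 0" for w
    using quad_bundle_positive_if_tilt_stable[OF assms(1,2) tilt _ that] qbar
    by (simp add: is_minimal_quad_bundle_def)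
  ultimately show "\<exists>qbar. is_minimal_quad_bundle f xbar 0 qbar \<and> (\<forall>w. w \<noteq> 0 \<longrightarrow> qbar w > 0)" by blast
next
  assume "\<exists>qbar. is_minimal_quad_bundle f xbar 0 qbar \<and> (\<forall>w. w \<noteq> 0 \<longrightarrow> qbar w > 0)"
  then obtain qbar where min: "\<And>q w. q \<in> quad_bundle f xbar 0 \<Longrightarrow> qbar w \<le> q w"
    and pos: "\<And>w. w \<noteq> 0 \<Longrightarrow> 0 < qbar w"
    by (auto simp: is_minimal_quad_bundle_def)
  show "tilt_stable_local_minimizer f xbar"
    by (rule tilt_stable_if_quad_bundle_positive[OF assms(1)]) (rule less_le_trans[OF pos min])
qed

end
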